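(* Let $\Gamma$ be a countably infinite group with Kazhdan's property (T). Then $\Gamma$ has cost $1$, that is, $\operatorname{cost}(\Gamma)=1$.
   Context: A countable (discrete) group $\Gamma$ is a Kazhdan group (has Kazhdan's property (T)) if every unitary representation of $\Gamma$ on a Hilbert space that has almost-invariant vectors has a non-zero $\Gamma$-invariant vector. (A representation $\pi$ has almost-invariant vectors if for every finite $F\subseteq\Gamma$ and every $\delta>0$ there is a unit vector $v$ with $\|\pi(g)v-v\|<\delta$ for all $g\in F$.) For a countably infinite group $\Gamma$ this is equivalent, by a theorem of Glasner and Weiss which may be taken as the definition, to the following: the set of ergodic $\Gamma$-invariant Borel probability measures on $\{0,1\}^\Gamma$ (with $\Gamma$ acting by translation) is weak$^*$ closed in the set of all $\Gamma$-invariant Borel probability measures on $\{0,1\}^\Gamma$. Cost. Let $\Gamma$ be a countable group with identity $o$. A graph on $\Gamma$ is an undirected simple graph with vertex set $\Gamma$, encoded as an element $\omega\in\{0,1\}^{\Gamma\times\Gamma}$ with $\omega(a,b)=\omega(b,a)$, where $\omega(a,b)=1$ means that $a$ and $b$ are joined by an edge. Let $\mathcal{S}(\Gamma)\subseteq\{0,1\}^{\Gamma\times\Gamma}$ be the set of connected graphs with vertex set $\Gamma$, that is, those such that for all $a,b\in\Gamma$ there are $n\ge 0$ and $a=a_0,a_1,\dots,a_n=b$ in $\Gamma$ with $\omega(a_{i-1},a_i)=1$ for $1\le i\le n$. Equip $\{0,1\}^{\Gamma\times\Gamma}$ with the product topology and Borel $\sigma$-algebra, and $\mathcal{S}(\Gamma)$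 with the subspace structure. $\Gamma$ acts by $(\gamma\omega)(u,v)=\omega(\gamma^{-1}u,\gamma^{-1}v)$. Let $M(\Gamma,\mathcal{S}(\Gamma))$ be the set of $\Gamma$-invariant Borel probability measures on $\mathcal{S}(\Gamma)$. The cost of $\Gamma$ is $$\operatorname{cost}(\Gamma)=\frac12\inf\left\{\int_{\mathcal{S}(\Gamma)}\deg_\omega(o)\,d\mu(\omega):\mu\in M(\Gamma,\mathcal{S}(\Gamma))\right\},$$ where $\deg_\omega(o)$ is the degree of $o$ in the graph $\omega$. *)

theory Defs
  imports "HOL-Probability.Probability"
begin

text \<open>
  The group is a type of class \<^class>\<open>group_add\<close>, which does not assume commutativity; the
  operation is merely written additively. Hence 0 is the identity \<open>o\<close>, and \<open>- g + a\<close>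
  is \<open>\<gamma>\<^sup>-\<^sup>1 a\<close>. The set \<open>{0,1}\<close> is \<^typ>\<open>bool\<close>, so that the product topology and its Borel
  sets are the library's topology on functions and \<^const>\<open>borel\<close>.
\<close>

definition invariant_prob_measures ::
    "('g \<Rightarrow> 'x \<Rightarrow> 'x) \<Rightarrow> 'x measure \<Rightarrow> 'x measure set" where
  "invariant_prob_measures act B =
     {\<mu>. prob_space \<mu> \<and> sets \<mu> = sets B \<and> (\<forall>g. distr \<mu> B (act g) = \<mu>)}"

definition ergodic_prob_measures ::
    "('g \<Rightarrow> 'x \<Rightarrow> 'x) \<Rightarrow> 'x measure \<Rightarrow> 'x measure set" where
  "ergodic_prob_measures act B =
     {\<mu> \<in> invariant_prob_measures act B.
        \<forall>A\<in>sets B. (\<forall>g. act g -` A \<inter> space B = A) \<longrightarrow> measure \<mu> A = 0 \<or> measure \<mu> A = 1}"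


section \<open>Property (T)\<close>

definition translate :: "'g::group_add \<Rightarrow> ('g \<Rightarrow> bool) \<Rightarrow> ('g \<Rightarrow> bool)" where
  "translate g \<omega> = (\<lambda>a. \<omega> (- g + a))"

text \<open>
  The weak* topology on Borel probability measures: the coarsest topology for which
  \<open>\<mu> \<mapsto> \<integral>f d\<mu>\<close> is continuous for every continuous real function \<open>f\<close>. As the space
  \<open>{0,1}\<^sup>\<Gamma>\<close> is compact, all such \<open>f\<close> are bounded.
\<close>

definition weak_star_topology :: "('g \<Rightarrow> bool) measure topology" where
  "weak_star_topology =
     pullback_topology {\<mu>. prob_space \<mu> \<and> sets \<mu> = sets borel}
       (\<lambda>\<mu>. \<lambda>f\<in>{f. continuous_on UNIV f}. \<integral>\<omega>. f \<omega> \<partial>\<mu>)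
       (product_topology (\<lambda>_. euclideanreal) {f. continuous_on UNIV f})"

text \<open>
  For countably infinite groups, the theorem of Glasner and Weiss identifies this with the
  definition through unitary representations. For finite groups the two differ, so the
  constant is meaningful only together with the assumption that the group is countably infinite.
\<close>

definition kazhdan :: "'g::group_add itself \<Rightarrow> bool" where
  "kazhdan _ \<longleftrightarrow>
     closedin
       (subtopology weak_star_topology
          (invariant_prob_measures (translate :: 'g \<Rightarrow> _) borel))
       (ergodic_prob_measures (translate :: 'g \<Rightarrow> _) borel)"


section \<open>Cost\<close>

definition connected_graphs :: "('v \<times> 'v \<Rightarrow> bool) set" where
  "connected_graphs =
     {\<omega>. (\<forall>a b. \<omega> (a, b) = \<omega> (b, a)) \<and> (\<forall>a. \<not> \<omega> (a, a)) \<and>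
         (\<forall>a b. (\<lambda>u v. \<omega> (u, v))\<^sup>*\<^sup>* a b)}"

definition graph_act ::
    "'g::group_add \<Rightarrow> ('g \<times> 'g \<Rightarrow> bool) \<Rightarrow> ('g \<times> 'g \<Rightarrow> bool)" where
  "graph_act g \<omega> = (\<lambda>(a, b). \<omega> (- g + a, - g + b))"

text \<open>Counting measure, rather than \<^const>\<open>card\<close>, gives vertices of infinite degree the value \<open>\<infinity>\<close>.\<close>

definition graph_degree :: "('v \<times> 'v \<Rightarrow> bool) \<Rightarrow> 'v \<Rightarrow> ennreal" where
  "graph_degree \<omega> a = emeasure (count_space UNIV) {b. \<omega> (a, b)}"

definition cost :: "'g::group_add itself \<Rightarrow> ennreal" where
  "cost _ =
     (INF \<mu> \<in> invariant_prob_measures (graph_act :: 'g \<Rightarrow> _)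
                (restrict_space borel connected_graphs).
        \<integral>\<^sup>+ \<omega>. graph_degree \<omega> 0 \<partial>\<mu>) / 2"


section \<open>Measurability and well-formedness of the notions above\<close>

lemma measurable_translate: "translate g \<in> borel_measurable borel"
proof -
  have "continuous_on UNIV (translate g)"
    unfolding translate_def
    by (intro continuous_on_coordinatewise_then_product continuous_on_product_coordinates)
  then show ?thesis by (rule borel_measurable_continuous_onI)
qed

lemma graph_act_connected_graphs:
  assumes "\<omega> \<in> connected_graphs"
  shows "graph_act g \<omega> \<in> connected_graphs"
proof -
  have "(\<lambda>u v. graph_act g \<omega> (u, v))\<^sup>*\<^sup>* (g + a) (g + b)"
    if "(\<lambda>u v. \<omega> (u, v))\<^sup>*\<^sup>* a b" for a b
    using that
  proof induction
    case (step y z)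
    have "graph_act g \<omega> (g + y, g + z)"
      using step.hyps by (simp add: graph_act_def add.assoc[symmetric])
    with step.IH show ?case by (rule rtranclp.rtrancl_into_rtrancl)
  qed simp
  from this[of "- g + a" "- g + b" for a b]
  have "(\<lambda>u v. graph_act g \<omega> (u, v))\<^sup>*\<^sup>* a b" for a b
    using assms by (simp add: connected_graphs_def add.assoc[symmetric])
  then show ?thesis
    using assms by (auto simp: connected_graphs_def graph_act_def)
qed

lemma measurable_graph_act:
  "graph_act g \<in> measurable (restrict_space borel connected_graphs)
                   (restrict_space borel connected_graphs)"
proof -
  have "continuous_on UNIV (graph_act g)"
    unfolding graph_act_def case_prod_beta
    by (intro continuous_on_coordinatewise_then_product continuous_on_product_coordinates)
  then have "graph_act g \<in> borel_measurable borel"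
    by (rule borel_measurable_continuous_onI)
  then show ?thesis
    by (intro measurable_restrict_space3) (auto intro: graph_act_connected_graphs)
qed

lemma topspace_weak_star_topology:
  "topspace (weak_star_topology :: ('g \<Rightarrow> bool) measure topology) =
     {\<mu>. prob_space \<mu> \<and> sets \<mu> = sets borel}"
  by (auto simp: weak_star_topology_def topspace_pullback_topology)

end

theory Submission
  imports Defs
begin

text \<open>
  Upper bound. Start from an i.i.d. colouring of \<open>\<Gamma>\<close> with \<open>2k\<close> colours and repeatedly recolour its
  monochromatic \<open>S\<close>-clusters independently, for a fixed finite symmetric \<open>S \<subseteq> \<Gamma>\<close>. Each round
  contracts the probability that \<open>o\<close> and \<open>s \<in> S\<close> get different colours, so the two-colourings by
  parity of the colour approach \<open>(\<delta>\<^sub>0 + \<delta>\<^sub>1) / 2\<close> on \<open>S\<close>. Weak* closedness of the ergodic measures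
  provides one \<open>S\<close>, independent of \<open>k\<close>, for which ergodicity must therefore be lost in some round.
  At the last ergodic round the recolouring is not mixing: for some finite \<open>W\<close> the probability that
  \<open>W\<close> and \<open>gW\<close> meet a common cluster is bounded below uniformly in \<open>g\<close>. In the Hilbert space of
  square integrable functions of (configuration, cluster), the closed convex hull of the orbit of
  \<open>C \<mapsto> |C \<inter> W|\<close> then avoids 0, and its element of minimal norm is an invariant square summable
  weight on clusters. Choosing a cluster of a fixed colour at random with these weights yields an
  invariant random \<open>S\<close>-connected set of density at most \<open>1/k\<close>: by ergodicity the colouring itself is
  not biased by this choice. Joining every other vertex by a single edge to that set gives a
  connected graph of expected degree at most \<open>2 + |S|/k\<close>.

  Lower bound. Let \<open>B\<close> be a Bernoulli random subset of density \<open>1/K\<close>. Every vertex outside \<open>B\<close> points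
  to a neighbour closer to \<open>B\<close>; no edge is used in both directions, so by the mass transport
  principle the expected degree is at least \<open>2 (1 - 1/K)\<close>.
\<close>

section \<open>Independent colours\<close>

text \<open>The contraction comes from the clusters: two points of one cluster always agree after
  recolouring, points of different clusters still both receive colour 0 with probability
  \<open>(pmf p 0)^2\<close>, and for \<open>s\<close> in \<open>S\<close> equal colours at
  \<open>o\<close> and \<open>s\<close> already mean a common cluster. The factor depends on
  \<open>k\<close>, which is harmless since the number of rounds may depend on \<open>k\<close> as
  well; \<open>S\<close> may not, because |S|/k has to vanish. A round preserves the law of each
  single colour. So parity stays balanced at exactly 1/2, and the limit is the mixture and not a
  point mass, while each colour keeps density 1/(2k). From an ergodic colouring, ergodicity is lost
  only through long-range clusters: given the old colouring, events over \<open>W\<close> and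
  \<open>gW\<close> are independent unless a cluster meets both. The resulting bound on overlaps is
  one on inner products of orbit elements, which is why a Hilbert space enters: it survives convex
  combinations and keeps the minimal norm positive. Clusters come without equivariant
  representatives. They are handled through a non-equivariant transversal, and invariance is claimed
  only for laws and sums that do not see the choice.\<close>

definition shift :: "'g::group_add \<Rightarrow> ('g \<Rightarrow> 'c) \<Rightarrow> 'g \<Rightarrow> 'c" where
  "shift g x = (\<lambda>a. x (- g + a))"

lemma shift_apply [simp]: "shift g x (g + a) = x a"
  by (simp add: shift_def add.assoc[symmetric])

lemma shift_shift: "shift g (shift h x) = shift (g + h) x"
  by (simp add: shift_def fun_eq_iff minus_add add.assoc[symmetric])

lemma shift_0 [simp]: "shift 0 x = x"
  by (simp add: shift_def)

abbreviation colorings :: "('v \<Rightarrow> nat) measure" where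
  "colorings \<equiv> PiM UNIV (\<lambda>_. count_space UNIV)"

lemma space_colorings [simp]: "space colorings = UNIV"
  by (simp add: space_PiM PiE_UNIV_domain)

lemma measurable_shift [measurable]: "shift g \<in> measurable colorings colorings"
  unfolding shift_def by (intro measurable_PiM_single') auto

lemma pred_countable_Ex:
  fixes P :: "'i \<Rightarrow> 'a \<Rightarrow> bool"
  assumes "countable (UNIV :: 'i set)" "\<And>i. Measurable.pred M (P i)"
  shows "Measurable.pred M (\<lambda>x. \<exists>i. P i x)"
proof -
  have "{x \<in> space M. \<exists>i. P i x} = (\<Union>i. {x \<in> space M. P i x})" by auto
  also have "\<dots> \<in> sets M"
    using assms by (intro sets.countable_UN'') (auto simp: pred_def)
  finally show ?thesis by (simp add: pred_def)
qed

lemma pred_countable_All: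
  fixes P :: "'i \<Rightarrow> 'a \<Rightarrow> bool"
  assumes "countable (UNIV :: 'i set)" and [measurable]: "\<And>i. Measurable.pred M (P i)"
  shows "Measurable.pred M (\<lambda>x. \<forall>i. P i x)"
proof -
  have "Measurable.pred M (\<lambda>x. \<not> (\<exists>i. \<not> P i x))"
    by (intro pred_intros_logic pred_countable_Ex assms(1)) measurable
  then show ?thesis by simp
qed

definition iid :: "nat pmf \<Rightarrow> ('v \<Rightarrow> nat) measure" where
  "iid p = PiM UNIV (\<lambda>_. measure_pmf p)"

lemma sets_iid [simp, measurable_cong]: "sets (iid p) = sets colorings"
  unfolding iid_def by (intro sets_PiM_cong) auto

lemma space_iid [simp]: "space (iid p) = UNIV"
  using sets_eq_imp_space_eq[OF sets_iid] by simp

lemma prob_space_iid: "prob_space (iid p)"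
  unfolding iid_def by (intro prob_space_PiM measure_pmf.prob_space_axioms)

lemma measurable_compose_index [measurable]:
  "(\<lambda>u. u \<circ> r) \<in> measurable colorings colorings"
  by (intro measurable_PiM_single') (auto simp: o_def)

text \<open>Maps with the same fibres differ by an injection on the range of one of them, and
  injective reindexing preserves an i.i.d. law. Hence the law of \<open>u \<circ> r\<close> depends
  only on the partition that \<open>r\<close> induces, which frees the recolouring from the choice
  of representatives.\<close>

lemma distr_iid_comp_eq:
  fixes r r' :: "'a \<Rightarrow> 'v"
  assumes eq: "\<And>a b. r a = r b \<longleftrightarrow> r' a = r' b"
  shows "distr (iid p) colorings (\<lambda>u. u \<circ> r) = distr (iid p) colorings (\<lambda>u. u \<circ> r')"
proof -
  let ?M = "\<lambda>_::'v. measure_pmf p"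
  \<comment> \<open>\<open>\<sigma>\<close> carries \<open>r' a\<close> to \<open>r a\<close>,
    consistently because the fibres agree; off the range of \<open>r'\<close> its values are
    arbitrary.\<close>
  define \<sigma> where "\<sigma> = (\<lambda>v. r (SOME a. r' a = v))"
  have \<sigma>: "\<sigma> (r' a) = r a" for a
    unfolding \<sigma>_def using eq someI[of "\<lambda>b. r' b = r' a" a] by auto
  have 1: "distr (PiM UNIV ?M) (PiM (range r') ?M) (\<lambda>\<omega>. \<lambda>n\<in>range r'. \<omega> (f n)) = PiM (range r') ?M"
    if "inj_on f (range r')" for f
    using distr_PiM_reindex[of UNIV ?M f "range r'"] that
    by (auto simp: measure_pmf.prob_space_axioms)
  have inj: "inj_on \<sigma> (range r')"
    by (auto simp: inj_on_def \<sigma> eq)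
  let ?\<Psi> = "\<lambda>v a. v (r' a)"
  have \<Psi>: "?\<Psi> \<in> measurable (PiM (range r') ?M) colorings"
    by (intro measurable_PiM_single') auto
  have meas: "(\<lambda>\<omega>. \<lambda>n\<in>range r'. \<omega> (f n)) \<in> measurable (PiM UNIV ?M) (PiM (range r') ?M)" for f
    by measurable
  have 2: "distr (PiM UNIV ?M) colorings (\<lambda>u. u \<circ> (f \<circ> r')) =
        distr (PiM (range r') ?M) colorings ?\<Psi>" if "inj_on f (range r')" for f
    by (subst 1[OF that, symmetric], subst distr_distr[OF \<Psi> meas])
       (intro distr_cong, auto simp: fun_eq_iff)
  have "\<sigma> \<circ> r' = r" by (auto simp: \<sigma>)
  with 2[OF inj] 2[of id] show ?thesis
    by (simp add: iid_def)
qed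

section \<open>Cylinder events and Borel sets\<close>

definition determined_on :: "'v set \<Rightarrow> ('v \<Rightarrow> 'c) set \<Rightarrow> bool" where
  "determined_on W A \<longleftrightarrow> (\<forall>x y. (\<forall>a\<in>W. x a = y a) \<longrightarrow> x \<in> A \<longrightarrow> y \<in> A)"

lemma determined_onD: "determined_on W A \<Longrightarrow> (\<And>a. a \<in> W \<Longrightarrow> x a = y a) \<Longrightarrow> x \<in> A \<longleftrightarrow> y \<in> A"
  unfolding determined_on_def by metis

text \<open>The two events read the i.i.d. family through the images of \<open>W\<close> and
  \<open>W'\<close> under \<open>r\<close>, which are disjoint. For \<open>r = rep x\<close> the
  disjointness says that no class meets both windows.\<close>

lemma iid_comp_indep:
  fixes r :: "'a \<Rightarrow> 'v"
  assumes disj: "r ` W \<inter> r ` W' = {}"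
    and A: "A \<in> sets colorings" "determined_on W A"
    and B: "B \<in> sets colorings" "determined_on W' B"
  shows "measure (distr (iid p) colorings (\<lambda>u. u \<circ> r)) (A \<inter> B) =
    measure (distr (iid p) colorings (\<lambda>u. u \<circ> r)) A * measure (distr (iid p) colorings (\<lambda>u. u \<circ> r)) B"
proof -
  let ?M = "\<lambda>_::'v. measure_pmf p"
  let ?P = "iid p :: ('v \<Rightarrow> nat) measure"
  interpret P: prob_space ?P by (rule prob_space_iid)
  interpret PP: prob_space "PiM UNIV ?M" using P.prob_space_axioms by (simp add: iid_def)
  have "P.indep_vars ?M (\<lambda>i \<omega>. \<omega> i) UNIV"
    unfolding iid_def
  proof (subst PP.indep_vars_iff_distr_eq_PiM)
    show "distr (PiM UNIV ?M) (PiM UNIV ?M) (\<lambda>x. \<lambda>i\<in>UNIV. x i) =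
      PiM UNIV (\<lambda>i. distr (PiM UNIV ?M) (measure_pmf p) (\<lambda>\<omega>. \<omega> i))"
      using distr_PiM_component[of UNIV ?M, OF measure_pmf.prob_space_axioms]
      by (simp add: distr_id2 restrict_UNIV)
  qed auto
  from P.indep_var_restrict[OF this disj]
  have ind: "P.indep_var (PiM (r ` W) ?M) (\<lambda>\<omega>. \<lambda>i\<in>r ` W. \<omega> i) (PiM (r ` W') ?M) (\<lambda>\<omega>. \<lambda>i\<in>r ` W'. \<omega> i)"
    by simp
  \<comment> \<open>Turns a family indexed by the image of a window back into a colouring. The value
    0 outside the window is a mere default, as the events are determined on the window.\<close>
  define e where "e = (\<lambda>W v a. if a \<in> W then v (r a) else 0 :: nat)"
  have e: "e V \<in> measurable (PiM (r ` V) ?M) colorings" for V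
  proof (unfold e_def, rule measurable_PiM_single')
    fix a
    show "(\<lambda>v. if a \<in> V then v (r a) else 0) \<in> measurable (PiM (r ` V) ?M) (count_space UNIV)"
      by (cases "a \<in> V") auto
  qed auto
  have e_eq: "u \<circ> r \<in> D \<longleftrightarrow> e V (\<lambda>i\<in>r ` V. u i) \<in> D" if "determined_on V D" for u V D
    using that by (rule determined_onD) (auto simp: e_def)
  define EA where "EA = e W -` A \<inter> space (PiM (r ` W) ?M)"
  define EB where "EB = e W' -` B \<inter> space (PiM (r ` W') ?M)"
  have EA: "EA \<in> sets (PiM (r ` W) ?M)" and EB: "EB \<in> sets (PiM (r ` W') ?M)"
    unfolding EA_def EB_def using A B measurable_sets[OF e] by auto
  have a: "{u. u \<circ> r \<in> A} = (\<lambda>\<omega>. \<lambda>i\<in>r ` W. \<omega> i) -` EA \<inter> space ?P"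
    and b: "{u. u \<circ> r \<in> B} = (\<lambda>\<omega>. \<lambda>i\<in>r ` W'. \<omega> i) -` EB \<inter> space ?P"
    and ab: "{u. u \<circ> r \<in> A \<inter> B} =
      (\<lambda>x. ((\<lambda>i\<in>r ` W. x i), (\<lambda>i\<in>r ` W'. x i))) -` (EA \<times> EB) \<inter> space ?P"
    unfolding EA_def EB_def using e_eq[OF A(2)] e_eq[OF B(2)] by (auto simp: space_PiM)
  have "measure (distr ?P colorings (\<lambda>u. u \<circ> r)) D = measure ?P {u. u \<circ> r \<in> D}"
    if "D \<in> sets colorings" for D
    using that by (subst measure_distr) (auto simp: vimage_def)
  note m = this
  from A B have "A \<inter> B \<in> sets colorings" by auto
  then show ?thesis
    using P.indep_varD[OF ind EA EB] m[OF A(1)] m[OF B(1)] m[of "A \<inter> B"]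
    unfolding a b ab by metis
qed

text \<open>Over a countable index set there are only countably many finite cylinders, so every open
  set is a countable union of them. The identification lets Borel measurability be checked
  coordinate by coordinate.\<close>

lemma borel_eq_PiM_bool:
  assumes "countable (UNIV :: 'v set)"
  shows "sets (borel :: ('v \<Rightarrow> bool) measure) = sets (PiM UNIV (\<lambda>_. count_space UNIV))"
proof
  let ?P = "PiM (UNIV :: 'v set) (\<lambda>_. count_space (UNIV :: bool set))"
  define cyl where "cyl = (\<lambda>xs :: ('v \<times> bool) list. {x. \<forall>(i, b)\<in>set xs. x i = b})"
  have cyl: "cyl xs \<in> sets ?P" for xs
  proof -
    have "Measurable.pred ?P (\<lambda>x. \<forall>p\<in>set xs. x (fst p) = snd p)"
      by measurable
    then show ?thesis
      by (simp add: cyl_def pred_def space_PiM PiE_UNIV_domain case_prod_beta)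
  qed
  show "sets (borel :: ('v \<Rightarrow> bool) measure) \<subseteq> sets ?P"
  proof -
    have "U \<in> sets ?P" if U: "open U" for U :: "('v \<Rightarrow> bool) set"
    proof -
      have "\<exists>xs. x \<in> cyl xs \<and> cyl xs \<subseteq> U" if x: "x \<in> U" for x
      proof -
        from product_topology_open_contains_basis[of "\<lambda>_. euclidean" UNIV U x] U x
        obtain X where X: "x \<in> (\<Pi>\<^sub>E i\<in>UNIV. X i)" "finite {i. X i \<noteq> UNIV}" "(\<Pi>\<^sub>E i\<in>UNIV. X i) \<subseteq> U"
          by (auto simp: open_fun_def)
        obtain xs where "set xs = {i. X i \<noteq> UNIV}"
          using finite_list[OF X(2)] by blast
        moreover have "y i \<in> X i" if "y \<in> cyl (map (\<lambda>i. (i, x i)) xs)" "set xs = {i. X i \<noteq> UNIV}" for y i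
          using X(1) that by (cases "X i = UNIV") (auto simp: cyl_def PiE_UNIV_domain Pi_iff)
        ultimately have "x \<in> cyl (map (\<lambda>i. (i, x i)) xs)" "cyl (map (\<lambda>i. (i, x i)) xs) \<subseteq> (\<Pi>\<^sub>E i\<in>UNIV. X i)"
          by (auto simp: cyl_def PiE_UNIV_domain Pi_iff)
        with X(3) show ?thesis by blast
      qed
      then have "U = (\<Union>xs\<in>{xs. cyl xs \<subseteq> U}. cyl xs)" by blast
      moreover have "countable (UNIV :: ('v \<times> bool) list set)"
        using countable_lists[of "UNIV :: ('v \<times> bool) set"] assms
          countable_SIGMA[of "UNIV :: 'v set" "\<lambda>_. UNIV :: bool set"]
        by (simp add: lists_UNIV)
      ultimately show ?thesis
        using cyl by (metis (no_types, lifting) countable_subset sets.countable_UN'' top_greatest)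
    qed
    then show ?thesis
      unfolding borel_def using sets.sigma_sets_subset[of "{S. open S}" ?P]
      by (auto simp: space_PiM PiE_UNIV_domain)
  qed
  have "(\<lambda>x. x) \<in> measurable (borel :: ('v \<Rightarrow> bool) measure) ?P"
  proof (rule measurable_PiM_single')
    fix i :: 'v
    have "(\<lambda>x::'v \<Rightarrow> bool. x i) \<in> borel_measurable borel"
      by (intro borel_measurable_continuous_onI continuous_on_product_coordinates)
    moreover have "sets (borel :: bool measure) = sets (count_space UNIV)"
      by (simp add: sets_borel_eq_count_space)
    ultimately show "(\<lambda>x::'v \<Rightarrow> bool. x i) \<in> measurable borel (count_space UNIV)"
      using measurable_cong_sets[OF refl] by blast
  qed auto
  from measurable_sets[OF this] show "sets ?P \<subseteq> sets (borel :: ('v \<Rightarrow> bool) measure)"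
    by auto
qed

section \<open>Recolouring the classes of an equivariant equivalence relation\<close>

lemma measurable_iid_compose: "(\<lambda>u. u \<circ> r) \<in> measurable (iid p) colorings"
  using measurable_compose_index measurable_cong_sets[OF sets_iid refl] by blast

text \<open>The events with finite-window approximations form a sigma-algebra that contains the
  coordinate events. The induction over \<open>sigma_sets\<close> verifies this, truncating a
  countable union first.\<close>

lemma approx_determined_on:
  fixes \<nu> :: "('v \<Rightarrow> nat) measure"
  assumes "finite_measure \<nu>" and sets: "sets \<nu> = sets colorings" and A: "A \<in> sets colorings" and "e > 0"
  shows "\<exists>W B. finite W \<and> B \<in> sets colorings \<and> determined_on W B \<and>
    measure \<nu> ((A - B) \<union> (B - A)) < e"
proof -
  interpret finite_measure \<nu> by fact
  have space: "space \<nu> = UNIV" using sets_eq_imp_space_eq[OF sets] by simp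
  have "A \<in> sigma_sets UNIV {{f. f i \<in> S} |i S. True}"
    using A by (simp add: sets_PiM_single PiE_UNIV_domain)
  from this \<open>e > 0\<close> show ?thesis
  proof (induction arbitrary: e)
    case (Basic A)
    then obtain i S where "A = {f. f i \<in> S}" by auto
    then have "finite {i} \<and> A \<in> sets colorings \<and> determined_on {i} A \<and> measure \<nu> ((A - A) \<union> (A - A)) < e"
      using Basic(2) by (auto simp: determined_on_def sets_PiM_single PiE_UNIV_domain intro!: sigma_sets.Basic)
    then show ?case by blast
  next
    case Empty
    have "finite {} \<and> {} \<in> sets colorings \<and> determined_on {} {} \<and> measure \<nu> (({} - {}) \<union> ({} - {})) < e"
      using Empty by (auto simp: determined_on_def)
    then show ?case by blast
  next
    case (Compl A)
    from Compl.IH[OF Compl.prems] obtain W B where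
      WB: "finite W" "B \<in> sets colorings" "determined_on W B" "measure \<nu> ((A - B) \<union> (B - A)) < e" by blast
    moreover have "UNIV - B \<in> sets colorings" using sets.compl_sets[OF WB(2)] by simp
    moreover have "determined_on W (UNIV - B)"
      using WB(3) unfolding determined_on_def by (metis DiffD2 DiffI UNIV_I)
    moreover have "((UNIV - A) - (UNIV - B)) \<union> ((UNIV - B) - (UNIV - A)) = (A - B) \<union> (B - A)" by auto
    ultimately show ?case by metis
  next
    case (Union A)
    have Am: "A i \<in> sets \<nu>" for i
      using Union(1) by (simp add: sets sets_PiM_single PiE_UNIV_domain)
    have "(\<lambda>n. measure \<nu> (\<Union>i\<in>{..n}. A i)) \<longlonglongrightarrow> measure \<nu> (\<Union>n. \<Union>i\<in>{..n}. A i)"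
      using Am by (intro finite_Lim_measure_incseq) (auto simp: incseq_def, fastforce)
    moreover have U: "(\<Union>n. \<Union>i\<in>{..n}. A i) = (\<Union>i. A i)" by auto
    ultimately have "eventually (\<lambda>n. dist (measure \<nu> (\<Union>i\<in>{..n}. A i)) (measure \<nu> (\<Union>i. A i)) < e / 2) sequentially"
      using Union.prems by (intro tendstoD) auto
    then obtain n where n: "\<bar>measure \<nu> (\<Union>i\<in>{..n}. A i) - measure \<nu> (\<Union>i. A i)\<bar> < e / 2"
      by (auto simp: dist_real_def eventually_sequentially)
    \<comment> \<open>Half of \<open>e\<close> pays for the truncation; the other half is shared by
      the \<open>n + 1\<close> remaining sets.\<close>
    have "\<exists>W B. finite W \<and> B \<in> sets colorings \<and> determined_on W B \<and>
      measure \<nu> ((A i - B) \<union> (B - A i)) < e / (2 * (real n + 1))" for i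
      using Union.IH[of "e / (2 * (real n + 1))" i] Union.prems by (auto simp: field_simps)
    then obtain W B where WB: "\<And>i. finite (W i)" "\<And>i. B i \<in> sets colorings" "\<And>i. determined_on (W i) (B i)"
      "\<And>i. measure \<nu> ((A i - B i) \<union> (B i - A i)) < e / (2 * (real n + 1))"
      by metis
    let ?W = "\<Union>i\<in>{..n}. W i" and ?B = "\<Union>i\<in>{..n}. B i"
    have Bm: "B i \<in> sets \<nu>" for i using WB by (simp add: sets)
    have "measure \<nu> (((\<Union>i. A i) - ?B) \<union> (?B - (\<Union>i. A i)))
      \<le> measure \<nu> (((\<Union>i. A i) - (\<Union>i\<in>{..n}. A i)) \<union> (\<Union>i\<in>{..n}. (A i - B i) \<union> (B i - A i)))"
      using Am Bm by (intro finite_measure_mono) auto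
    also have "\<dots> \<le> measure \<nu> ((\<Union>i. A i) - (\<Union>i\<in>{..n}. A i)) + measure \<nu> (\<Union>i\<in>{..n}. (A i - B i) \<union> (B i - A i))"
      using Am Bm by (intro measure_Un_le) auto
    also have "measure \<nu> ((\<Union>i. A i) - (\<Union>i\<in>{..n}. A i)) < e / 2"
      using n Am by (subst finite_measure_Diff) (auto simp: abs_if split: if_splits)
    also have "measure \<nu> (\<Union>i\<in>{..n}. (A i - B i) \<union> (B i - A i)) \<le> (\<Sum>i\<in>{..n}. measure \<nu> ((A i - B i) \<union> (B i - A i)))"
      using Am Bm by (intro finite_measure_subadditive_finite) auto
    also have "\<dots> \<le> (\<Sum>i\<in>{..n}. e / (2 * (real n + 1)))"
      using WB(4) by (intro sum_mono) (auto intro: less_imp_le)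
    also have "\<dots> = e / 2" by (simp add: field_simps)
    finally have "measure \<nu> (((\<Union>i. A i) - ?B) \<union> (?B - (\<Union>i. A i))) < e" by simp
    moreover have "finite ?W" "?B \<in> sets colorings"
      using WB by auto
    moreover have "determined_on ?W ?B"
      unfolding determined_on_def
    proof safe
      fix x y i assume "\<forall>a\<in>?W. x a = y a" "x \<in> B i" "i \<le> n"
      then have "y \<in> B i" using determined_onD[OF WB(3), of i x y] by auto
      with \<open>i \<le> n\<close> show "y \<in> ?B" by auto
    qed
    ultimately show ?case by blast
  qed
qed

lemma invariant_measure_shift:
  assumes "\<mu> \<in> invariant_prob_measures shift colorings" "A \<in> sets colorings"
  shows "measure \<mu> {x. shift g x \<in> A} = measure \<mu> A"
proof -
  have \<mu>: "distr \<mu> colorings (shift g) = \<mu>" "sets \<mu> = sets colorings"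
    using assms by (auto simp: invariant_prob_measures_def)
  then have "shift g \<in> measurable \<mu> colorings" "space \<mu> = UNIV"
    using measurable_cong_sets[OF \<mu>(2) refl] sets_eq_imp_space_eq[OF \<mu>(2)] by auto
  then have "measure (distr \<mu> colorings (shift g)) A = measure \<mu> {x. shift g x \<in> A}"
    using assms(2) by (subst measure_distr) (auto simp: vimage_def)
  with \<mu> show ?thesis by simp
qed

text \<open>The sets where \<open>f\<close> lies strictly below or strictly above its mean are
  invariant, and neither can have full measure, since integrating the strict inequality gives a
  contradiction. The sign \<open>s\<close> treats both at once.\<close>

lemma ergodic_AE_eq_integral:
  fixes f :: "('g::group_add \<Rightarrow> nat) \<Rightarrow> real"
  assumes erg: "\<mu> \<in> ergodic_prob_measures shift colorings"
    and int: "integrable \<mu> f" and f: "\<And>g x. f (shift g x) = f x"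
  shows "AE x in \<mu>. f x = integral\<^sup>L \<mu> f"
proof -
  have "prob_space \<mu>" and sets: "sets \<mu> = sets colorings"
    using erg by (auto simp: ergodic_prob_measures_def invariant_prob_measures_def)
  then interpret prob_space \<mu> by simp
  have space: "space \<mu> = UNIV" using sets_eq_imp_space_eq[OF sets] by simp
  have null: "AE x in \<mu>. \<not> s * f x < s * integral\<^sup>L \<mu> f" for s :: real
  proof -
    let ?A = "{x. s * f x < s * integral\<^sup>L \<mu> f}"
    have meas: "?A \<in> sets \<mu>"
    proof -
      have [measurable]: "f \<in> borel_measurable \<mu>" using int by auto
      have "{x \<in> space \<mu>. s * f x < s * integral\<^sup>L \<mu> f} \<in> sets \<mu>" by measurable
      then show ?thesis by (simp add: space)
    qed
    moreover have "\<forall>g. shift g -` ?A = ?A" using f by auto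
    ultimately have "measure \<mu> ?A = 0 \<or> measure \<mu> ?A = 1"
      using erg sets by (simp add: ergodic_prob_measures_def)
    then show ?thesis
    proof
      assume "measure \<mu> ?A = 1"
      then have less: "AE x in \<mu>. s * f x < s * integral\<^sup>L \<mu> f"
        using prob_Collect_eq_1[of "\<lambda>x. s * f x < s * integral\<^sup>L \<mu> f"] meas space by simp
      have "integral\<^sup>L \<mu> (\<lambda>x. s * integral\<^sup>L \<mu> f - s * f x) = 0"
        using int prob_space by simp
      moreover have "AE x in \<mu>. 0 \<le> s * integral\<^sup>L \<mu> f - s * f x"
        using less by eventually_elim simp
      ultimately have "AE x in \<mu>. s * integral\<^sup>L \<mu> f - s * f x = 0"
        using int by (subst (asm) integral_nonneg_eq_0_iff_AE) auto
      with less have "AE x in \<mu>. False" by eventually_elim simp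
      then show ?thesis by simp
    next
      assume "measure \<mu> ?A = 0"
      then show ?thesis
        using prob_Collect_eq_0[of "\<lambda>x. s * f x < s * integral\<^sup>L \<mu> f"] meas space by simp
    qed
  qed
  from null[of 1] null[of "-1"] show ?thesis by eventually_elim simp
qed

text \<open>Instantiated twice: by equality, whose recolouring is the i.i.d. colouring, and by the
  monochromatic clusters of a colouring.\<close>

locale equivariant_equiv =
  fixes E :: "('g::group_add \<Rightarrow> nat) \<Rightarrow> 'g \<Rightarrow> 'g \<Rightarrow> bool"
  assumes countable_group: "countable (UNIV :: 'g set)"
    and equiv: "equivp (E x)"
    and measurable_E [measurable]: "Measurable.pred colorings (\<lambda>x. E x a b)"
    and equivariant: "E (shift g x) (g + a) (g + b) = E x a b"
begin

lemma E_refl: "E x a a"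
  using equiv by (rule equivp_reflp)

lemma E_sym: "E x a b \<Longrightarrow> E x b a"
  using equiv by (rule equivp_symp)

lemma E_trans: "E x a b \<Longrightarrow> E x b c \<Longrightarrow> E x a c"
  using equiv by (rule equivp_transp)

lemma equivariant': "E (shift g x) a b = E x (- g + a) (- g + b)"
  using equivariant[of g x "- g + a" "- g + b"] by (simp add: add.assoc[symmetric])

definition rep :: "('g \<Rightarrow> nat) \<Rightarrow> 'g \<Rightarrow> 'g" where
  "rep x a = from_nat_into UNIV (LEAST n. E x a (from_nat_into UNIV n))"

lemma E_rep: "E x a (rep x a)"
proof -
  have "\<exists>n. E x a (from_nat_into UNIV n)"
    using E_refl[of x a] from_nat_into_surj[OF countable_group, of a] by (metis UNIV_I)
  then show ?thesis unfolding rep_def by (rule LeastI_ex)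
qed

lemma rep_eq_iff: "rep x a = rep x b \<longleftrightarrow> E x a b"
proof
  assume "rep x a = rep x b"
  then show "E x a b" using E_rep[of x a] E_rep[of x b] E_sym E_trans by metis
next
  assume "E x a b"
  then have "E x a = E x b" using E_sym E_trans by blast
  then show "rep x a = rep x b" by (simp add: rep_def)
qed

lemma measurable_rep [measurable]: "(\<lambda>x. rep x a) \<in> measurable colorings (count_space UNIV)"
  unfolding rep_def by measurable

definition law :: "nat pmf \<Rightarrow> ('g \<Rightarrow> nat) \<Rightarrow> ('g \<Rightarrow> nat) measure" where
  "law p x = distr (iid p) colorings (\<lambda>u. u \<circ> rep x)"

text \<open>The choice of representatives by \<open>rep\<close> is not equivariant. The law of the recolouring
  nevertheless is, because it depends only on the partition into classes.\<close>

definition recolor :: "nat pmf \<Rightarrow> ('g \<Rightarrow> nat) measure \<Rightarrow> ('g \<Rightarrow> nat) measure" where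
  "recolor p \<mu> = distr (\<mu> \<Otimes>\<^sub>M iid p) colorings (\<lambda>(x, u). u \<circ> rep x)"

lemma measurable_recolor: "(\<lambda>(x, u). u \<circ> rep x) \<in> measurable (colorings \<Otimes>\<^sub>M colorings) colorings"
proof (intro measurable_PiM_single')
  fix a
  show "(\<lambda>xu. (case xu of (x, u) \<Rightarrow> u \<circ> rep x) a) \<in>
      measurable (colorings \<Otimes>\<^sub>M colorings) (count_space UNIV)"
    unfolding case_prod_beta o_def
    by (rule measurable_compose_countable'[where f = "\<lambda>v xu. snd xu v", OF _ _ countable_group])
       measurable
qed auto

lemma prob_space_law: "prob_space (law p x)"
  unfolding law_def by (rule prob_space.prob_space_distr[OF prob_space_iid measurable_iid_compose])

lemma sets_law [simp, measurable_cong]: "sets (law p x) = sets colorings"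
  by (simp add: law_def)

lemma sets_recolor [simp, measurable_cong]: "sets (recolor p \<mu>) = sets colorings"
  by (simp add: recolor_def)

text \<open>Translating a recoloured configuration amounts to composing \<open>u\<close> with a
  translated copy of \<open>rep x\<close>. This map has the same fibres as
  \<open>rep (shift g x)\<close>, though it need not be equal to it.\<close>

lemma law_shift: "law p (shift g x) = distr (law p x) colorings (shift g)"
proof -
  have "distr (law p x) colorings (shift g) = distr (iid p) colorings (\<lambda>u. u \<circ> (\<lambda>a. rep x (- g + a)))"
    unfolding law_def distr_distr[OF measurable_shift measurable_iid_compose]
    by (simp add: shift_def comp_def)
  also have "\<dots> = law p (shift g x)"
    unfolding law_def by (rule distr_iid_comp_eq) (simp add: rep_eq_iff equivariant')
  finally show ?thesis ..
qed

lemma measure_law: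
  "A \<in> sets colorings \<Longrightarrow> measure (law p x) A = measure (iid p) {u. u \<circ> rep x \<in> A}"
  unfolding law_def by (subst measure_distr) (auto simp: vimage_def)

lemma measure_law_shift:
  "A \<in> sets colorings \<Longrightarrow> measure (law p (shift g x)) A = measure (law p x) {y. shift g y \<in> A}"
  unfolding law_shift by (subst measure_distr) (auto simp: vimage_def law_def)

context
  fixes \<mu> :: "('g \<Rightarrow> nat) measure"
  assumes inv: "\<mu> \<in> invariant_prob_measures shift colorings"
begin

lemma prob_mu: "prob_space \<mu>" and sets_mu [simp, measurable_cong]: "sets \<mu> = sets colorings"
  and distr_mu: "distr \<mu> colorings (shift g) = \<mu>"
  using inv by (auto simp: invariant_prob_measures_def)

lemma space_mu [simp]: "space \<mu> = UNIV"
  using sets_eq_imp_space_eq[OF sets_mu] by simp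

lemma measurable_measure_law [measurable]:
  assumes [measurable]: "A \<in> sets colorings"
  shows "(\<lambda>x. measure (law p x) A) \<in> borel_measurable colorings"
proof -
  interpret P: prob_space "iid p :: ('g \<Rightarrow> nat) measure" by (rule prob_space_iid)
  have "{(x, u). u \<circ> rep x \<in> A} \<in> sets (colorings \<Otimes>\<^sub>M iid p)"
    using measurable_sets[OF measurable_recolor assms]
    by (simp add: space_pair_measure vimage_def case_prod_beta' cong: sets_pair_measure_cong)
  from P.measurable_emeasure_Pair[OF this]
  show ?thesis
    by (subst measure_law[OF assms]) (simp add: measure_def vimage_def)
qed

lemma measure_recolor:
  assumes [measurable]: "A \<in> sets colorings"
  shows "measure (recolor p \<mu>) A = (\<integral>x. measure (law p x) A \<partial>\<mu>)"
proof -
  interpret P: prob_space "iid p :: ('g \<Rightarrow> nat) measure" by (rule prob_space_iid)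
  interpret M: prob_space \<mu> by (rule prob_mu)
  interpret PM: pair_prob_space \<mu> "iid p :: ('g \<Rightarrow> nat) measure" ..
  have s: "{(x, u). u \<circ> rep x \<in> A} \<in> sets (\<mu> \<Otimes>\<^sub>M iid p)"
    using measurable_sets[OF measurable_recolor assms]
    by (simp add: space_pair_measure vimage_def case_prod_beta' cong: sets_pair_measure_cong)
  have "emeasure (recolor p \<mu>) A = emeasure (\<mu> \<Otimes>\<^sub>M iid p) {(x, u). u \<circ> rep x \<in> A}"
    unfolding recolor_def using measurable_recolor assms
    by (subst emeasure_distr) (auto simp: vimage_def space_pair_measure case_prod_beta' cong: measurable_cong_sets sets_pair_measure_cong)
  also have "\<dots> = (\<integral>\<^sup>+x. emeasure (iid p) {u. u \<circ> rep x \<in> A} \<partial>\<mu>)"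
    by (subst P.emeasure_pair_measure_alt[OF s]) (simp add: vimage_def)
  also have "\<dots> = (\<integral>\<^sup>+x. ennreal (measure (law p x) A) \<partial>\<mu>)"
    by (simp add: measure_law P.emeasure_eq_measure)
  finally have "measure (recolor p \<mu>) A = enn2real (\<integral>\<^sup>+x. ennreal (measure (law p x) A) \<partial>\<mu>)"
    by (simp add: measure_def)
  then show ?thesis
    by (subst integral_eq_nn_integral) auto
qed

lemma prob_space_recolor: "prob_space (recolor p \<mu>)"
proof -
  interpret P: prob_space "iid p :: ('g \<Rightarrow> nat) measure" by (rule prob_space_iid)
  interpret M: prob_space \<mu> by (rule prob_mu)
  interpret PM: pair_prob_space \<mu> "iid p :: ('g \<Rightarrow> nat) measure" ..
  show ?thesis
    unfolding recolor_def using measurable_recolor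
    by (intro PM.prob_space_distr) (simp cong: measurable_cong_sets sets_pair_measure_cong)
qed

lemma integrable_law: "A \<in> sets colorings \<Longrightarrow> integrable \<mu> (\<lambda>x. measure (law p x) A)"
  using prob_space.finite_measure[OF prob_mu] prob_space.prob_le_1[OF prob_space_law, of p]
  by (intro finite_measure.integrable_const_bound[where B = 1]) auto

lemma recolor_invariant: "recolor p \<mu> \<in> invariant_prob_measures shift colorings"
proof -
  interpret R: prob_space "recolor p \<mu>" by (rule prob_space_recolor)
  have "distr (recolor p \<mu>) colorings (shift g) = recolor p \<mu>" for g
  proof (rule measure_eqI)
    interpret D: prob_space "distr (recolor p \<mu>) colorings (shift g)"
      by (rule R.prob_space_distr) measurable
    fix A assume "A \<in> sets (distr (recolor p \<mu>) colorings (shift g))"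
    then have A [measurable]: "A \<in> sets colorings" by simp
    have sA: "{y. shift g y \<in> A} \<in> sets colorings"
      using measurable_sets[OF measurable_shift A] by (simp add: vimage_def)
    have "measure (distr (recolor p \<mu>) colorings (shift g)) A = measure (recolor p \<mu>) {y. shift g y \<in> A}"
      by (subst measure_distr) (auto simp: vimage_def recolor_def)
    also have "\<dots> = (\<integral>x. measure (law p (shift g x)) A \<partial>\<mu>)"
      by (simp add: measure_recolor sA measure_law_shift)
    also have "\<dots> = (\<integral>x. measure (law p x) A \<partial>(distr \<mu> colorings (shift g)))"
      by (subst integral_distr) auto
    finally show "emeasure (distr (recolor p \<mu>) colorings (shift g)) A = emeasure (recolor p \<mu>) A"
      by (simp add: D.emeasure_eq_measure R.emeasure_eq_measure distr_mu measure_recolor)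
  qed simp
  then show ?thesis
    by (simp add: invariant_prob_measures_def prob_space_recolor)
qed

end

text \<open>Given the old colouring, an invariant event \<open>A\<close> has a constant conditional
  probability \<open>a\<close>, by ergodicity of \<open>\<mu>\<close>. Approximate \<open>A\<close>
  by an event \<open>B\<close> over a finite window \<open>W\<close>. Outside an event of small
  probability no class meets both \<open>W\<close> and \<open>gW\<close>, so \<open>B\<close> and
  its translate are conditionally independent; both approximate \<open>A\<close>, whence
  \<open>a = a * a\<close>.\<close>

lemma recolor_ergodic:
  assumes erg: "\<mu> \<in> ergodic_prob_measures shift colorings"
    and mixing: "\<And>W e. finite W \<Longrightarrow> e > 0 \<Longrightarrow>
      \<exists>g. measure \<mu> {x. \<exists>a\<in>W. \<exists>b\<in>W. E x a (g + b)} < e"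
  shows "recolor p \<mu> \<in> ergodic_prob_measures shift colorings"
proof -
  have inv: "\<mu> \<in> invariant_prob_measures shift colorings"
    using erg by (simp add: ergodic_prob_measures_def)
  note [measurable_cong] = sets_mu[OF inv]
  let ?\<nu> = "recolor p \<mu>"
  interpret M: prob_space \<mu> by (rule prob_mu[OF inv])
  interpret R: prob_space ?\<nu> by (rule prob_space_recolor[OF inv])
  have "measure ?\<nu> A = 0 \<or> measure ?\<nu> A = 1"
    if A [measurable]: "A \<in> sets colorings" and A_inv: "\<And>g. shift g -` A = A" for A
  proof -
    define a where "a = measure ?\<nu> A"
    have a: "a = (\<integral>x. measure (law p x) A \<partial>\<mu>)"
      unfolding a_def by (rule measure_recolor[OF inv A])
    have "measure (law p (shift g x)) A = measure (law p x) A" for g x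
      using A_inv[of g] by (simp add: measure_law_shift vimage_def)
    \<comment> \<open>Conditional independence alone would only give the average of the squared
      conditional probabilities; constancy turns this into \<open>a * a\<close>.\<close>
    then have AE_a: "AE x in \<mu>. measure (law p x) A = a"
      unfolding a by (intro ergodic_AE_eq_integral[OF erg] integrable_law[OF inv]) auto
    \<comment> \<open>Three \<open>e\<close> account for the exceptional set \<open>N\<close> and
      the two approximation errors in the conditional estimate, two more for replacing
      \<open>A\<close> by \<open>B \<inter> B'\<close>.\<close>
    have le: "\<bar>a - a * a\<bar> \<le> 5 * e" if e: "e > 0" for e
    proof -
      obtain W B where W: "finite W" and B [measurable]: "B \<in> sets colorings"
        and WB: "determined_on W B" and AB: "measure ?\<nu> ((A - B) \<union> (B - A)) < e"
        using approx_determined_on[OF _ _ A e, of ?\<nu>] R.finite_measure_axioms by auto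
      obtain g where g: "measure \<mu> {x. \<exists>a\<in>W. \<exists>b\<in>W. E x a (g + b)} < e"
        using mixing[OF W e] by blast
      define N where "N = {x. \<exists>a\<in>W. \<exists>b\<in>W. E x a (g + b)}"
      have "Measurable.pred colorings (\<lambda>x. \<exists>a\<in>W. \<exists>b\<in>W. E x a (g + b))"
        using W by measurable
      then have N [measurable]: "N \<in> sets colorings" by (simp add: N_def pred_def)
      \<comment> \<open>The translate of \<open>B\<close> by \<open>g\<close>. Since
        \<open>A\<close> is invariant, the error \<open>?D'\<close> is the translate of
        \<open>?D\<close> and has the same measure.\<close>
      define B' where "B' = {y. shift (- g) y \<in> B}"
      have B' [measurable]: "B' \<in> sets colorings"
        using measurable_sets[OF measurable_shift[of "- g"] B] by (simp add: B'_def vimage_def)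
      have WB': "determined_on ((+) g ` W) B'"
        unfolding determined_on_def B'_def
      proof safe
        fix x y assume "\<forall>a\<in>(+) g ` W. x a = y a" "shift (- g) x \<in> B"
        then show "shift (- g) y \<in> B"
          using determined_onD[OF WB, of "shift (- g) x" "shift (- g) y"] by (auto simp: shift_def)
      qed
      let ?D = "(A - B) \<union> (B - A)" and ?D' = "(A - B') \<union> (B' - A)"
      have D [measurable]: "?D \<in> sets colorings" "?D' \<in> sets colorings" by auto
      have "?D' = {y. shift (- g) y \<in> ?D}"
        using A_inv[of "- g"] by (auto simp: B'_def)
      then have AB': "measure ?\<nu> ?D' < e"
        using invariant_measure_shift[OF recolor_invariant[OF inv] D(1), of p "- g"] AB by simp
      have close: "\<bar>measure P X - measure P Y\<bar> \<le> measure P ((Y - X) \<union> (X - Y))"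
        if "prob_space P" "sets P = sets colorings" "X \<in> sets colorings" "Y \<in> sets colorings" for X Y and P :: "('g \<Rightarrow> nat) measure"
      proof -
        interpret P: prob_space P by fact
        have "measure P X \<le> measure P (Y \<union> ((Y - X) \<union> (X - Y)))" "measure P Y \<le> measure P (X \<union> ((Y - X) \<union> (X - Y)))"
          using that by (auto intro!: P.finite_measure_mono)
        moreover have "measure P (Z \<union> ((Y - X) \<union> (X - Y))) \<le> measure P Z + measure P ((Y - X) \<union> (X - Y))" if "Z \<in> sets colorings" for Z
          using that \<open>sets P = _\<close> \<open>X \<in> _\<close> \<open>Y \<in> _\<close> by (intro measure_Un_le) auto
        ultimately show ?thesis using that(3,4) by (smt (verit))
      qed
      have "AE x in \<mu>. \<bar>measure (law p x) (B \<inter> B') - a * a\<bar>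
          \<le> indicator N x + measure (law p x) ?D + measure (law p x) ?D'"
        using AE_a
      proof eventually_elim
        case (elim x)
        interpret L: prob_space "law p x" by (rule prob_space_law)
        let ?b = "measure (law p x) B" and ?b' = "measure (law p x) B'" and ?c = "measure (law p x) (B \<inter> B')"
        have "\<bar>?c - ?b * ?b'\<bar> \<le> indicator N x"
        proof (cases "x \<in> N")
          case True
          have "0 \<le> ?b * ?b'" "?b * ?b' \<le> 1" by (auto intro: mult_le_one)
          then have "\<bar>?c - ?b * ?b'\<bar> \<le> 1" using L.prob_le_1[of "B \<inter> B'"] measure_nonneg[of "law p x" "B \<inter> B'"] by linarith
          with True show ?thesis by simp
        next
          case False
          then have "rep x ` W \<inter> rep x ` ((+) g ` W) = {}"
            by (auto simp: N_def rep_eq_iff)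
          then have "?c = ?b * ?b'"
            unfolding law_def by (rule iid_comp_indep[OF _ B WB B' WB'])
          then show ?thesis by simp
        qed
        moreover have "\<bar>?b * ?b' - a * a\<bar> \<le> \<bar>?b - a\<bar> + \<bar>?b' - a\<bar>"
        proof -
          have "?b * ?b' - a * a = (?b - a) * ?b' + a * (?b' - a)" by (simp add: algebra_simps)
          also have "\<bar>\<dots>\<bar> \<le> \<bar>?b - a\<bar> * ?b' + a * \<bar>?b' - a\<bar>"
            by (rule order.trans[OF abs_triangle_ineq]) (simp add: abs_mult a_def)
          also have "\<dots> \<le> \<bar>?b - a\<bar> * 1 + 1 * \<bar>?b' - a\<bar>"
            by (intro add_mono mult_mono) (auto simp: a_def)
          finally show ?thesis by simp
        qed
        moreover have "\<bar>?b - a\<bar> \<le> measure (law p x) ?D" "\<bar>?b' - a\<bar> \<le> measure (law p x) ?D'"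
          using close[of "law p x" B A] close[of "law p x" B' A] elim L.prob_space_axioms by auto
        ultimately show ?case by linarith
      qed
      then have "\<bar>\<integral>x. measure (law p x) (B \<inter> B') - a * a \<partial>\<mu>\<bar>
          \<le> (\<integral>x. indicator N x + measure (law p x) ?D + measure (law p x) ?D' \<partial>\<mu>)"
        by (intro order.trans[OF integral_abs_bound] integral_mono_AE Bochner_Integration.integrable_diff
            Bochner_Integration.integrable_add integrable_abs integrable_law[OF inv] B B' sets.Int D)
           (auto intro!: integrable_real_indicator simp: sets_mu[OF inv] M.emeasure_eq_measure)
      also have "\<dots> = measure \<mu> N + measure ?\<nu> ?D + measure ?\<nu> ?D'"
        using integrable_law[OF inv D(1), of p] integrable_law[OF inv D(2), of p]
        by (simp add: measure_recolor[OF inv] sets_mu[OF inv] M.emeasure_eq_measure integrable_real_indicator)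
      also have "\<dots> \<le> 3 * e" using AB AB' g by (simp add: N_def)
      also have "(\<integral>x. measure (law p x) (B \<inter> B') - a * a \<partial>\<mu>) = measure ?\<nu> (B \<inter> B') - a * a"
        using integrable_law[OF inv, of "B \<inter> B'" p]
        by (subst Bochner_Integration.integral_diff) (auto simp: measure_recolor[OF inv] M.prob_space simp del: space_mu)
      finally have 1: "\<bar>measure ?\<nu> (B \<inter> B') - a * a\<bar> \<le> 3 * e" .
      have "\<bar>measure ?\<nu> (B \<inter> B') - a\<bar> \<le> measure ?\<nu> ((A - (B \<inter> B')) \<union> ((B \<inter> B') - A))"
        unfolding a_def by (intro close R.prob_space_axioms) auto
      also have "\<dots> \<le> measure ?\<nu> (?D \<union> ?D')"
        by (intro R.finite_measure_mono) auto
      also have "\<dots> \<le> measure ?\<nu> ?D + measure ?\<nu> ?D'"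
        by (intro measure_Un_le) auto
      also have "\<dots> \<le> 2 * e" using AB AB' by simp
      finally show ?thesis using 1 by linarith
    qed
    \<comment> \<open>If positive, this number could be taken as \<open>6 * e\<close> and would be
      at most \<open>5 * e\<close>.\<close>
    have "\<not> 0 < \<bar>a - a * a\<bar>"
      using le[of "\<bar>a - a * a\<bar> / 6"] by auto
    then have "a * (1 - a) = 0" by (simp add: algebra_simps)
    then show ?thesis by (auto simp: a_def)
  qed
  then show ?thesis
    using recolor_invariant[OF inv] by (simp add: ergodic_prob_measures_def)
qed

end

section \<open>The gap provided by property (T)\<close>

lemma continuous_bool_functions_bounded:
  fixes f :: "('v \<Rightarrow> bool) \<Rightarrow> real"
  assumes "continuous_on UNIV f"
  shows "\<exists>C. \<forall>x. \<bar>f x\<bar> \<le> C"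
proof -
  have "compact_space (product_topology (\<lambda>_. euclidean :: bool topology) (UNIV :: 'v set))"
    unfolding compact_space_product_topology
    by (auto simp: compact_space_def compactin_euclidean_iff intro: finite_imp_compact)
  then have "compact (UNIV :: ('v \<Rightarrow> bool) set)"
    by (simp add: euclidean_product_topology compact_space_def)
  with assms have "bounded (f ` UNIV)"
    by (intro compact_imp_bounded compact_continuous_image)
  then show ?thesis by (auto simp: bounded_iff)
qed

text \<open>A basic neighbourhood of \<open>y\<close> constrains finitely many coordinates. The
  window depends on \<open>y\<close>; it is applied at the two constant configurations.\<close>

lemma continuous_bool_functions_window:
  fixes f :: "('v \<Rightarrow> bool) \<Rightarrow> real"
  assumes "continuous_on UNIV f" "e > 0"
  shows "\<exists>W. finite W \<and> (\<forall>x. (\<forall>a\<in>W. x a = y a) \<longrightarrow> \<bar>f x - f y\<bar> < e)"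
proof -
  have "open (f -` ball (f y) e)"
    using assms by (simp add: continuous_on_open_vimage)
  then have "openin (product_topology (\<lambda>_. euclidean) UNIV) (f -` ball (f y) e)"
    by (simp add: open_fun_def)
  from product_topology_open_contains_basis[OF this, of y] assms(2)
  obtain X where X: "y \<in> (\<Pi>\<^sub>E i\<in>UNIV. X i)" "finite {i. X i \<noteq> UNIV}" "(\<Pi>\<^sub>E i\<in>UNIV. X i) \<subseteq> f -` ball (f y) e"
    by auto
  have "\<bar>f x - f y\<bar> < e" if "\<forall>a\<in>{i. X i \<noteq> UNIV}. x a = y a" for x
  proof -
    have "x i \<in> X i" for i
      using that X(1) by (cases "X i = UNIV") (auto simp: PiE_UNIV_domain Pi_iff)
    then have "x \<in> f -` ball (f y) e" using X(3) by (simp add: PiE_UNIV_domain Pi_iff subset_iff)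
    then show ?thesis by (simp add: dist_real_def abs_minus_commute)
  qed
  with X(2) show ?thesis by blast
qed

text \<open>Without a gap there are ergodic measures of density 1/2 under which
  \<open>\<omega> 0\<close> and \<open>\<omega> s\<close> agree with probability tending to 1, for
  each \<open>s\<close>. They converge to the fair mixture of the two constant configurations, which
  is invariant but not ergodic, and closedness forbids this.\<close>

lemma kazhdan_spectral_gap:
  assumes cnt: "countable (UNIV :: 'g::group_add set)" and T: "kazhdan TYPE('g)"
  shows "\<exists>(F :: 'g set) d. finite F \<and> d > 0 \<and>
    (\<forall>\<nu> \<in> ergodic_prob_measures (translate :: 'g \<Rightarrow> _) borel. measure \<nu> {\<omega>. \<omega> 0} = 1 / 2 \<longrightarrow>
      (\<exists>s\<in>F. d \<le> measure \<nu> {\<omega>. \<omega> 0 \<noteq> \<omega> s}))"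
proof (rule ccontr)
  let ?erg = "ergodic_prob_measures (translate :: 'g \<Rightarrow> _) borel"
  define P where "P F d \<longleftrightarrow> (\<forall>\<nu>\<in>?erg. measure \<nu> {\<omega>. \<omega> 0} = 1 / 2 \<longrightarrow>
    (\<exists>s\<in>F. d \<le> measure \<nu> {\<omega>. \<omega> 0 \<noteq> \<omega> s}))" for F and d :: real
  assume "\<not> ?thesis"
  then have contra: "\<not> (finite F \<and> d > 0 \<and> P F d)" for F d
    unfolding P_def by blast
  let ?inv = "invariant_prob_measures (translate :: 'g \<Rightarrow> _) borel"
  \<comment> \<open>An exhaustion of the countable group, so that a sequence of measures
    suffices.\<close>
  define F where "F n = from_nat_into (UNIV :: 'g set) ` {..n}" for n
  have F: "finite (F n)" for n by (simp add: F_def)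
  have "\<exists>\<nu>\<in>?erg. measure \<nu> {\<omega>. \<omega> 0} = 1 / 2 \<and> (\<forall>s\<in>F n. measure \<nu> {\<omega>. \<omega> 0 \<noteq> \<omega> s} < 1 / Suc n)" for n
  proof -
    have "\<not> P (F n) (1 / Suc n)"
      using contra F[of n] by auto
    then show ?thesis by (simp add: P_def not_le)
  qed
  then have "\<forall>n. \<exists>\<nu>. \<nu> \<in> ?erg \<and> measure \<nu> {\<omega>. \<omega> 0} = 1 / 2 \<and>
      (\<forall>s\<in>F n. measure \<nu> {\<omega>. \<omega> 0 \<noteq> \<omega> s} < 1 / Suc n)"
    unfolding Bex_def by (rule allI)
  from choice[OF this]
  obtain \<nu> where \<nu>: "\<And>n. \<nu> n \<in> ?erg" "\<And>n. measure (\<nu> n) {\<omega>. \<omega> 0} = 1 / 2"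
    "\<And>n s. s \<in> F n \<Longrightarrow> measure (\<nu> n) {\<omega>. \<omega> 0 \<noteq> \<omega> s} < 1 / Suc n"
    by blast
  define c where "c = (\<lambda>b (_ :: 'g). b :: bool)"
  define \<kappa> where "\<kappa> = distr (measure_pmf (bernoulli_pmf (1/2))) borel c"
  have cm [measurable]: "c \<in> measurable (measure_pmf (bernoulli_pmf (1/2))) borel" by simp
  have \<kappa>_sets: "sets \<kappa> = sets borel" by (simp add: \<kappa>_def)
  have \<kappa>_prob: "prob_space \<kappa>"
    unfolding \<kappa>_def by (intro measure_pmf.prob_space_distr cm)
  have "translate g \<circ> c = c" for g by (simp add: c_def translate_def fun_eq_iff)
  then have "distr \<kappa> borel (translate g) = \<kappa>" for g
    unfolding \<kappa>_def by (subst distr_distr) (auto simp: measurable_translate)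
  then have \<kappa>_inv: "\<kappa> \<in> ?inv"
    using \<kappa>_sets \<kappa>_prob by (simp add: invariant_prob_measures_def)
  have coord [measurable]: "(\<lambda>\<omega>. \<omega> a) \<in> measurable borel (count_space (UNIV :: bool set))" for a :: 'g
    using measurable_cong_sets[OF borel_eq_PiM_bool[OF cnt] refl, of "count_space (UNIV :: bool set)"]
    by (metis measurable_component_singleton UNIV_I)
  have not_erg: "\<kappa> \<notin> ?erg"
  proof
    assume "\<kappa> \<in> ?erg"
    \<comment> \<open>Just the configuration that is \<open>True\<close> everywhere; it is invariant
      and has \<open>\<kappa>\<close>-measure 1/2.\<close>
    moreover define A where "A = {\<omega> :: 'g \<Rightarrow> bool. \<forall>a b. \<omega> a = \<omega> b \<and> \<omega> a}"
    have "Measurable.pred borel (\<lambda>\<omega> :: 'g \<Rightarrow> bool. \<forall>a b. \<omega> a = \<omega> b \<and> \<omega> a)"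
      by (intro pred_countable_All cnt) measurable
    then have A: "A \<in> sets borel" by (simp add: A_def pred_def)
    moreover have "translate g -` A = A" for g
    proof -
      have "(\<forall>a b. \<omega> (- g + a) = \<omega> (- g + b) \<and> \<omega> (- g + a)) \<longleftrightarrow> (\<forall>a b. \<omega> a = \<omega> b \<and> \<omega> a)" for \<omega> :: "'g \<Rightarrow> bool"
        by (metis (no_types, lifting) add.assoc add_0 left_minus minus_minus)
      then show ?thesis by (auto simp: A_def translate_def)
    qed
    ultimately have "measure \<kappa> A = 0 \<or> measure \<kappa> A = 1"
      by (auto simp: ergodic_prob_measures_def)
    moreover have "measure \<kappa> A = measure (measure_pmf (bernoulli_pmf (1/2))) {True}"
      unfolding \<kappa>_def using A by (subst measure_distr) (auto simp: A_def c_def intro!: arg_cong[of _ _ "measure _"])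
    ultimately show False by (simp add: measure_pmf_single)
  qed
  have lim: "(\<lambda>n. integral\<^sup>L (\<nu> n) f) \<longlonglongrightarrow> integral\<^sup>L \<kappa> f" if f: "continuous_on UNIV f" for f :: "('g \<Rightarrow> bool) \<Rightarrow> real"
  proof (rule LIMSEQ_I)
    fix e :: real assume e: "0 < e"
    obtain C where C: "\<And>x. \<bar>f x\<bar> \<le> C" using continuous_bool_functions_bounded[OF f] by auto
    have C0: "0 \<le> C" using C[of undefined] by linarith
    have fm [measurable]: "f \<in> borel_measurable borel" by (rule borel_measurable_continuous_onI[OF f])
    have "\<exists>W. finite W \<and> (\<forall>x. (\<forall>a\<in>W. x a = b) \<longrightarrow> \<bar>f x - f (c b)\<bar> < e / 4)" for b
      using continuous_bool_functions_window[OF f, of "e / 4" "c b"] e by (simp add: c_def)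
    then obtain W where W: "\<And>b. finite (W b)"
      "\<And>b x. (\<And>a. a \<in> W b \<Longrightarrow> x a = b) \<Longrightarrow> \<bar>f x - f (c b)\<bar> < e / 4" by metis
    define V where "V = W True \<union> W False"
    have V: "finite V" using W(1) by (simp add: V_def)
    \<comment> \<open>The first summand makes the disagreement term
      \<open>2 * C * card V / Suc n\<close> at most \<open>e / 4\<close>, the second puts
      \<open>V\<close> inside \<open>F n\<close>. Inserting 0 keeps the maximum meaningful when
      \<open>V\<close> is empty.\<close>
    define N where "N = nat \<lceil>8 * C * card V / e\<rceil> + Max (to_nat_on UNIV ` insert 0 V)"
    have "\<bar>integral\<^sup>L (\<nu> n) f - integral\<^sup>L \<kappa> f\<bar> < e" if n: "N \<le> n" for n
    proof -
      have sets [measurable_cong]: "sets (\<nu> n) = sets borel" and "prob_space (\<nu> n)"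
        using \<nu>(1)[of n] by (auto simp: ergodic_prob_measures_def invariant_prob_measures_def)
      interpret prob_space "\<nu> n" by fact
      have space: "space (\<nu> n) = UNIV" using sets_eq_imp_space_eq[OF sets] by simp
      \<comment> \<open>\<open>g\<close> evaluates \<open>f\<close> at the constant configuration
        with value \<open>\<omega> 0\<close>. As the density is exactly 1/2, its integral is already
        that of \<open>f\<close> under \<open>\<kappa>\<close>.\<close>
      define g where "g = (\<lambda>\<omega> :: 'g \<Rightarrow> bool. f (c (\<omega> 0)))"
      define D where "D s = {\<omega> :: 'g \<Rightarrow> bool. \<omega> 0 \<noteq> \<omega> s}" for s
      have D: "D s \<in> sets borel" for s
      proof -
        have "Measurable.pred borel (\<lambda>\<omega> :: 'g \<Rightarrow> bool. \<omega> 0 \<noteq> \<omega> s)" by measurable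
        then show ?thesis by (simp add: D_def pred_def)
      qed
      have gm [measurable]: "g \<in> borel_measurable borel"
        unfolding g_def by (rule measurable_compose[OF coord]) simp
      have gf: "integral\<^sup>L (\<nu> n) g = integral\<^sup>L \<kappa> f"
      proof -
        have T: "measure (\<nu> n) {\<omega>. \<omega> 0} = 1 / 2" by (rule \<nu>)
        have Tm: "{\<omega> :: 'g \<Rightarrow> bool. \<omega> 0} \<in> sets borel"
          using coord[of 0] by (simp add: pred_def)
        have "g = (\<lambda>\<omega>. f (c False) + (f (c True) - f (c False)) * indicator {\<omega>. \<omega> 0} \<omega>)"
          by (auto simp: g_def fun_eq_iff indicator_def)
        then have "integral\<^sup>L (\<nu> n) g = f (c False) + (f (c True) - f (c False)) * (1 / 2)"
          using Tm T prob_space by (simp add: space sets emeasure_eq_measure integrable_real_indicator)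
        moreover have "integral\<^sup>L \<kappa> f = f (c True) * (1 / 2) + f (c False) * (1 / 2)"
          unfolding \<kappa>_def by (subst integral_distr) auto
        ultimately show ?thesis by (simp add: field_simps)
      qed
      have bf: "integrable (\<nu> n) f" and bg: "integrable (\<nu> n) g"
        using C by (auto intro!: integrable_const_bound[where B = C] simp: g_def[abs_def])
      \<comment> \<open>Either \<open>\<omega>\<close> has the value \<open>\<omega> 0\<close> on
        all of \<open>V\<close> and the window bound applies, or some \<open>s\<close> in
        \<open>V\<close> disagrees and the trivial bound \<open>2 * C\<close> does.\<close>
      have pw: "\<bar>f \<omega> - g \<omega>\<bar> \<le> e / 4 + 2 * C * (\<Sum>s\<in>V. indicator (D s) \<omega>)" for \<omega>
      proof (cases "\<exists>s\<in>V. \<omega> \<in> D s")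
        case True
        then obtain s where s: "s \<in> V" "\<omega> \<in> D s" by blast
        then have "1 \<le> (\<Sum>s\<in>V. indicator (D s) \<omega> :: real)"
          using member_le_sum[of s V "\<lambda>s. indicator (D s) \<omega> :: real"] V by simp
        then have "2 * C * 1 \<le> 2 * C * (\<Sum>s\<in>V. indicator (D s) \<omega>)"
          using C0 by (intro mult_left_mono) auto
        moreover have "\<bar>f \<omega> - g \<omega>\<bar> \<le> 2 * C"
          using C[of \<omega>] C[of "c (\<omega> 0)"] by (simp add: g_def)
        ultimately show ?thesis using e by linarith
      next
        case False
        then have "\<bar>f \<omega> - f (c (\<omega> 0))\<bar> < e / 4"
          by (intro W(2)) (cases "\<omega> 0"; auto simp: V_def D_def)
        moreover have "0 \<le> 2 * C * (\<Sum>s\<in>V. indicator (D s) \<omega>)"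
          using C0 by (intro mult_nonneg_nonneg sum_nonneg) auto
        ultimately show ?thesis by (simp add: g_def)
      qed
      have "\<bar>integral\<^sup>L (\<nu> n) f - integral\<^sup>L (\<nu> n) g\<bar> = \<bar>\<integral>\<omega>. f \<omega> - g \<omega> \<partial>\<nu> n\<bar>"
        using bf bg by simp
      also have "\<dots> \<le> (\<integral>\<omega>. e / 4 + 2 * C * (\<Sum>s\<in>V. indicator (D s) \<omega>) \<partial>\<nu> n)"
        using bf bg D pw
        by (intro order.trans[OF integral_abs_bound] integral_mono Bochner_Integration.integrable_add
            Bochner_Integration.integrable_mult_right Bochner_Integration.integrable_sum)
           (auto simp: sets emeasure_eq_measure intro!: integrable_real_indicator)
      also have "\<dots> = e / 4 + 2 * C * (\<Sum>s\<in>V. measure (\<nu> n) (D s))"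
        using D prob_space by (simp add: sets emeasure_eq_measure integrable_real_indicator space)
      also have "(\<Sum>s\<in>V. measure (\<nu> n) (D s)) \<le> (\<Sum>s\<in>V. 1 / Suc n)"
      proof (intro sum_mono)
        fix s assume "s \<in> V"
        then have "to_nat_on (UNIV :: 'g set) s \<le> N"
          unfolding N_def using V by (intro trans_le_add2 Max_ge) auto
        with n have "s \<in> F n"
          unfolding F_def by (intro image_eqI[of _ _ "to_nat_on UNIV s"]) (auto simp: cnt)
        then show "measure (\<nu> n) (D s) \<le> 1 / Suc n"
          unfolding D_def using \<nu>(3)[of s n] by simp
      qed
      also have "2 * C * (\<Sum>s\<in>V. 1 / Suc n) = 2 * C * card V / Suc n" by simp
      also have "\<dots> \<le> e / 4"
      proof -
        have "8 * C * card V / e \<le> Suc n"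
          using n unfolding N_def by linarith
        then show ?thesis using e by (simp add: field_simps)
      qed
      finally show ?thesis using e C0 gf by (simp add: mult_left_mono)
    qed
    then show "\<exists>no. \<forall>n\<ge>no. norm (integral\<^sup>L (\<nu> n) f - integral\<^sup>L \<kappa> f) < e"
      by auto
  qed
  have "?inv - ?erg \<in> Collect (openin (subtopology weak_star_topology ?inv))"
    using T by (simp add: kazhdan_def closedin_def topspace_subtopology topspace_weak_star_topology)
       (smt (verit, ccfv_threshold) Collect_mono_iff Diff_Int_distrib2 Int_absorb1 invariant_prob_measures_def subset_iff)
  then obtain U where U: "openin (weak_star_topology :: ('g \<Rightarrow> bool) measure topology) U" "?inv - ?erg = U \<inter> ?inv"
    by (auto simp: openin_subtopology)
  then obtain V where V: "openin (product_topology (\<lambda>_. euclideanreal) {f. continuous_on UNIV f}) V"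
    "U = (\<lambda>\<mu>. \<lambda>f\<in>{f. continuous_on UNIV f}. \<integral>\<omega>. f \<omega> \<partial>\<mu>) -` V \<inter> {\<mu>. prob_space \<mu> \<and> sets \<mu> = sets (borel :: ('g \<Rightarrow> bool) measure)}"
    unfolding weak_star_topology_def openin_pullback_topology by blast
  let ?I = "\<lambda>\<mu>. \<lambda>f\<in>{f. continuous_on UNIV f}. \<integral>\<omega>. f \<omega> \<partial>(\<mu> :: ('g \<Rightarrow> bool) measure)"
  \<comment> \<open>The weak* topology is pulled back from this product, where convergence is
    coordinatewise, with one coordinate for each test function.\<close>
  have "limitin (product_topology (\<lambda>_. euclideanreal) {f. continuous_on UNIV f}) (\<lambda>n. ?I (\<nu> n)) (?I \<kappa>) sequentially"
    unfolding limitin_componentwise using lim by auto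
  moreover have "\<kappa> \<in> U" using U(2) \<kappa>_inv not_erg by blast
  then have "?I \<kappa> \<in> V" using V(2) by blast
  ultimately have "eventually (\<lambda>n. ?I (\<nu> n) \<in> V) sequentially"
    using V(1) by (simp add: limitin_def)
  then obtain n where "?I (\<nu> n) \<in> V" by (auto simp: eventually_sequentially)
  moreover have "\<nu> n \<in> ?inv" using \<nu>(1) by (simp add: ergodic_prob_measures_def)
  ultimately have "\<nu> n \<in> U" unfolding V(2) by (auto simp: invariant_prob_measures_def)
  with U(2) \<open>\<nu> n \<in> ?inv\<close> \<nu>(1)[of n] show False by blast
qed

section \<open>Elements of minimal norm\<close>

abbreviation sq_norm :: "'z measure \<Rightarrow> ('z \<Rightarrow> real) \<Rightarrow> ennreal" where
  "sq_norm R V \<equiv> \<integral>\<^sup>+z. ennreal ((V z)\<^sup>2) \<partial>R"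

lemma sq_norm_parallelogram:
  assumes [measurable]: "V \<in> borel_measurable R" "W \<in> borel_measurable R"
  shows "sq_norm R (\<lambda>z. V z - W z) + 4 * sq_norm R (\<lambda>z. (V z + W z) / 2) = 2 * sq_norm R V + 2 * sq_norm R W"
proof -
  have "ennreal ((a - b)\<^sup>2) + 4 * ennreal (((a + b) / 2)\<^sup>2) = 2 * ennreal (a\<^sup>2) + 2 * ennreal (b\<^sup>2)" for a b :: real
  proof -
    have "(a - b)\<^sup>2 + 4 * ((a + b) / 2)\<^sup>2 = 2 * a\<^sup>2 + 2 * b\<^sup>2"
      by (simp add: power2_eq_square field_simps)
    then have "ennreal ((a - b)\<^sup>2) + ennreal 4 * ennreal (((a + b) / 2)\<^sup>2) = ennreal 2 * ennreal (a\<^sup>2) + ennreal 2 * ennreal (b\<^sup>2)"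
      unfolding ennreal_mult'[symmetric, OF zero_le_numeral]
      by (simp add: ennreal_plus[symmetric] del: ennreal_plus)
    then show ?thesis by simp
  qed
  then have "(\<integral>\<^sup>+z. ennreal ((V z - W z)\<^sup>2) + 4 * ennreal (((V z + W z) / 2)\<^sup>2) \<partial>R) =
    (\<integral>\<^sup>+z. 2 * ennreal ((V z)\<^sup>2) + 2 * ennreal ((W z)\<^sup>2) \<partial>R)" by simp
  then show ?thesis
    by (simp add: nn_integral_add nn_integral_cmult)
qed

text \<open>Stands in for the triangle inequality without square roots in \<open>ennreal\<close>;
  the difference of the integrands is \<open>(2 * W z - V z)^2\<close>.\<close>

lemma sq_norm_le_double:
  assumes [measurable]: "V \<in> borel_measurable R" "W \<in> borel_measurable R"
  shows "sq_norm R V \<le> 2 * sq_norm R W + 2 * sq_norm R (\<lambda>z. V z - W z)"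
proof -
  have "ennreal (a\<^sup>2) \<le> 2 * ennreal (b\<^sup>2) + 2 * ennreal ((a - b)\<^sup>2)" for a b :: real
  proof -
    have "a\<^sup>2 \<le> 2 * b\<^sup>2 + 2 * (a - b)\<^sup>2"
      using zero_le_power2[of "2 * b - a"] by (simp add: power2_eq_square algebra_simps)
    then have "ennreal (a\<^sup>2) \<le> ennreal (2 * b\<^sup>2 + 2 * (a - b)\<^sup>2)" by (rule ennreal_leI)
    also have "\<dots> = ennreal 2 * ennreal (b\<^sup>2) + ennreal 2 * ennreal ((a - b)\<^sup>2)"
      unfolding ennreal_mult'[symmetric, OF zero_le_numeral] by (subst ennreal_plus[symmetric]) auto
    finally show ?thesis by simp
  qed
  then have "sq_norm R V \<le> (\<integral>\<^sup>+z. 2 * ennreal ((W z)\<^sup>2) + 2 * ennreal ((V z - W z)\<^sup>2) \<partial>R)"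
    by (intro nn_integral_mono)
  then show ?thesis
    by (simp add: nn_integral_add nn_integral_cmult)
qed

text \<open>Even with the weights \<open>4 ^ n\<close> the squared norms are summable, so almost
  everywhere the weighted squares have a finite sum, whose square root serves as \<open>B\<close>.
  This gives pointwise convergence without passing to a subsequence.\<close>

lemma AE_geometric_bound:
  assumes [measurable]: "\<And>n::nat. D n \<in> borel_measurable R"
    and D: "\<And>n. sq_norm R (D n) \<le> ennreal (4 / 16 ^ n)"
  shows "AE z in R. \<exists>B. \<forall>n. \<bar>D n z\<bar> \<le> B / 2 ^ n"
proof -
  have "(\<integral>\<^sup>+z. (\<Sum>n. ennreal (4 ^ n) * ennreal ((D n z)\<^sup>2)) \<partial>R) = (\<Sum>n. ennreal (4 ^ n) * sq_norm R (D n))"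
    by (simp add: nn_integral_suminf nn_integral_cmult)
  also have "\<dots> \<le> (\<Sum>n. ennreal (4 * (1 / 4) ^ n))"
  proof (intro suminf_le)
    fix n
    have "ennreal (4 ^ n) * sq_norm R (D n) \<le> ennreal (4 ^ n) * ennreal (4 / 16 ^ n)"
      by (intro mult_left_mono D) auto
    also have "\<dots> = ennreal (4 ^ n * (4 / 16 ^ n))"
      by (subst ennreal_mult[symmetric]) auto
    also have "4 ^ n * (4 / 16 ^ n) = 4 * (1 / 4 :: real) ^ n"
      using power_mult_distrib[of "4 :: real" 4 n] by (simp add: field_simps)
    finally show "ennreal (4 ^ n) * sq_norm R (D n) \<le> ennreal (4 * (1 / 4) ^ n)" .
  qed auto
  also have "\<dots> < \<infinity>"
    by (subst suminf_ennreal2) (auto intro!: summable_mult summable_geometric)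
  finally have "AE z in R. (\<Sum>n. ennreal (4 ^ n) * ennreal ((D n z)\<^sup>2)) \<noteq> \<infinity>"
    by (intro nn_integral_PInf_AE) auto
  then show ?thesis
  proof eventually_elim
    case (elim z)
    then obtain S where S: "0 \<le> S" "(\<Sum>n. ennreal (4 ^ n) * ennreal ((D n z)\<^sup>2)) = ennreal S"
      by (cases "\<Sum>n. ennreal (4 ^ n) * ennreal ((D n z)\<^sup>2)" rule: ennreal_cases) auto
    have "\<bar>D n z\<bar> \<le> sqrt S / 2 ^ n" for n
    proof -
      have "ennreal (4 ^ n) * ennreal ((D n z)\<^sup>2) \<le> ennreal S"
        using sum_le_suminf[of "\<lambda>n. ennreal (4 ^ n) * ennreal ((D n z)\<^sup>2)" "{n}"] S by simp
      then have "ennreal (4 ^ n * (D n z)\<^sup>2) \<le> ennreal S"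
        by (simp add: ennreal_mult)
      then have "4 ^ n * (D n z)\<^sup>2 \<le> S"
        using S(1) by (simp only: ennreal_le_iff)
      moreover have "(2 ^ n)\<^sup>2 = (4 :: real) ^ n"
        unfolding power2_eq_square power_mult_distrib[symmetric] by simp
      ultimately have "(2 ^ n * \<bar>D n z\<bar>)\<^sup>2 \<le> S"
        by (simp add: power_mult_distrib)
      then have "2 ^ n * \<bar>D n z\<bar> \<le> sqrt S" by (rule real_le_rsqrt)
      then show ?thesis by (simp add: field_simps)
    qed
    then show ?case by blast
  qed
qed

lemma convergent_if_geometric_increments:
  fixes V :: "nat \<Rightarrow> real"
  assumes "\<And>n. \<bar>V (Suc n) - V n\<bar> \<le> B / 2 ^ n"
  shows "convergent V"
proof -
  have "summable (\<lambda>n. B * (1 / 2) ^ n)"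
    by (intro summable_mult summable_geometric) auto
  then have "summable (\<lambda>n. V (Suc n) - V n)"
    by (rule summable_comparison_test'[where N = 0]) (use assms in \<open>auto simp: power_divide\<close>)
  then have "convergent (\<lambda>n. \<Sum>k<n. V (Suc k) - V k)"
    by (simp add: summable_iff_convergent)
  then have "convergent (\<lambda>n. V n - V 0)"
    by (simp add: sum_lessThan_telescope)
  then show ?thesis
    using convergent_add[OF _ convergent_const[of "V 0"], of "\<lambda>n. V n - V 0"] by simp
qed

text \<open>The element of minimal norm in the closed convex hull of an orbit is fixed by the action.\<close>

lemma invariant_limit_of_midpoint_closed:
  fixes R :: "'z measure" and C :: "('z \<Rightarrow> real) set" and T :: "'i \<Rightarrow> 'z \<Rightarrow> 'z"
  assumes cnt: "countable (UNIV :: 'i set)" and ne: "C \<noteq> {}"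
    and meas: "\<And>V. V \<in> C \<Longrightarrow> V \<in> borel_measurable R"
    and fin: "\<And>V. V \<in> C \<Longrightarrow> sq_norm R V < \<infinity>"
    and mid: "\<And>V W. V \<in> C \<Longrightarrow> W \<in> C \<Longrightarrow> (\<lambda>z. (V z + W z) / 2) \<in> C"
    and low: "\<And>V. V \<in> C \<Longrightarrow> ennreal c \<le> sq_norm R V" and c: "0 < c"
    and T: "\<And>i V. V \<in> C \<Longrightarrow> (\<lambda>z. V (T i z)) \<in> C"
      "\<And>i V. V \<in> C \<Longrightarrow> sq_norm R (\<lambda>z. V (T i z)) = sq_norm R V"
  shows "\<exists>V. (\<forall>n. V n \<in> C) \<and> (AE z in R. \<forall>i. lim (\<lambda>n. V n (T i z)) = lim (\<lambda>n. V n z)) \<and>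
    0 < sq_norm R (\<lambda>z. lim (\<lambda>n. V n z)) \<and> sq_norm R (\<lambda>z. lim (\<lambda>n. V n z)) < \<infinity>"
proof -
  define I where "I = (INF V\<in>C. sq_norm R V)"
  have I_le: "I \<le> sq_norm R V" if "V \<in> C" for V
    unfolding I_def using that by (rule INF_lower)
  obtain V0 where "V0 \<in> C" using ne by blast
  then have I_fin: "I < \<infinity>" using I_le[of V0] fin[of V0] by simp
  \<comment> \<open>The rate \<open>1 / 16 ^ n\<close> is what later gives pointwise increments of
    order \<open>1 / 2 ^ n\<close>.\<close>
  have "\<exists>V\<in>C. sq_norm R V \<le> I + ennreal (1 / 16 ^ n)" for n
  proof -
    have "I < I + ennreal (1 / 16 ^ n)"
      using I_fin by (cases I) (auto simp: ennreal_plus[symmetric] ennreal_less_iff simp del: ennreal_plus)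
    then have "\<exists>V\<in>C. sq_norm R V < I + ennreal (1 / 16 ^ n)"
      by (subst (asm) I_def) (simp add: INF_less_iff)
    then show ?thesis by (auto intro: less_imp_le)
  qed
  then obtain V where V: "\<And>n. V n \<in> C" "\<And>n. sq_norm R (V n) \<le> I + ennreal (1 / 16 ^ n)"
    by metis
  \<comment> \<open>The midpoint of two near-minimisers has squared norm at least \<open>I\<close>,
    so the parallelogram identity leaves at most \<open>4 / 16 ^ n\<close> for their
    difference.\<close>
  have close: "sq_norm R (\<lambda>z. W z - W' z) \<le> ennreal (4 / 16 ^ n)"
    if "W \<in> C" "W' \<in> C" "sq_norm R W \<le> I + ennreal (1 / 16 ^ n)" "sq_norm R W' \<le> I + ennreal (1 / 16 ^ n)" for W W' n
  proof -
    have "4 * I + sq_norm R (\<lambda>z. W z - W' z) \<le> sq_norm R (\<lambda>z. W z - W' z) + 4 * sq_norm R (\<lambda>z. (W z + W' z) / 2)"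
      using I_le[OF mid[OF that(1,2)]] by (subst add.commute) (intro add_mono mult_left_mono, auto)
    also have "\<dots> = 2 * sq_norm R W + 2 * sq_norm R W'"
      using that meas by (intro sq_norm_parallelogram) auto
    also have "\<dots> \<le> 2 * (I + ennreal (1 / 16 ^ n)) + 2 * (I + ennreal (1 / 16 ^ n))"
      using that by (intro add_mono mult_left_mono) auto
    also have "\<dots> = 4 * I + 4 * ennreal (1 / 16 ^ n)"
      by (simp add: algebra_simps mult_2[symmetric] flip: add.assoc)
    also have "4 * ennreal (1 / 16 ^ n) = ennreal (4 / 16 ^ n)"
      using ennreal_mult'[of 4 "1 / 16 ^ n"] by simp
    finally show ?thesis
      using I_fin by (auto simp: ennreal_add_left_cancel_le ennreal_mult_eq_top_iff)
  qed
  have mono: "sq_norm R (V m) \<le> I + ennreal (1 / 16 ^ n)" if "n \<le> m" for n m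
  proof -
    have "(1 / 16 ^ m :: real) \<le> 1 / 16 ^ n"
      using that by (intro divide_left_mono power_increasing) auto
    then show ?thesis
      using V(2)[of m] by (meson add_left_mono ennreal_leI order_trans)
  qed
  note [measurable] = meas[OF V(1)]
  have [measurable]: "(\<lambda>z. V n (T i z)) \<in> borel_measurable R" for n i
    by (rule meas[OF T(1)[OF V(1)]])
  define U where "U = (\<lambda>z. lim (\<lambda>n. V n z))"
  have [measurable]: "U \<in> borel_measurable R" unfolding U_def by measurable
  have conv: "AE z in R. (\<lambda>n. V n z) \<longlonglongrightarrow> U z"
  proof -
    have "AE z in R. \<exists>B. \<forall>n. \<bar>V (Suc n) z - V n z\<bar> \<le> B / 2 ^ n"
      by (rule AE_geometric_bound) (auto intro!: close V mono)
    then show ?thesis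
    proof eventually_elim
      case (elim z)
      then show ?case
        unfolding U_def convergent_LIMSEQ_iff[symmetric]
        using convergent_if_geometric_increments[of "\<lambda>n. V n z"] by blast
    qed
  qed
  \<comment> \<open>The translate of \<open>V n\<close> lies in \<open>C\<close> and has the same
    norm, hence is a near-minimiser as well and close to \<open>V n\<close>. Both therefore have the
    same limit.\<close>
  have "AE z in R. \<forall>i\<in>UNIV. U (T i z) = U z"
  proof (subst AE_ball_countable[OF cnt], intro ballI)
    fix i
    have "AE z in R. \<exists>B. \<forall>n. \<bar>V n (T i z) - V n z\<bar> \<le> B / 2 ^ n"
      by (rule AE_geometric_bound) (auto intro!: close V T simp: T(2)[OF V(1)])
    with conv show "AE z in R. U (T i z) = U z"
    proof eventually_elim
      case (elim z)
      then obtain B where B: "\<And>n. \<bar>V n (T i z) - V n z\<bar> \<le> B / 2 ^ n" by blast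
      have "(\<lambda>n. B * (1 / 2) ^ n) \<longlonglongrightarrow> B * 0"
        by (intro tendsto_mult tendsto_const LIMSEQ_realpow_zero) auto
      moreover have "eventually (\<lambda>n. norm (V n (T i z) - V n z) \<le> B * (1 / 2) ^ n) sequentially"
        using B by (simp add: power_divide)
      ultimately have "(\<lambda>n. V n (T i z) - V n z) \<longlonglongrightarrow> 0"
        using Lim_null_comparison[where f = "\<lambda>n. V n (T i z) - V n z" and g = "\<lambda>n. B * (1 / 2) ^ n"] by simp
      from tendsto_add[OF this elim(1)] have "(\<lambda>n. V n (T i z)) \<longlonglongrightarrow> U z" by simp
      then show ?case unfolding U_def[of ] by (rule limI)
    qed
  qed
  \<comment> \<open>Pointwise convergence is upgraded to convergence in norm, so that the lower
    bound \<open>c\<close> on \<open>C\<close> keeps the limit away from 0.\<close>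
  moreover have fatou: "sq_norm R (\<lambda>z. V n z - U z) \<le> ennreal (4 / 16 ^ n)" for n
  proof -
    have "sq_norm R (\<lambda>z. V n z - U z) = (\<integral>\<^sup>+z. liminf (\<lambda>m. ennreal ((V n z - V m z)\<^sup>2)) \<partial>R)"
      using conv
    proof (intro nn_integral_cong_AE, eventually_elim)
      case (elim z)
      then have "(\<lambda>m. ennreal ((V n z - V m z)\<^sup>2)) \<longlonglongrightarrow> ennreal ((V n z - U z)\<^sup>2)"
        by (intro tendsto_intros)
      then show ?case by (intro lim_imp_Liminf[symmetric]) simp
    qed
    also have "\<dots> \<le> liminf (\<lambda>m. sq_norm R (\<lambda>z. V n z - V m z))"
      by (intro nn_integral_liminf) measurable
    also have "\<dots> \<le> liminf (\<lambda>m. ennreal (4 / 16 ^ n))"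
      by (intro Liminf_mono eventually_sequentiallyI[of n] close V mono)
    also have "\<dots> = ennreal (4 / 16 ^ n)" by (simp add: Liminf_const)
    finally show ?thesis .
  qed
  moreover have "sq_norm R U < \<infinity>"
  proof -
    have "sq_norm R U \<le> 2 * sq_norm R (V 0) + 2 * sq_norm R (\<lambda>z. U z - V 0 z)"
      by (rule sq_norm_le_double) measurable
    also have "\<dots> \<le> 2 * sq_norm R (V 0) + 2 * ennreal 4"
      using fatou[of 0] by (intro add_left_mono mult_left_mono) (simp_all add: power2_commute)
    also have "\<dots> < \<infinity>"
      using fin[OF V(1)[of 0]] by (simp add: ennreal_mult_less_top)
    finally show ?thesis .
  qed
  moreover have "0 < sq_norm R U"
  proof (rule ccontr)
    assume "\<not> 0 < sq_norm R U"
    then have U0: "sq_norm R U = 0" by simp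
    have "(\<lambda>n. 8 * (1 / 16 :: real) ^ n) \<longlonglongrightarrow> 8 * 0"
      by (intro tendsto_mult tendsto_const LIMSEQ_realpow_zero) auto
    then have "eventually (\<lambda>n. 8 * (1 / 16 :: real) ^ n < c) sequentially"
      using c by (intro order_tendstoD) auto
    then obtain n where n: "8 / 16 ^ n < c"
      by (auto simp: eventually_sequentially power_divide)
    have "ennreal c \<le> sq_norm R (V n)" by (rule low[OF V(1)])
    also have "\<dots> \<le> 2 * sq_norm R U + 2 * sq_norm R (\<lambda>z. V n z - U z)"
      by (rule sq_norm_le_double) measurable
    also have "\<dots> \<le> 2 * ennreal (4 / 16 ^ n)"
      using fatou[of n] U0 by (simp add: mult_left_mono)
    also have "\<dots> = ennreal (8 / 16 ^ n)"
      using ennreal_mult'[of 2 "4 / 16 ^ n"] by simp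
    also have "\<dots> < ennreal c" using n by (intro ennreal_lessI c)
    finally show False by simp
  qed
  ultimately show ?thesis
    using V(1) unfolding U_def by (intro exI[of _ V]) auto
qed

section \<open>Invariant weights on classes\<close>

lemma nn_integral_count_space_single:
  "(\<integral>\<^sup>+b. (if b = c then v else 0) \<partial>count_space UNIV) = (v :: ennreal)"
proof -
  have "(\<lambda>b. if b = c then v else 0) = (\<lambda>b. v * indicator {c} b)"
    by (auto simp: fun_eq_iff indicator_def)
  then show ?thesis by (simp add: nn_integral_cmult_indicator)
qed

text \<open>Each point of one transversal is matched with the unique equivalent point of the other.
  Inserting this match as an inner sum and exchanging the sums replaces \<open>P\<close> by
  \<open>P'\<close>.\<close>

lemma sum_over_transversal_eq:
  fixes e :: "'v \<Rightarrow> 'v \<Rightarrow> bool" and F :: "'v \<Rightarrow> ennreal"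
  assumes cnt: "countable (UNIV :: 'v set)" and e: "\<And>a b. e a b \<Longrightarrow> e b a" "\<And>a b. e a b \<Longrightarrow> F a = F b"
    and P: "\<And>a. \<exists>!b. P b \<and> e a b" and P': "\<And>a. \<exists>!b. P' b \<and> e a b"
  shows "(\<integral>\<^sup>+b. (if P b then F b else 0) \<partial>count_space UNIV) = (\<integral>\<^sup>+b. (if P' b then F b else 0) \<partial>count_space UNIV)"
proof -
  have *: "(if Q a then F a else 0) = (\<integral>\<^sup>+b. (if Q a \<and> Q' b \<and> e a b then F a else 0) \<partial>count_space UNIV)"
    if "\<And>a. \<exists>!b. Q' b \<and> e a b" for Q Q' a
  proof -
    from that[of a] obtain c where "Q' c" "e a c" and c: "\<forall>b. Q' b \<and> e a b \<longrightarrow> b = c"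
      by blast
    then have "Q' b \<and> e a b \<longleftrightarrow> b = c" for b by blast
    then show ?thesis by (simp add: nn_integral_count_space_single)
  qed
  have "(\<integral>\<^sup>+b. (if P b then F b else 0) \<partial>count_space UNIV) =
      (\<integral>\<^sup>+b. \<integral>\<^sup>+b'. (if P b \<and> P' b' \<and> e b b' then F b else 0) \<partial>count_space UNIV \<partial>count_space UNIV)"
    by (subst *[OF P']) (rule refl)
  also have "\<dots> = (\<integral>\<^sup>+b'. \<integral>\<^sup>+b. (if P b \<and> P' b' \<and> e b b' then F b else 0) \<partial>count_space UNIV \<partial>count_space UNIV)"
    by (rule nn_integral_count_space_nn_integral) (auto simp: cnt)
  also have "\<dots> = (\<integral>\<^sup>+b'. \<integral>\<^sup>+b. (if P' b' \<and> P b \<and> e b' b then F b' else 0) \<partial>count_space UNIV \<partial>count_space UNIV)"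
    using e by (intro nn_integral_cong) (metis (no_types, opaque_lifting))
  also have "\<dots> = (\<integral>\<^sup>+b. (if P' b then F b else 0) \<partial>count_space UNIV)"
    by (subst (2) *[OF P]) (rule refl)
  finally show ?thesis .
qed

lemma ennreal_halves:
  assumes "0 \<le> c"
  shows "ennreal c = ennreal (1/2) * ennreal c + ennreal (1/2) * ennreal c"
proof -
  have "ennreal c = ennreal (1/2 * c + 1/2 * c)" by simp
  also have "\<dots> = ennreal (1/2 * c) + ennreal (1/2 * c)" using assms by (intro ennreal_plus) auto
  finally show ?thesis using assms by (simp only: ennreal_mult)
qed

lemma ennreal_mult_midpoint:
  assumes "0 \<le> s" "0 \<le> a" "0 \<le> b"
  shows "ennreal (1/2) * (ennreal s * ennreal a) + ennreal (1/2) * (ennreal s * ennreal b) =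
    ennreal s * ennreal ((a + b) / 2)"
proof -
  have "ennreal s * ennreal ((a + b) / 2) = ennreal (1/2 * (s * a) + 1/2 * (s * b))"
    using assms by (subst ennreal_mult[symmetric]) (simp_all add: field_simps)
  also have "\<dots> = ennreal (1/2 * (s * a)) + ennreal (1/2 * (s * b))"
    using assms by (intro ennreal_plus) auto
  finally show ?thesis using assms by (simp only: ennreal_mult mult_nonneg_nonneg zero_le_divide_1_iff zero_le_numeral)
qed

section \<open>Sums over classes and the diagonal action\<close>

definition act :: "'g::group_add \<Rightarrow> 'g \<times> ('g \<Rightarrow> 'c) \<Rightarrow> 'g \<times> ('g \<Rightarrow> 'c)" where
  "act h = (\<lambda>(b, x). (h + b, shift h x))"

lemma act_act: "act h (act k z) = act (h + k) z"
  by (cases z) (simp add: act_def shift_shift add.assoc)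

context equivariant_equiv
begin

abbreviation pairs :: "('g \<times> ('g \<Rightarrow> nat)) measure" where
  "pairs \<equiv> count_space UNIV \<Otimes>\<^sub>M colorings"

lemma measurable_pairsI:
  "(\<And>b. (\<lambda>x. f (b, x)) \<in> measurable colorings N) \<Longrightarrow> f \<in> measurable pairs N"
  by (rule measurable_pair_measure_countable1[OF countable_group])

lemma measurable_pairsD: "f \<in> measurable pairs N \<Longrightarrow> (\<lambda>x. f (b, x)) \<in> measurable colorings N"
  by (rule measurable_compose[OF measurable_Pair1'[of b]]) auto

lemma measurable_act: "act h \<in> measurable pairs pairs"
  by (rule measurable_pairsI) (simp add: act_def)

text \<open>A function of a class and a configuration, encoded on the points of the class.\<close>

definition class_fun :: "('g \<times> ('g \<Rightarrow> nat) \<Rightarrow> 'c) \<Rightarrow> bool" where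
  "class_fun f \<longleftrightarrow> (\<forall>x a b. E x a b \<longrightarrow> f (a, x) = f (b, x))"

definition class_sum :: "('g \<times> ('g \<Rightarrow> nat) \<Rightarrow> ennreal) \<Rightarrow> ('g \<Rightarrow> nat) \<Rightarrow> ennreal" where
  "class_sum f x = (\<integral>\<^sup>+b. (if rep x b = b then f (b, x) else 0) \<partial>count_space UNIV)"

lemma class_sum_cong: "(\<And>b. f (b, x) = g (b, x)) \<Longrightarrow> class_sum f x = class_sum g x"
  unfolding class_sum_def by (intro nn_integral_cong) auto

lemma class_sum_mono: "(\<And>b. f (b, x) \<le> g (b, x)) \<Longrightarrow> class_sum f x \<le> class_sum g x"
  unfolding class_sum_def by (intro nn_integral_mono) auto

lemma class_sum_cmult: "class_sum (\<lambda>z. c (snd z) * f z) x = c x * class_sum f x"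
  unfolding class_sum_def by (subst nn_integral_cmult[symmetric]) (auto intro!: nn_integral_cong)

lemma class_sum_indicator: "class_sum (\<lambda>z. of_bool (E (snd z) a (fst z))) x = 1"
proof -
  have "rep x b = b \<and> E x a b \<longleftrightarrow> b = rep x a" for b
    using E_rep[of x a] rep_eq_iff[of x] by metis
  then have "(\<lambda>b. if rep x b = b then of_bool (E x a b) else 0 :: ennreal) = (\<lambda>b. if b = rep x a then 1 else 0)"
    by (auto simp: fun_eq_iff)
  then show ?thesis
    unfolding class_sum_def fst_conv snd_conv by (simp only: nn_integral_count_space_single)
qed

lemma class_sum_ge: "rep x b = b \<Longrightarrow> f (b, x) \<le> class_sum f x"
  using nn_integral_ge_point[of b UNIV "\<lambda>b. if rep x b = b then f (b, x) else 0"]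
  by (simp add: class_sum_def)

text \<open>Translation by \<open>h\<close> turns the representatives for \<open>x\<close> into a
  transversal for \<open>shift h x\<close>, in general not the one chosen by \<open>rep\<close>; a
  class function has the same sum over both.\<close>

lemma class_sum_shift:
  assumes "class_fun f"
  shows "class_sum f (shift h x) = class_sum (\<lambda>z. f (act h z)) x"
proof -
  let ?y = "shift h x"
  have ex1: "\<exists>!b. rep x (- h + b) = - h + b \<and> E ?y a b" for a
  proof (rule ex1I[of _ "h + rep x (- h + a)"])
    show "rep x (- h + (h + rep x (- h + a))) = - h + (h + rep x (- h + a)) \<and> E ?y a (h + rep x (- h + a))"
      using E_rep[of x "- h + a"] rep_eq_iff[of x] E_sym by (simp add: equivariant' add.assoc[symmetric])
    fix b assume "rep x (- h + b) = - h + b \<and> E ?y a b"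
    then have "- h + b = rep x (- h + a)"
      using rep_eq_iff[of x] by (simp add: equivariant') metis
    then show "b = h + rep x (- h + a)" by (metis add.assoc add_0 right_minus)
  qed
  have ex1': "\<exists>!b. rep y b = b \<and> E y a b" for y a
    using E_rep[of y] rep_eq_iff[of y] by metis
  have "class_sum f ?y = (\<integral>\<^sup>+b. (if rep x (- h + b) = - h + b then f (b, ?y) else 0) \<partial>count_space UNIV)"
    unfolding class_sum_def
  proof (rule sum_over_transversal_eq[OF countable_group, of "E ?y"])
    show "\<exists>!b. rep ?y b = b \<and> E ?y a b" for a by (rule ex1')
    show "\<exists>!b. rep x (- h + b) = - h + b \<and> E ?y a b" for a by (rule ex1)
    show "E ?y a b \<Longrightarrow> E ?y b a" for a b by (rule E_sym)
    show "E ?y a b \<Longrightarrow> f (a, ?y) = f (b, ?y)" for a b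
      using assms by (simp add: class_fun_def)
  qed
  also have "\<dots> = (\<integral>\<^sup>+b. (if rep x (- h + (h + b)) = - h + (h + b) then f (h + b, ?y) else 0) \<partial>count_space UNIV)"
    by (rule nn_integral_bij_count_space[symmetric])
       (auto intro!: bij_betw_byWitness[where f' = "\<lambda>b. - h + b"] simp: add.assoc[symmetric])
  finally show ?thesis
    by (simp add: class_sum_def act_def add.assoc[symmetric] cong: if_cong)
qed

lemma measurable_class_sum [measurable]:
  assumes "f \<in> borel_measurable pairs"
  shows "class_sum f \<in> borel_measurable colorings"
proof -
  have [measurable]: "(\<lambda>x. f (b, x)) \<in> borel_measurable colorings" for b
    using assms by (rule measurable_pairsD)
  have "(\<lambda>z. if rep (snd z) (fst z) = fst z then f z else 0) \<in> borel_measurable pairs"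
    by (rule measurable_pairsI) simp
  from measurable_compose[OF measurable_pair_swap' this]
  have "(\<lambda>(x, b). if rep x b = b then f (b, x) else 0) \<in> borel_measurable (colorings \<Otimes>\<^sub>M count_space UNIV)"
    by (simp add: case_prod_beta' cong: if_cong)
  then show ?thesis
    unfolding class_sum_def[abs_def]
    by (intro sigma_finite_measure.borel_measurable_nn_integral sigma_finite_measure_count_space_countable countable_group) (simp add: case_prod_beta')
qed

context
  fixes \<mu> :: "('g \<Rightarrow> nat) measure"
  assumes inv: "\<mu> \<in> invariant_prob_measures shift colorings"
begin

declare sets_mu[OF inv, measurable_cong]

text \<open>Integration over pairs (class, configuration): each class is counted once, through its
  representative.\<close>

definition class_measure :: "('g \<times> ('g \<Rightarrow> nat)) measure" where
  "class_measure = density (count_space UNIV \<Otimes>\<^sub>M \<mu>) (\<lambda>z. of_bool (rep (snd z) (fst z) = fst z))"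

lemma sets_class_measure [measurable_cong]: "sets class_measure = sets pairs"
  unfolding class_measure_def sets_density by (intro sets_pair_measure_cong refl sets_mu[OF inv])

lemma nn_integral_class_measure:
  assumes [measurable]: "f \<in> borel_measurable pairs"
  shows "(\<integral>\<^sup>+z. f z \<partial>class_measure) = (\<integral>\<^sup>+x. class_sum f x \<partial>\<mu>)"
proof -
  interpret M: prob_space \<mu> by (rule prob_mu[OF inv])
  have [measurable]: "(\<lambda>x. f (b, x)) \<in> borel_measurable colorings" for b
    by (rule measurable_pairsD) measurable
  have eq: "borel_measurable (count_space UNIV \<Otimes>\<^sub>M \<mu>) = borel_measurable pairs"
    by (intro measurable_cong_sets sets_pair_measure_cong refl sets_mu[OF inv])
  have m: "(\<lambda>z. of_bool (rep (snd z) (fst z) = fst z) :: ennreal) \<in> borel_measurable pairs"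
    by (rule measurable_pairsI) simp
  have "(\<integral>\<^sup>+z. f z \<partial>class_measure) =
      (\<integral>\<^sup>+z. of_bool (rep (snd z) (fst z) = fst z) * f z \<partial>(count_space UNIV \<Otimes>\<^sub>M \<mu>))"
    unfolding class_measure_def using m assms by (intro nn_integral_density) (simp_all only: eq)
  also have "\<dots> = (\<integral>\<^sup>+b. \<integral>\<^sup>+x. of_bool (rep x b = b) * f (b, x) \<partial>\<mu> \<partial>count_space UNIV)"
    using borel_measurable_times_ennreal[OF m assms]
    by (subst M.nn_integral_fst[symmetric]) (simp_all add: eq)
  also have "\<dots> = (\<integral>\<^sup>+x. \<integral>\<^sup>+b. of_bool (rep x b = b) * f (b, x) \<partial>count_space UNIV \<partial>\<mu>)"
    by (rule nn_integral_count_space_nn_integral[symmetric])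
      (simp_all add: countable_group measurable_cong_sets[OF sets_mu[OF inv] refl])
  finally show ?thesis
    unfolding class_sum_def by (auto intro!: nn_integral_cong)
qed

lemma nn_integral_shift:
  assumes [measurable]: "f \<in> borel_measurable colorings"
  shows "(\<integral>\<^sup>+x. f (shift h x) \<partial>\<mu>) = (\<integral>\<^sup>+x. f x \<partial>\<mu>)"
proof -
  have "(\<integral>\<^sup>+x. f x \<partial>distr \<mu> colorings (shift h)) = (\<integral>\<^sup>+x. f (shift h x) \<partial>\<mu>)"
    by (rule nn_integral_distr)
      (simp_all add: measurable_cong_sets[OF sets_mu[OF inv] refl])
  then show ?thesis by (simp add: distr_mu[OF inv])
qed

text \<open>\<open>class_measure\<close> lives on representatives and need not be invariant itself.
  On class functions the choice of representatives is invisible, and the invariance of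
  \<open>\<mu>\<close> applies.\<close>

lemma class_measure_act:
  assumes [measurable]: "f \<in> borel_measurable pairs" and "class_fun f"
  shows "(\<integral>\<^sup>+z. f (act h z) \<partial>class_measure) = (\<integral>\<^sup>+z. f z \<partial>class_measure)"
proof -
  have "(\<lambda>z. f (act h z)) \<in> borel_measurable pairs"
    by (rule measurable_compose[OF measurable_act]) measurable
  then show ?thesis
    by (simp add: nn_integral_class_measure class_sum_shift[OF assms(2), symmetric] nn_integral_shift)
qed

end

text \<open>Closure under midpoints suffices for the parallelogram argument, so only the dyadic convex
  hull of the orbit of \<open>C \<mapsto> |C \<inter> W|\<close> is formed. The cluster is given by one of its points \<open>b\<close>.\<close>

inductive_set dyadic_hull :: "'g set \<Rightarrow> ('g \<times> ('g \<Rightarrow> nat) \<Rightarrow> real) set" for W :: "'g set" where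
  translate: "(\<lambda>z. \<Sum>w\<in>W. of_bool (E (snd z) (g + w) (fst z))) \<in> dyadic_hull W"
| midpoint: "V \<in> dyadic_hull W \<Longrightarrow> V' \<in> dyadic_hull W \<Longrightarrow> (\<lambda>z. (V z + V' z) / 2) \<in> dyadic_hull W"

lemma dyadic_hull_measurable: "V \<in> dyadic_hull W \<Longrightarrow> V \<in> borel_measurable pairs"
proof (induction rule: dyadic_hull.induct)
  case (translate g)
  show ?case by (rule measurable_pairsI) simp
qed simp

lemma dyadic_hull_class_fun: "V \<in> dyadic_hull W \<Longrightarrow> class_fun V"
proof (induction rule: dyadic_hull.induct)
  case (translate g)
  have "E x c a = E x c b" if "E x a b" for x a b c
    using that E_sym E_trans by blast
  then show ?case by (simp add: class_fun_def)
qed (simp add: class_fun_def)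

lemma dyadic_hull_nonneg: "V \<in> dyadic_hull W \<Longrightarrow> 0 \<le> V z"
  by (induction arbitrary: z rule: dyadic_hull.induct) (auto intro: sum_nonneg split: prod.split)

lemma dyadic_hull_act: "V \<in> dyadic_hull W \<Longrightarrow> (\<lambda>z. V (act h z)) \<in> dyadic_hull W"
proof (induction rule: dyadic_hull.induct)
  case (translate g)
  have "(\<lambda>z. \<Sum>w\<in>W. of_bool (E (snd (act h z)) (g + w) (fst (act h z))) :: real) =
      (\<lambda>z. \<Sum>w\<in>W. of_bool (E (snd z) ((- h + g) + w) (fst z)))"
    by (auto simp: act_def fun_eq_iff equivariant' add.assoc[symmetric] split: prod.split)
  then show ?case using dyadic_hull.translate[where g = "- h + g" and W = W] by simp
qed (rule dyadic_hull.midpoint)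

context
  fixes \<mu> :: "('g \<Rightarrow> nat) measure" and W :: "'g set" and c :: real
  assumes inv: "\<mu> \<in> invariant_prob_measures shift colorings" and W: "finite W" and c: "0 < c"
    and nonmixing: "\<And>g. c \<le> measure \<mu> {x. \<exists>a\<in>W. \<exists>b\<in>W. E x a (g + b)}"
begin

declare sets_mu[OF inv, measurable_cong] sets_class_measure[OF inv, measurable_cong]

abbreviation R where "R \<equiv> class_measure \<mu>"

lemma borel_measurable_R: "borel_measurable R = borel_measurable pairs"
  by (rule measurable_cong_sets[OF sets_class_measure[OF inv] refl])

text \<open>A class contains at most \<open>card W\<close> points of a translate of
  \<open>W\<close>, and each of these points lies in exactly one class; so the squared counts sum to
  at most \<open>(card W)^2\<close>. For midpoints a crude bound by the sum of both squares is
  enough.\<close>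

lemma dyadic_hull_finite: "V \<in> dyadic_hull W \<Longrightarrow> sq_norm R V < \<infinity>"
proof (induction rule: dyadic_hull.induct)
  case (translate g)
  interpret M: prob_space \<mu> by (rule prob_mu[OF inv])
  have m: "(\<lambda>z. of_bool (E (snd z) a (fst z)) :: ennreal) \<in> borel_measurable pairs" for a
    by (rule measurable_pairsI) simp
  have "ennreal ((\<Sum>w\<in>W. of_bool (E (snd z) (g + w) (fst z)))\<^sup>2)
      \<le> of_nat (card W) * (\<Sum>w\<in>W. of_bool (E (snd z) (g + w) (fst z)))" for z
  proof -
    let ?s = "\<Sum>w\<in>W. of_bool (E (snd z) (g + w) (fst z)) :: real"
    have "?s * ?s \<le> real (card W) * ?s"
      using sum_bounded_above[of W "\<lambda>w. of_bool (E (snd z) (g + w) (fst z)) :: real" 1]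
      by (intro mult_right_mono) (auto intro: sum_nonneg)
    then have "ennreal (?s\<^sup>2) \<le> ennreal (real (card W) * ?s)"
      by (intro ennreal_leI) (simp add: power2_eq_square)
    also have "\<dots> = of_nat (card W) * ennreal ?s"
      by (subst ennreal_mult) (auto intro: sum_nonneg simp: ennreal_of_nat_eq_real_of_nat)
    also have "ennreal ?s = (\<Sum>w\<in>W. ennreal (of_bool (E (snd z) (g + w) (fst z))))"
      by (rule sum_ennreal[symmetric]) simp
    also have "\<dots> = (\<Sum>w\<in>W. of_bool (E (snd z) (g + w) (fst z)))"
      by (intro sum.cong) auto
    finally show ?thesis .
  qed
  then have "sq_norm R (\<lambda>z. \<Sum>w\<in>W. of_bool (E (snd z) (g + w) (fst z)))
      \<le> (\<integral>\<^sup>+z. of_nat (card W) * (\<Sum>w\<in>W. of_bool (E (snd z) (g + w) (fst z))) \<partial>R)"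
    by (intro nn_integral_mono) auto
  also have "\<dots> = of_nat (card W) * (\<Sum>w\<in>W. \<integral>\<^sup>+z. of_bool (E (snd z) (g + w) (fst z)) \<partial>R)"
    using m by (simp add: nn_integral_cmult nn_integral_sum borel_measurable_R)
  also have "\<dots> = of_nat (card W) * of_nat (card W)"
    by (simp add: nn_integral_class_measure[OF inv m] class_sum_indicator M.emeasure_space_1)
  also have "\<dots> < \<infinity>" by (simp add: ennreal_mult_less_top of_nat_less_top)
  finally show ?case .
next
  case (midpoint V V')
  note [measurable] = dyadic_hull_measurable[OF midpoint.hyps(1)] dyadic_hull_measurable[OF midpoint.hyps(2)]
  have "ennreal (((a + b) / 2)\<^sup>2) \<le> ennreal (a\<^sup>2) + ennreal (b\<^sup>2)" for a b :: real
  proof -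
    have "((a + b) / 2)\<^sup>2 \<le> a\<^sup>2 + b\<^sup>2"
    proof -
      have "a\<^sup>2 + b\<^sup>2 - ((a + b) / 2)\<^sup>2 = (a - b)\<^sup>2 / 4 + (a\<^sup>2 + b\<^sup>2) / 2"
        by (simp add: power2_eq_square field_simps)
      moreover have "0 \<le> (a - b)\<^sup>2 / 4 + (a\<^sup>2 + b\<^sup>2) / 2" by simp
      ultimately show ?thesis by linarith
    qed
    then have "ennreal (((a + b) / 2)\<^sup>2) \<le> ennreal (a\<^sup>2 + b\<^sup>2)" by (rule ennreal_leI)
    then show ?thesis by simp
  qed
  then have "sq_norm R (\<lambda>z. (V z + V' z) / 2) \<le> (\<integral>\<^sup>+z. ennreal ((V z)\<^sup>2) + ennreal ((V' z)\<^sup>2) \<partial>R)"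
    by (intro nn_integral_mono)
  also have "\<dots> = sq_norm R V + sq_norm R V'"
    by (intro nn_integral_add) (simp_all add: borel_measurable_R)
  also have "\<dots> < \<infinity>" using midpoint.IH by simp
  finally show ?case .
qed

text \<open>By invariance of \<open>\<mu>\<close> only the difference \<open>- g + h\<close>
  matters.\<close>

lemma nonmixing_translates:
  "ennreal c \<le> emeasure \<mu> {x. \<exists>w\<in>W. \<exists>w'\<in>W. E x (g + w) (h + w')}"
proof -
  interpret M: prob_space \<mu> by (rule prob_mu[OF inv])
  have m: "{x. \<exists>w\<in>W. \<exists>w'\<in>W. E x w ((- g + h) + w')} \<in> sets colorings"
  proof -
    have "Measurable.pred colorings (\<lambda>x. \<exists>w\<in>W. \<exists>w'\<in>W. E x w ((- g + h) + w'))"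
      using W by measurable
    then show ?thesis by (simp add: pred_def)
  qed
  have "c \<le> measure \<mu> {x. \<exists>w\<in>W. \<exists>w'\<in>W. E x w ((- g + h) + w')}" by (rule nonmixing)
  also have "\<dots> = measure \<mu> {x. shift (- g) x \<in> {x. \<exists>w\<in>W. \<exists>w'\<in>W. E x w ((- g + h) + w')}}"
    by (rule invariant_measure_shift[OF inv m, symmetric])
  also have "{x. shift (- g) x \<in> {x. \<exists>w\<in>W. \<exists>w'\<in>W. E x w ((- g + h) + w')}} =
      {x. \<exists>w\<in>W. \<exists>w'\<in>W. E x (g + w) (h + w')}"
    by (simp add: equivariant' add.assoc[symmetric])
  finally show ?thesis by (simp add: M.emeasure_eq_measure ennreal_leI)
qed

text \<open>For two translates the integrand is at least 1 on any class meeting both windows, so the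
  nonmixing hypothesis bounds the inner product from below. By bilinearity the bound passes to
  midpoints in each argument, hence the nested inductions; with \<open>V' = V\<close> it bounds the
  norm.\<close>

lemma dyadic_hull_product_ge:
  assumes "V \<in> dyadic_hull W" "V' \<in> dyadic_hull W"
  shows "ennreal c \<le> (\<integral>\<^sup>+z. ennreal (V z) * ennreal (V' z) \<partial>R)"
  using assms
proof (induction arbitrary: V' rule: dyadic_hull.induct)
  case (translate g)
  let ?V = "\<lambda>g z. \<Sum>w\<in>W. of_bool (E (snd z) (g + w) (fst z)) :: real"
  note [measurable] = dyadic_hull_measurable[OF dyadic_hull.translate[where W = W]]
  from translate show ?case
  proof (induction V' rule: dyadic_hull.induct)
    case (translate h)
    let ?A = "{x. \<exists>w\<in>W. \<exists>w'\<in>W. E x (g + w) (h + w')}"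
    have "Measurable.pred colorings (\<lambda>x. \<exists>w\<in>W. \<exists>w'\<in>W. E x (g + w) (h + w'))"
      using W by measurable
    then have A: "?A \<in> sets \<mu>" by (simp add: pred_def sets_mu[OF inv])
    have "ennreal c \<le> (\<integral>\<^sup>+x. indicator ?A x \<partial>\<mu>)"
      using nonmixing_translates A by simp
    also have "\<dots> \<le> (\<integral>\<^sup>+x. class_sum (\<lambda>z. ennreal (?V g z) * ennreal (?V h z)) x \<partial>\<mu>)"
    proof (intro nn_integral_mono)
      fix x
      show "indicator ?A x \<le> class_sum (\<lambda>z. ennreal (?V g z) * ennreal (?V h z)) x"
      proof (cases "x \<in> ?A")
        case True
        then obtain w w' where w: "w \<in> W" "w' \<in> W" "E x (g + w) (h + w')" by blast
        define b where "b = rep x (g + w)"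
        have b: "E x (g + w) b" "E x (h + w') b"
          using E_rep[of x "g + w"] w(3) E_sym E_trans unfolding b_def by blast+
        have "1 \<le> ?V k (b, x)" if "E x (k + u) b" "u \<in> W" for k u
          using member_le_sum[of u W "\<lambda>u. of_bool (E x (k + u) b) :: real"] that W by simp
        then have "(1 :: ennreal) * 1 \<le> ennreal (?V g (b, x)) * ennreal (?V h (b, x))"
          using b w by (intro mult_mono) (auto simp: ennreal_ge_1 simp del: mult_1)
        also have "\<dots> \<le> class_sum (\<lambda>z. ennreal (?V g z) * ennreal (?V h z)) x"
          using b(1) rep_eq_iff[of x "g + w" b]
          by (intro class_sum_ge[where f = "\<lambda>z. ennreal (?V g z) * ennreal (?V h z)"]) (simp add: b_def)
        finally show ?thesis using True by simp
      qed simp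
    qed
    also have "\<dots> = (\<integral>\<^sup>+z. ennreal (?V g z) * ennreal (?V h z) \<partial>R)"
      by (rule nn_integral_class_measure[OF inv, symmetric]) measurable
    finally show ?case .
  next
    case (midpoint V V')
    note [measurable] = dyadic_hull_measurable[OF midpoint.hyps(1)] dyadic_hull_measurable[OF midpoint.hyps(2)]
    have "ennreal c = ennreal (1/2) * ennreal c + ennreal (1/2) * ennreal c"
      using c by (intro ennreal_halves) simp
    also have "\<dots> \<le> ennreal (1/2) * (\<integral>\<^sup>+z. ennreal (?V g z) * ennreal (V z) \<partial>R) + ennreal (1/2) * (\<integral>\<^sup>+z. ennreal (?V g z) * ennreal (V' z) \<partial>R)"
      using midpoint.IH by (intro add_mono mult_left_mono) auto
    also have "\<dots> = (\<integral>\<^sup>+z. ennreal (1/2) * (ennreal (?V g z) * ennreal (V z)) + ennreal (1/2) * (ennreal (?V g z) * ennreal (V' z)) \<partial>R)"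
      by (simp add: nn_integral_add nn_integral_cmult borel_measurable_R)
    also have "\<dots> = (\<integral>\<^sup>+z. ennreal (?V g z) * ennreal ((V z + V' z) / 2) \<partial>R)"
      using dyadic_hull_nonneg[OF dyadic_hull.translate[where g = g and W = W]] dyadic_hull_nonneg[OF midpoint.hyps(1)] dyadic_hull_nonneg[OF midpoint.hyps(2)]
      by (intro nn_integral_cong ennreal_mult_midpoint)
    finally show ?case .
  qed
next
  case (midpoint V V'' V')
  note [measurable] = dyadic_hull_measurable[OF midpoint.hyps(1)] dyadic_hull_measurable[OF midpoint.hyps(2)] dyadic_hull_measurable[OF midpoint.prems]
  have "ennreal c = ennreal (1/2) * ennreal c + ennreal (1/2) * ennreal c"
    using c by (intro ennreal_halves) simp
  also have "\<dots> \<le> ennreal (1/2) * (\<integral>\<^sup>+z. ennreal (V z) * ennreal (V' z) \<partial>R) + ennreal (1/2) * (\<integral>\<^sup>+z. ennreal (V'' z) * ennreal (V' z) \<partial>R)"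
    using midpoint.IH midpoint.prems by (intro add_mono mult_left_mono) auto
  also have "\<dots> = (\<integral>\<^sup>+z. ennreal (1/2) * (ennreal (V z) * ennreal (V' z)) + ennreal (1/2) * (ennreal (V'' z) * ennreal (V' z)) \<partial>R)"
    by (simp add: nn_integral_add nn_integral_cmult borel_measurable_R)
  also have "\<dots> = (\<integral>\<^sup>+z. ennreal ((V z + V'' z) / 2) * ennreal (V' z) \<partial>R)"
    using dyadic_hull_nonneg[OF midpoint.hyps(1)] dyadic_hull_nonneg[OF midpoint.hyps(2)] dyadic_hull_nonneg[OF midpoint.prems]
    by (intro nn_integral_cong) (simp only: ennreal_mult_midpoint mult.commute[of _ "ennreal (V' _)"])
  finally show ?case .
qed

text \<open>The weight is the square of the minimal element, so that square integrability becomes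
  finiteness of the total mass.\<close>

lemma invariant_class_weight:
  "\<exists>U \<in> borel_measurable pairs. class_fun U \<and> (\<forall>h z. U (act h z) = U z) \<and>
    0 < (\<integral>\<^sup>+z. U z \<partial>R) \<and> (\<integral>\<^sup>+z. U z \<partial>R) < \<infinity>"
proof -
  have sq: "sq_norm R V = (\<integral>\<^sup>+z. ennreal (V z) * ennreal (V z) \<partial>R)" if "V \<in> dyadic_hull W" for V
    using dyadic_hull_nonneg[OF that] by (simp add: power2_eq_square ennreal_mult)
  have "\<exists>V. (\<forall>n. V n \<in> dyadic_hull W) \<and> (AE z in R. \<forall>h. lim (\<lambda>n. V n (act h z)) = lim (\<lambda>n. V n z)) \<and>
    0 < sq_norm R (\<lambda>z. lim (\<lambda>n. V n z)) \<and> sq_norm R (\<lambda>z. lim (\<lambda>n. V n z)) < \<infinity>"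
  proof (rule invariant_limit_of_midpoint_closed[OF countable_group])
    show "dyadic_hull W \<noteq> {}" using dyadic_hull.translate by blast
    show "V \<in> borel_measurable R" if "V \<in> dyadic_hull W" for V
      using dyadic_hull_measurable[OF that] by (simp add: borel_measurable_R)
    show "ennreal c \<le> sq_norm R V" if "V \<in> dyadic_hull W" for V
      using dyadic_hull_product_ge[OF that that] by (simp add: sq[OF that])
    show "sq_norm R (\<lambda>z. V (act h z)) = sq_norm R V" if "V \<in> dyadic_hull W" for V h
    proof (rule class_measure_act[OF inv, of "\<lambda>z. ennreal ((V z)\<^sup>2)"])
      show "(\<lambda>z. ennreal ((V z)\<^sup>2)) \<in> borel_measurable pairs"
        using dyadic_hull_measurable[OF that] by measurable
      show "class_fun (\<lambda>z. ennreal ((V z)\<^sup>2))"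
        using dyadic_hull_class_fun[OF that] by (simp add: class_fun_def)
    qed
  qed (fact c dyadic_hull_finite dyadic_hull.midpoint dyadic_hull_act)+
  then obtain V where V: "\<And>n. V n \<in> dyadic_hull W"
    and AE: "AE z in R. \<forall>h. lim (\<lambda>n. V n (act h z)) = lim (\<lambda>n. V n z)"
    and pos: "0 < sq_norm R (\<lambda>z. lim (\<lambda>n. V n z))" and fin: "sq_norm R (\<lambda>z. lim (\<lambda>n. V n z)) < \<infinity>"
    by blast
  define L where "L = (\<lambda>z. lim (\<lambda>n. V n z))"
  \<comment> \<open>\<open>L\<close> is invariant only almost everywhere; the supremum over the orbit is invariant everywhere.\<close>
  define U where "U z = (SUP h. ennreal ((L (act h z))\<^sup>2))" for z
  note [measurable] = dyadic_hull_measurable[OF V] measurable_act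
  have [measurable]: "L \<in> borel_measurable pairs" unfolding L_def by measurable
  have "U \<in> borel_measurable pairs"
    unfolding U_def[abs_def] by (intro borel_measurable_SUP countable_group) measurable
  moreover have "class_fun U"
  proof -
    have "L (act h (a, x)) = L (act h (b, x))" if "E x a b" for h x a b
    proof -
      have "E (shift h x) (h + a) (h + b)" using that by (simp add: equivariant)
      then show ?thesis
        using dyadic_hull_class_fun[OF V] by (simp add: L_def act_def class_fun_def)
    qed
    then show ?thesis by (simp add: class_fun_def U_def)
  qed
  moreover have "U (act k z) = U z" for k z
  proof -
    have "range (\<lambda>h. ennreal ((L (act (h + k) z))\<^sup>2)) = range (\<lambda>h. ennreal ((L (act h z))\<^sup>2))"
      by (auto simp: image_iff) (metis add.assoc add.right_neutral left_minus)
    then show ?thesis by (simp add: U_def act_act)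
  qed
  moreover have "(\<integral>\<^sup>+z. U z \<partial>R) = sq_norm R L"
    using AE by (intro nn_integral_cong_AE, eventually_elim) (simp add: U_def L_def)
  ultimately show ?thesis
    using pos fin by (intro bexI[of _ U]) (auto simp: L_def)
qed

end

end

section \<open>The lower bound on the cost\<close>

lemma measure_iid_box:
  assumes "finite J"
  shows "measure (iid p) {u. \<forall>v\<in>J. u v \<in> X v} = (\<Prod>v\<in>J. measure (measure_pmf p) (X v))"
proof -
  interpret product_prob_space "\<lambda>_. measure_pmf p" UNIV
    by standard
  have "prod_emb UNIV (\<lambda>_. measure_pmf p) J (Pi\<^sub>E J X) = {u. \<forall>v\<in>J. u v \<in> X v}"
    by (auto simp: prod_emb_def PiE_UNIV_domain restrict_def PiE_iff)
  then show ?thesis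
    using measure_PiM_emb[of J X] assms by (simp add: iid_def)
qed

lemma emeasure_count_space_Collect:
  "emeasure (count_space UNIV) {b. P b} = (\<integral>\<^sup>+b. of_bool (P b) \<partial>count_space UNIV)"
proof -
  have "(\<lambda>b. of_bool (P b)) = (indicator {b. P b} :: _ \<Rightarrow> ennreal)"
    by (simp add: fun_eq_iff indicator_def)
  then show ?thesis by simp
qed

lemma sets_coordinate:
  assumes "countable (UNIV :: 'v set)"
  shows "(\<lambda>\<omega>. \<omega> a) \<in> measurable (borel :: ('v \<Rightarrow> bool) measure) (count_space UNIV)"
  using measurable_cong_sets[OF borel_eq_PiM_bool[OF assms] refl, of "count_space (UNIV :: bool set)"]
  by (metis measurable_component_singleton UNIV_I)

lemma countable_UNIV_prod:
  assumes "countable (UNIV :: 'v set)"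
  shows "countable (UNIV :: ('v \<times> 'v) set)"
  using countable_SIGMA[OF assms, of "\<lambda>_. UNIV :: 'v set"] assms by simp

text \<open>Graph distance at most \<open>n\<close> from \<open>v\<close> to the zero set of
  \<open>u\<close>. The recursion on \<open>n\<close> opens measurability and equivariance to
  induction and leaves room for vertices at infinite distance.\<close>

primrec near :: "nat \<Rightarrow> ('v \<times> 'v \<Rightarrow> bool) \<Rightarrow> ('v \<Rightarrow> nat) \<Rightarrow> 'v \<Rightarrow> bool" where
  "near 0 \<omega> u v \<longleftrightarrow> u v = 0"
| "near (Suc n) \<omega> u v \<longleftrightarrow> near n \<omega> u v \<or> (\<exists>w. \<omega> (v, w) \<and> near n \<omega> u w)"

text \<open>The neighbour \<open>w\<close> is strictly closer to the zero set than \<open>v\<close>: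
  the threshold \<open>n\<close> separates the two distances.\<close>

definition descent :: "('v \<times> 'v \<Rightarrow> bool) \<Rightarrow> ('v \<Rightarrow> nat) \<Rightarrow> 'v \<Rightarrow> 'v \<Rightarrow> bool" where
  "descent \<omega> u v w \<longleftrightarrow> \<omega> (v, w) \<and> (\<exists>n. near n \<omega> u w \<and> \<not> near n \<omega> u v)"

text \<open>Among the neighbours closer to the zero set of \<open>u\<close>, the one whose difference from \<open>v\<close> comes first
  in a fixed enumeration of the group; this makes the choice equivariant.\<close>

definition arrow :: "('g::group_add \<times> 'g \<Rightarrow> bool) \<Rightarrow> ('g \<Rightarrow> nat) \<Rightarrow> 'g \<Rightarrow> 'g \<Rightarrow> bool" where
  "arrow \<omega> u v w \<longleftrightarrow> descent \<omega> u v w \<and>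
    (\<forall>a. to_nat_on UNIV a < to_nat_on UNIV (- v + w) \<longrightarrow> \<not> descent \<omega> u v (v + a))"

lemma near_mono: "near n \<omega> u v \<Longrightarrow> n \<le> m \<Longrightarrow> near m \<omega> u v"
  by (induction m) (auto simp: le_Suc_eq)

text \<open>The sets given by \<open>near n\<close> grow with \<open>n\<close>, so two thresholds
  cannot separate \<open>v\<close> and \<open>w\<close> in opposite directions.\<close>

lemma descent_asym: "descent \<omega> u v w \<Longrightarrow> \<not> descent \<omega> u w v"
  unfolding descent_def using near_mono[of _ \<omega> u] nat_le_linear by metis

lemma near_connected:
  assumes "(\<lambda>a b. \<omega> (a, b))\<^sup>*\<^sup>* v b" "u b = 0"
  shows "\<exists>n. near n \<omega> u v"
  using assms
proof (induction rule: converse_rtranclp_induct)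
  case base
  then have "near 0 \<omega> u b" by simp
  then show ?case by blast
next
  case (step v w)
  then obtain n where "near n \<omega> u w" by blast
  with step have "near (Suc n) \<omega> u v" by auto
  then show ?case by blast
qed

lemma descent_exists:
  assumes "near n \<omega> u v" "u v \<noteq> 0"
  shows "\<exists>w. descent \<omega> u v w"
  using assms
proof (induction n)
  case (Suc n)
  then show ?case by (auto simp: descent_def)
qed simp

lemma arrow_exists:
  fixes v :: "'g::group_add"
  assumes "near n \<omega> u v" "u v \<noteq> 0"
  shows "\<exists>w. arrow \<omega> u v w"
proof -
  obtain w where "descent \<omega> u v w" using descent_exists[OF assms] by blast
  then have "descent \<omega> u v (v + (- v + w))" by (simp add: add.assoc[symmetric])
  from ex_has_least_nat[of "\<lambda>a. descent \<omega> u v (v + a)", OF this, of "to_nat_on UNIV"]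
  obtain a where "descent \<omega> u v (v + a)" "\<And>b. descent \<omega> u v (v + b) \<Longrightarrow> to_nat_on UNIV a \<le> to_nat_on UNIV b"
    by blast
  then have "arrow \<omega> u v (v + a)"
    by (auto simp: arrow_def add.assoc[symmetric] not_less[symmetric])
  then show ?thesis ..
qed

lemma ex_translate: "(\<exists>w. P (g + w)) \<longleftrightarrow> (\<exists>w :: 'g::group_add. P w)"
  by (metis add.assoc add_0 right_minus)

lemma near_act: "near n (graph_act g \<omega>) (shift g u) (g + v) \<longleftrightarrow> near n \<omega> u v"
proof (induction n arbitrary: v)
  case (Suc n)
  have "(\<exists>w. graph_act g \<omega> (g + v, w) \<and> near n (graph_act g \<omega>) (shift g u) w) \<longleftrightarrow>
      (\<exists>w. graph_act g \<omega> (g + v, g + w) \<and> near n (graph_act g \<omega>) (shift g u) (g + w))"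
    by (rule ex_translate[symmetric])
  then show ?case using Suc by (simp add: graph_act_def add.assoc[symmetric])
qed simp

lemma descent_act: "descent (graph_act g \<omega>) (shift g u) (g + v) (g + w) \<longleftrightarrow> descent \<omega> u v w"
  by (simp add: descent_def near_act) (simp add: graph_act_def add.assoc[symmetric])

lemma arrow_act: "arrow (graph_act g \<omega>) (shift g u) (g + v) (g + w) \<longleftrightarrow> arrow \<omega> u v w"
proof -
  have "- (g + v) + (g + w) = - v + w" by (simp add: minus_add add.assoc) (simp add: add.assoc[symmetric])
  then show ?thesis
    unfolding arrow_def descent_act add.assoc by simp
qed

lemma arrow_degree:
  assumes sym: "\<And>a b. \<omega> (a, b) = \<omega> (b, a)"
  shows "emeasure (count_space UNIV) {w. arrow \<omega> u v w} + emeasure (count_space UNIV) {w. arrow \<omega> u w v} \<le> graph_degree \<omega> v"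
proof -
  have "emeasure (count_space UNIV) {w. arrow \<omega> u v w} + emeasure (count_space UNIV) {w. arrow \<omega> u w v} =
      emeasure (count_space UNIV) ({w. arrow \<omega> u v w} \<union> {w. arrow \<omega> u w v})"
    by (rule plus_emeasure) (auto simp: arrow_def dest: descent_asym)
  also have "\<dots> \<le> graph_degree \<omega> v"
    unfolding graph_degree_def using sym
    by (intro emeasure_mono) (auto simp: arrow_def descent_def)
  finally show ?thesis .
qed

text \<open>Any \<open>n\<close> vertices all miss colour 0 with probability
  \<open>(1 - pmf p 0) ^ n\<close>, and an infinite vertex set offers every
  \<open>n\<close>.\<close>

lemma iid_has_zero:
  assumes inf: "infinite (UNIV :: 'v set)" and cnt: "countable (UNIV :: 'v set)" and p: "pmf p 0 > 0"
  shows "AE u in (iid p :: ('v \<Rightarrow> nat) measure). \<exists>b. u b = 0"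
proof -
  interpret prob_space "iid p :: ('v \<Rightarrow> nat) measure" by (rule prob_space_iid)
  have "Measurable.pred colorings (\<lambda>u :: 'v \<Rightarrow> nat. \<not> (\<exists>b. u b = 0))"
    by (intro pred_intros_logic pred_countable_Ex cnt) measurable
  then have m: "{u :: 'v \<Rightarrow> nat. \<not> (\<exists>b. u b = 0)} \<in> sets (iid p)"
    by (simp add: pred_def)
  have "prob {u :: 'v \<Rightarrow> nat. \<not> (\<exists>b. u b = 0)} \<le> (1 - pmf p 0) ^ n" for n
  proof -
    obtain B :: "'v set" where B: "finite B" "card B = n"
      using infinite_arbitrarily_large[OF inf] by blast
    have "Measurable.pred colorings (\<lambda>u :: 'v \<Rightarrow> nat. \<forall>v\<in>B. u v \<noteq> 0)"
      using B(1) by measurable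
    then have "prob {u :: 'v \<Rightarrow> nat. \<not> (\<exists>b. u b = 0)} \<le> prob {u. \<forall>v\<in>B. u v \<in> - {0}}"
      by (intro finite_measure_mono) (auto simp: pred_def)
    also have "\<dots> = measure (measure_pmf p) (- {0}) ^ n"
      using measure_iid_box[OF B(1), of p "\<lambda>_. - {0}"] B by simp
    also have "measure (measure_pmf p) (- {0}) = 1 - pmf p 0"
      using measure_pmf.prob_compl[of "{0}" p] by (simp add: measure_pmf_single Compl_eq_Diff_UNIV)
    finally show ?thesis .
  qed
  moreover have "(\<lambda>n. (1 - pmf p 0) ^ n) \<longlonglongrightarrow> 0"
    using p by (intro LIMSEQ_realpow_zero) (auto simp: pmf_le_1)
  ultimately have "prob {u :: 'v \<Rightarrow> nat. \<not> (\<exists>b. u b = 0)} \<le> 0"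
    by (intro LIMSEQ_le_const) auto
  then have "prob {u :: 'v \<Rightarrow> nat. \<not> (\<exists>b. u b = 0)} = 0"
    by (simp add: measure_le_0_iff)
  then have "AE u in (iid p :: ('v \<Rightarrow> nat) measure). \<not> \<not> (\<exists>b. u b = 0)"
    using m prob_Collect_eq_0[of "\<lambda>u. \<not> (\<exists>b. u b = 0)"] by simp
  then show ?thesis by simp
qed

lemma distr_iid_shift: "distr (iid p) colorings (shift g) = iid p"
proof -
  have "distr (iid p) colorings (\<lambda>u. u \<circ> (\<lambda>a. - g + a)) = distr (iid p) colorings (\<lambda>u. u \<circ> (\<lambda>a. a))"
    by (rule distr_iid_comp_eq) simp
  then show ?thesis
    by (simp add: shift_def[abs_def] comp_def distr_id2)
qed

text \<open>The random subset is the zero set of a uniform colouring by \<open>{..<K}\<close>,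
  independent of the graph. Mass transport takes place on the product space, under the diagonal
  action.\<close>

lemma expected_degree_ge:
  assumes cnt: "countable (UNIV :: 'g::group_add set)" and inf: "infinite (UNIV :: 'g set)"
    and \<mu>: "\<mu> \<in> invariant_prob_measures (graph_act :: 'g \<Rightarrow> _) (restrict_space borel connected_graphs)"
    and K: "0 < K"
  shows "ennreal (2 * (1 - 1 / real K)) \<le> (\<integral>\<^sup>+\<omega>. graph_degree \<omega> 0 \<partial>\<mu>)"
proof -
  let ?B = "restrict_space (borel :: ('g \<times> 'g \<Rightarrow> bool) measure) connected_graphs"
  have sets: "sets \<mu> = sets ?B" and \<mu>_act: "\<And>g. distr \<mu> ?B (graph_act g) = \<mu>"
    using \<mu> unfolding invariant_prob_measures_def by blast+
  interpret M: prob_space \<mu> using \<mu> unfolding invariant_prob_measures_def by blast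
  have space: "space \<mu> = connected_graphs"
    using sets_eq_imp_space_eq[OF sets] by (simp add: space_restrict_space)
  have p: "pmf (pmf_of_set {..<K}) 0 = 1 / real K"
    using K by (subst pmf_of_set) (auto simp: lessThan_empty_iff)
  define P where "P = (iid (pmf_of_set {..<K}) :: ('g \<Rightarrow> nat) measure)"
  interpret P: prob_space P unfolding P_def by (rule prob_space_iid)
  have P_sets: "sets P = sets colorings" by (simp add: P_def)
  interpret PM: pair_prob_space \<mu> P ..
  let ?N = "?B \<Otimes>\<^sub>M colorings"
  have N_sets: "sets (\<mu> \<Otimes>\<^sub>M P) = sets ?N"
    by (intro sets_pair_measure_cong sets P_sets)
  have edge [measurable]: "Measurable.pred ?N (\<lambda>z. fst z e)" for e
    by (intro measurable_compose[OF measurable_fst] measurable_restrict_space1 sets_coordinate countable_UNIV_prod cnt)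
  have near_m [measurable]: "Measurable.pred ?N (\<lambda>z. near n (fst z) (snd z) v)" for n v
  proof (induction n arbitrary: v)
    case (Suc n)
    note [measurable] = Suc
    have "Measurable.pred ?N (\<lambda>z. \<exists>w. fst z (v, w) \<and> near n (fst z) (snd z) w)"
      by (intro pred_countable_Ex cnt) measurable
    then show ?case by simp
  qed simp
  have descent_m [measurable]: "Measurable.pred ?N (\<lambda>z. descent (fst z) (snd z) v w)" for v w
    unfolding descent_def by measurable
  have arrow_m: "Measurable.pred ?N (\<lambda>z. arrow (fst z) (snd z) v w)" for v w
    unfolding arrow_def by (intro pred_intros_logic pred_countable_All cnt) measurable
  define F where "F v w z = (indicator {z. arrow (fst z) (snd z) v w} z :: ennreal)" for v w :: 'g and z
  have Fm [measurable]: "F v w \<in> borel_measurable ?N" for v w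
    unfolding F_def[abs_def] using arrow_m[of v w] by (intro borel_measurable_indicator') (simp add: pred_def)
  have Nm: "measurable (\<mu> \<Otimes>\<^sub>M P) L = measurable ?N L" for L :: "ennreal measure"
    by (rule measurable_cong_sets[OF N_sets refl])
  define a where "a v w = (\<integral>\<^sup>+z. F v w z \<partial>(\<mu> \<Otimes>\<^sub>M P))" for v w
  have a_fst: "a v w = (\<integral>\<^sup>+\<omega>. \<integral>\<^sup>+u. F v w (\<omega>, u) \<partial>P \<partial>\<mu>)" for v w
    unfolding a_def by (rule P.nn_integral_fst[symmetric]) (simp add: Nm)
  \<comment> \<open>The diagonal action preserves each factor of
    \<open>\<mu> \<Otimes>\<^sub>M P\<close>; the substitution is made first in the graph, then in
    the colouring.\<close>
  have a_act: "a (g + v) (g + w) = a v w" for g v w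
  proof -
    have gm: "graph_act g \<in> measurable \<mu> ?B"
      using measurable_graph_act measurable_cong_sets[OF sets refl] by blast
    have sm: "shift g \<in> measurable P colorings"
      using measurable_shift measurable_cong_sets[OF P_sets refl] by blast
    have inner: "(\<integral>\<^sup>+u. F (g + v) (g + w) (\<omega>, u) \<partial>P) = (\<integral>\<^sup>+u. F (g + v) (g + w) (\<omega>, shift g u) \<partial>P)"
      if "\<omega> \<in> connected_graphs" for \<omega>
    proof -
      have "(\<lambda>u. F (g + v) (g + w) (\<omega>, u)) \<in> borel_measurable colorings"
        using that by (intro measurable_compose[OF measurable_Pair1'[of \<omega> ?B]] Fm) (simp add: space_restrict_space)
      then have "(\<integral>\<^sup>+u. F (g + v) (g + w) (\<omega>, u) \<partial>distr P colorings (shift g)) = (\<integral>\<^sup>+u. F (g + v) (g + w) (\<omega>, shift g u) \<partial>P)"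
        by (intro nn_integral_distr sm) simp
      then show ?thesis by (simp add: P_def distr_iid_shift)
    qed
    have outer: "(\<lambda>\<omega>. \<integral>\<^sup>+u. F (g + v) (g + w) (\<omega>, u) \<partial>P) \<in> borel_measurable ?B"
    proof -
      have "F (g + v) (g + w) \<in> borel_measurable (?B \<Otimes>\<^sub>M P)"
        using Fm measurable_cong_sets[OF sets_pair_measure_cong[OF refl P_sets] refl] by blast
      from P.borel_measurable_nn_integral_fst[OF this] show ?thesis .
    qed
    have "a (g + v) (g + w) = (\<integral>\<^sup>+\<omega>. \<integral>\<^sup>+u. F (g + v) (g + w) (\<omega>, u) \<partial>P \<partial>distr \<mu> ?B (graph_act g))"
      by (simp add: a_fst \<mu>_act)
    also have "\<dots> = (\<integral>\<^sup>+\<omega>. \<integral>\<^sup>+u. F (g + v) (g + w) (graph_act g \<omega>, u) \<partial>P \<partial>\<mu>)"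
      using outer by (intro nn_integral_distr gm) simp
    also have "\<dots> = (\<integral>\<^sup>+\<omega>. \<integral>\<^sup>+u. F (g + v) (g + w) (graph_act g \<omega>, shift g u) \<partial>P \<partial>\<mu>)"
      by (intro nn_integral_cong inner) (simp add: space graph_act_connected_graphs)
    also have "\<dots> = a v w"
      by (simp add: a_fst F_def arrow_act indicator_def)
    finally show ?thesis .
  qed
  define out where "out z = (\<integral>\<^sup>+w. F 0 w z \<partial>count_space UNIV)" for z
  define inn where "inn z = (\<integral>\<^sup>+w. F w 0 z \<partial>count_space UNIV)" for z
  have out_a: "(\<integral>\<^sup>+z. out z \<partial>(\<mu> \<Otimes>\<^sub>M P)) = (\<integral>\<^sup>+w. a 0 w \<partial>count_space UNIV)"
    unfolding out_def a_def by (intro nn_integral_count_space_nn_integral cnt) (simp add: Nm)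
  have "(\<integral>\<^sup>+z. inn z \<partial>(\<mu> \<Otimes>\<^sub>M P)) = (\<integral>\<^sup>+w. a w 0 \<partial>count_space UNIV)"
    unfolding inn_def a_def by (intro nn_integral_count_space_nn_integral cnt) (simp add: Nm)
  \<comment> \<open>Mass transport: inversion in the group followed by translation by
    \<open>w\<close> turns the mass received at 0 into the mass sent from 0.\<close>
  also have "\<dots> = (\<integral>\<^sup>+w. a (- w) 0 \<partial>count_space UNIV)"
    by (intro nn_integral_bij_count_space[symmetric] bij_betw_byWitness[where f' = uminus]) auto
  also have "\<dots> = (\<integral>\<^sup>+w. a 0 w \<partial>count_space UNIV)"
    using a_act[of w "- w" 0 for w] by simp
  finally have inn_out: "(\<integral>\<^sup>+z. inn z \<partial>(\<mu> \<Otimes>\<^sub>M P)) = (\<integral>\<^sup>+z. out z \<partial>(\<mu> \<Otimes>\<^sub>M P))"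
    by (simp add: out_a)
  have io_m: "out \<in> borel_measurable (\<mu> \<Otimes>\<^sub>M P)" "inn \<in> borel_measurable (\<mu> \<Otimes>\<^sub>M P)"
  proof -
    have "(\<lambda>z. \<integral>\<^sup>+w. G w z \<partial>count_space UNIV) \<in> borel_measurable (\<mu> \<Otimes>\<^sub>M P)"
      if G: "\<And>w. G w \<in> borel_measurable ?N" for G :: "'g \<Rightarrow> _ \<Rightarrow> ennreal"
    proof -
      have "(\<lambda>q. G (fst q) (snd q)) \<in> borel_measurable (count_space UNIV \<Otimes>\<^sub>M (\<mu> \<Otimes>\<^sub>M P))"
        using G by (intro measurable_pair_measure_countable1[OF cnt]) (simp add: Nm)
      from measurable_compose[OF measurable_pair_swap' this]
      show ?thesis
        by (intro sigma_finite_measure.borel_measurable_nn_integral sigma_finite_measure_count_space_countable cnt) (simp add: case_prod_beta')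
    qed
    note sum_m = this
    show "out \<in> borel_measurable (\<mu> \<Otimes>\<^sub>M P)"
      unfolding out_def[abs_def] by (rule sum_m[OF Fm])
    show "inn \<in> borel_measurable (\<mu> \<Otimes>\<^sub>M P)"
      unfolding inn_def[abs_def] by (rule sum_m[OF Fm])
  qed
  have out_ge: "ennreal (1 - 1 / real K) \<le> (\<integral>\<^sup>+z. out z \<partial>(\<mu> \<Otimes>\<^sub>M P))"
  proof -
    have "ennreal (1 - 1 / real K) \<le> (\<integral>\<^sup>+u. out (\<omega>, u) \<partial>P)" if \<omega>: "\<omega> \<in> connected_graphs" for \<omega>
    proof -
      have zm: "{u :: 'g \<Rightarrow> nat. u 0 \<noteq> 0} \<in> sets P"
      proof -
        have "Measurable.pred colorings (\<lambda>u :: 'g \<Rightarrow> nat. u 0 \<noteq> 0)" by measurable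
        then show ?thesis by (simp add: pred_def P_sets)
      qed
      have "P.prob {u. u 0 \<noteq> 0} = 1 - 1 / real K"
      proof -
        have "P.prob {u. u 0 \<noteq> 0} = measure (measure_pmf (pmf_of_set {..<K})) (- {0})"
          using measure_iid_box[of "{0 :: 'g}" "pmf_of_set {..<K}" "\<lambda>_. - {0}"] by (simp add: P_def)
        also have "\<dots> = 1 - 1 / real K"
          using measure_pmf.prob_compl[of "{0}" "pmf_of_set {..<K}"] p
          by (simp add: measure_pmf_single Compl_eq_Diff_UNIV)
        finally show ?thesis .
      qed
      then have "ennreal (1 - 1 / real K) = (\<integral>\<^sup>+u. indicator {u. u 0 \<noteq> 0} u \<partial>P)"
        using zm by (simp add: P.emeasure_eq_measure)
      also have "\<dots> \<le> (\<integral>\<^sup>+u. out (\<omega>, u) \<partial>P)"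
      proof (intro nn_integral_mono_AE)
        have "AE u in P. \<exists>b. u b = 0"
          unfolding P_def using p K by (intro iid_has_zero inf cnt) simp
        then show "AE u in P. indicator {u. u 0 \<noteq> 0} u \<le> out (\<omega>, u)"
        proof eventually_elim
          case (elim u)
          then obtain b where b: "u b = 0" by blast
          have "\<exists>w. arrow \<omega> u 0 w" if "u 0 \<noteq> 0"
          proof -
            have "(\<lambda>a b. \<omega> (a, b))\<^sup>*\<^sup>* 0 b" using \<omega> by (simp add: connected_graphs_def)
            then obtain n where "near n \<omega> u 0" using near_connected[where \<omega> = \<omega> and u = u and v = 0 and b = b] b by blast
            from arrow_exists[OF this that] show ?thesis .
          qed
          moreover have "1 \<le> out (\<omega>, u)" if "arrow \<omega> u 0 w" for w
            using nn_integral_ge_point[of w UNIV "\<lambda>w. F 0 w (\<omega>, u)"] that by (simp add: out_def F_def)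
          ultimately show ?case by (cases "u 0 = 0") auto
        qed
      qed
      finally show ?thesis .
    qed
    then have "(\<integral>\<^sup>+\<omega>. ennreal (1 - 1 / real K) \<partial>\<mu>) \<le> (\<integral>\<^sup>+\<omega>. \<integral>\<^sup>+u. out (\<omega>, u) \<partial>P \<partial>\<mu>)"
      by (intro nn_integral_mono) (simp add: space)
    also have "\<dots> = (\<integral>\<^sup>+z. out z \<partial>(\<mu> \<Otimes>\<^sub>M P))"
      by (rule P.nn_integral_fst[OF io_m(1)])
    finally show ?thesis by (simp add: M.emeasure_space_1)
  qed
  have "ennreal (2 * (1 - 1 / real K)) = ennreal (1 - 1 / real K) + ennreal (1 - 1 / real K)"
    using K by (subst ennreal_plus[symmetric]) auto
  also have "\<dots> \<le> (\<integral>\<^sup>+z. out z \<partial>(\<mu> \<Otimes>\<^sub>M P)) + (\<integral>\<^sup>+z. inn z \<partial>(\<mu> \<Otimes>\<^sub>M P))"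
    unfolding inn_out by (intro add_mono out_ge)
  also have "\<dots> = (\<integral>\<^sup>+z. out z + inn z \<partial>(\<mu> \<Otimes>\<^sub>M P))"
    using io_m by (intro nn_integral_add[symmetric])
  also have "\<dots> = (\<integral>\<^sup>+\<omega>. \<integral>\<^sup>+u. out (\<omega>, u) + inn (\<omega>, u) \<partial>P \<partial>\<mu>)"
    using io_m by (intro P.nn_integral_fst[symmetric]) simp
  also have "\<dots> \<le> (\<integral>\<^sup>+\<omega>. graph_degree \<omega> 0 \<partial>\<mu>)"
  proof (intro nn_integral_mono)
    fix \<omega> assume "\<omega> \<in> space \<mu>"
    then have sym: "\<omega> (a, b) = \<omega> (b, a)" for a b
      unfolding space connected_graphs_def by blast
    have "out (\<omega>, u) + inn (\<omega>, u) \<le> graph_degree \<omega> 0" for u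
    proof -
      have "out (\<omega>, u) = emeasure (count_space UNIV) {w. arrow \<omega> u 0 w}"
        "inn (\<omega>, u) = emeasure (count_space UNIV) {w. arrow \<omega> u w 0}"
        by (simp_all add: out_def inn_def F_def indicator_def emeasure_count_space_Collect)
      then show ?thesis using arrow_degree[where \<omega> = \<omega>, OF sym, of u 0] by simp
    qed
    then have "(\<integral>\<^sup>+u. out (\<omega>, u) + inn (\<omega>, u) \<partial>P) \<le> (\<integral>\<^sup>+u. graph_degree \<omega> 0 \<partial>P)"
      by (intro nn_integral_mono)
    then show "(\<integral>\<^sup>+u. out (\<omega>, u) + inn (\<omega>, u) \<partial>P) \<le> graph_degree \<omega> 0"
      by (simp add: P.emeasure_space_1)
  qed
  finally show ?thesis .
qed

lemma cost_ge_1: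
  assumes cnt: "countable (UNIV :: 'g::group_add set)" and inf: "infinite (UNIV :: 'g set)"
  shows "1 \<le> cost TYPE('g)"
proof -
  have "2 \<le> (\<integral>\<^sup>+\<omega>. graph_degree \<omega> 0 \<partial>\<mu>)"
    if \<mu>: "\<mu> \<in> invariant_prob_measures (graph_act :: 'g \<Rightarrow> _) (restrict_space borel connected_graphs)" for \<mu>
  proof -
    have "(\<lambda>n. ennreal (2 * (1 - 1 / real (Suc n)))) \<longlonglongrightarrow> ennreal (2 * (1 - 0))"
      by (intro tendsto_ennrealI tendsto_intros LIMSEQ_Suc[OF lim_1_over_n])
    then have "ennreal 2 \<le> (\<integral>\<^sup>+\<omega>. graph_degree \<omega> 0 \<partial>\<mu>)"
      by (intro LIMSEQ_le_const2[of _ "ennreal 2"] exI allI impI)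
        (use expected_degree_ge[OF cnt inf \<mu>, of "Suc n" for n] in simp_all)
    then show ?thesis by simp
  qed
  then have "2 / 2 \<le> cost TYPE('g)"
    unfolding cost_def by (intro divide_right_mono_ennreal INF_greatest)
  then show ?thesis by (simp add: ennreal_divide_self)
qed

section \<open>Sparse connected sets\<close>

lemma translate_eq_shift: "translate = shift"
  by (simp add: fun_eq_iff translate_def shift_def)

context equivariant_equiv
begin

text \<open>\<open>Q\<close> is the law of a class of one fixed colour \<open>j\<close>, drawn given
  \<open>x\<close> with probability proportional to the invariant weight. The total weight of that
  colour is invariant, so by ergodicity it is positive and finite almost surely, and the draw is
  possible for almost every \<open>x\<close>. Hence the colouring keeps the law
  \<open>\<mu>\<close>, and 0 lies in the drawn class only if \<open>x 0 = j\<close>. The last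
  clause expresses, through properties \<open>P\<close>, that \<open>Q\<close> lives on
  classes.\<close>

lemma cluster_measure:
  assumes erg: "\<mu> \<in> ergodic_prob_measures shift colorings"
    and const: "\<And>x a b. E x a b \<Longrightarrow> x a = x b"
    and W: "finite W" and c: "0 < c"
    and nonmixing: "\<And>g. c \<le> measure \<mu> {x. \<exists>a\<in>W. \<exists>b\<in>W. E x a (g + b)}"
    and m: "\<And>j. measure \<mu> {x. x 0 = j} \<le> m"
  shows "\<exists>Q \<in> invariant_prob_measures (translate :: 'g \<Rightarrow> _) borel. measure Q {\<omega>. \<omega> 0} \<le> m \<and>
    (\<forall>P. (\<forall>x b. P (E x b)) \<longrightarrow> {\<omega>. P \<omega>} \<in> sets borel \<longrightarrow> (AE \<omega> in Q. P \<omega>))"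
proof -
  have inv: "\<mu> \<in> invariant_prob_measures shift colorings"
    using erg by (simp add: ergodic_prob_measures_def)
  interpret M: prob_space \<mu> by (rule prob_mu[OF inv])
  note sets_\<mu> = sets_mu[OF inv] and space_\<mu> = space_mu[OF inv]
  note mR = borel_measurable_R[OF inv W c nonmixing] and mM = measurable_cong_sets[OF sets_\<mu> refl]
  let ?R = "class_measure \<mu>"
  note int_R = nn_integral_class_measure[OF inv]
  obtain U where Um: "U \<in> borel_measurable pairs" and U_class: "class_fun U"
    and U_act: "\<And>h z. U (act h z) = U z" and U_pos: "0 < (\<integral>\<^sup>+z. U z \<partial>?R)" and U_fin: "(\<integral>\<^sup>+z. U z \<partial>?R) < \<infinity>"
    using invariant_class_weight[OF inv W c nonmixing] by blast
  define f where "f j z = (if snd z (fst z) = j then U z else 0)" for j z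
  have fm [measurable]: "f j \<in> borel_measurable pairs" for j
  proof (rule measurable_pairsI)
    fix b
    note measurable_pairsD[OF Um, measurable]
    show "(\<lambda>x. f j (b, x)) \<in> borel_measurable colorings"
      unfolding f_def by simp
  qed
  \<comment> \<open>There are countably many colours, so a nonzero weight cannot vanish on each of
    them.\<close>
  have "\<exists>j. 0 < (\<integral>\<^sup>+z. f j z \<partial>?R)"
  proof (rule ccontr)
    assume "\<nexists>j. 0 < (\<integral>\<^sup>+z. f j z \<partial>?R)"
    then have "(\<integral>\<^sup>+z. f j z \<partial>?R) = 0" for j by simp
    then have "AE z in ?R. f j z = 0" for j
      using fm[of j] by (subst (asm) nn_integral_0_iff_AE) (simp_all add: mR)
    then have "AE z in ?R. \<forall>j. f j z = 0" by (simp add: AE_all_countable)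
    then have "AE z in ?R. U z = 0"
      by eventually_elim (simp add: f_def split: if_splits)
    then have "(\<integral>\<^sup>+z. U z \<partial>?R) = 0"
      using Um by (subst nn_integral_0_iff_AE) (simp_all add: mR)
    with U_pos show False by simp
  qed
  then obtain j where j: "0 < (\<integral>\<^sup>+z. f j z \<partial>?R)" by blast
  have f_class: "class_fun (f j)"
    unfolding class_fun_def f_def
  proof (intro allI impI)
    fix x a b assume "E x a b"
    then have "x a = x b" "U (a, x) = U (b, x)" using const U_class by (auto simp: class_fun_def)
    then show "(if snd (a, x) (fst (a, x)) = j then U (a, x) else 0) = (if snd (b, x) (fst (b, x)) = j then U (b, x) else 0)"
      by simp
  qed
  have f_act: "f j (act h z) = f j z" for h z
    using U_act[of h z] by (cases z) (simp add: f_def act_def)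
  define H where "H = class_sum (f j)"
  have Hm [measurable]: "H \<in> borel_measurable colorings" unfolding H_def by measurable
  have H_shift: "H (shift h x) = H x" for h x
    unfolding H_def class_sum_shift[OF f_class] by (simp add: f_act)
  have H_int: "(\<integral>\<^sup>+x. H x \<partial>\<mu>) = (\<integral>\<^sup>+z. f j z \<partial>?R)"
    unfolding H_def by (rule int_R[OF fm, symmetric])
  \<comment> \<open>The event is invariant. If it had measure 0, then \<open>H\<close> would be 0 or
    infinite almost everywhere, but its integral is positive and finite.\<close>
  have H: "AE x in \<mu>. 0 < H x \<and> H x < \<infinity>"
  proof -
    let ?A = "{x. 0 < H x \<and> H x < \<infinity>}"
    have "Measurable.pred colorings (\<lambda>x. 0 < H x \<and> H x < \<infinity>)" by measurable
    then have A: "?A \<in> sets colorings" by (simp add: pred_def)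
    moreover have "\<forall>g. shift g -` ?A = ?A" by (simp add: H_shift vimage_def)
    ultimately have "measure \<mu> ?A = 0 \<or> measure \<mu> ?A = 1"
      using erg by (simp add: ergodic_prob_measures_def)
    moreover have "measure \<mu> ?A \<noteq> 0"
    proof
      assume "measure \<mu> ?A = 0"
      then have "AE x in \<mu>. \<not> (0 < H x \<and> H x < \<infinity>)"
        using A M.prob_Collect_eq_0[of "\<lambda>x. 0 < H x \<and> H x < \<infinity>"] by (simp add: sets_\<mu> space_\<mu>)
      moreover have "(\<integral>\<^sup>+z. f j z \<partial>?R) \<le> (\<integral>\<^sup>+z. U z \<partial>?R)"
        by (intro nn_integral_mono) (simp add: f_def)
      then have "(\<integral>\<^sup>+x. H x \<partial>\<mu>) \<noteq> \<infinity>" using U_fin H_int by auto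
      then have "AE x in \<mu>. H x \<noteq> \<infinity>"
        by (intro nn_integral_PInf_AE) (simp_all add: mM)
      ultimately have "AE x in \<mu>. H x = 0"
        by eventually_elim (auto simp: less_top)
      then have "(\<integral>\<^sup>+x. H x \<partial>\<mu>) = 0"
        by (subst nn_integral_0_iff_AE) (simp_all add: mM)
      with j H_int show False by simp
    qed
    ultimately show ?thesis
      using A M.prob_Collect_eq_1[of "\<lambda>x. 0 < H x \<and> H x < \<infinity>"] by (simp add: sets_\<mu> space_\<mu>)
  qed
  \<comment> \<open>The conditional probability of drawing the class, given the colouring.\<close>
  define w where "w z = f j z / H (snd z)" for z
  define cl where "cl z = E (snd z) (fst z)" for z
  have wm [measurable]: "w \<in> borel_measurable pairs"
    unfolding w_def[abs_def] by measurable
  have clm: "cl \<in> measurable pairs borel"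
  proof -
    have "cl \<in> measurable pairs (PiM UNIV (\<lambda>_. count_space UNIV))"
      unfolding cl_def by (intro measurable_pairsI measurable_PiM_single') auto
    then show ?thesis
      using measurable_cong_sets[OF refl borel_eq_PiM_bool[OF countable_group]] by blast
  qed
  have cl_act: "cl (act h z) = translate h (cl z)" for h z
    by (cases z) (simp add: cl_def act_def translate_def fun_eq_iff equivariant' add.assoc[symmetric])
  have w_act: "w (act h z) = w z" for h z
    by (cases z) (simp add: w_def f_act, simp add: act_def H_shift)
  have w_sum: "AE x in \<mu>. class_sum w x = 1"
    using H
  proof eventually_elim
    case (elim x)
    have "class_sum w x = class_sum (\<lambda>z. inverse (H (snd z)) * f j z) x"
      by (rule class_sum_cong) (simp add: w_def divide_ennreal_def mult.commute)
    also have "\<dots> = H x / H x"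
      unfolding class_sum_cmult[where c = "\<lambda>x. inverse (H x)"] by (simp add: H_def divide_ennreal_def mult.commute)
    finally show ?case using elim by (simp add: ennreal_divide_self zero_less_iff_neq_zero)
  qed
  define Q where "Q = distr (density ?R w) borel cl"
  have clR: "cl \<in> measurable (density ?R w) borel"
  proof -
    have "cl \<in> measurable ?R borel"
      using clm measurable_cong_sets[OF sets_class_measure[OF inv] refl] by blast
    then show ?thesis by (simp add: measurable_density_eq1)
  qed
  have Q_int: "(\<integral>\<^sup>+\<omega>. F \<omega> \<partial>Q) = (\<integral>\<^sup>+z. w z * F (cl z) \<partial>?R)" if Fm: "F \<in> borel_measurable borel" for F
  proof -
    have Fcl: "(\<lambda>z. F (cl z)) \<in> borel_measurable pairs" by (rule measurable_compose[OF clm Fm])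
    have "(\<integral>\<^sup>+\<omega>. F \<omega> \<partial>Q) = (\<integral>\<^sup>+z. F (cl z) \<partial>density ?R w)"
      unfolding Q_def using Fm by (intro nn_integral_distr clR) simp
    also have "\<dots> = (\<integral>\<^sup>+z. w z * F (cl z) \<partial>?R)"
      using wm Fcl by (intro nn_integral_density) (simp_all add: mR)
    finally show ?thesis .
  qed
  have Q_sets: "sets Q = sets borel" by (simp add: Q_def)
  have Q_space: "space Q = UNIV" using sets_eq_imp_space_eq[OF Q_sets] by simp
  have Q_prob: "prob_space Q"
  proof
    have "emeasure Q (space Q) = (\<integral>\<^sup>+\<omega>. 1 \<partial>Q)" by simp
    also have "\<dots> = (\<integral>\<^sup>+x. class_sum w x \<partial>\<mu>)"
      using Q_int[of "\<lambda>_. 1"] int_R[OF wm] by simp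
    also have "\<dots> = (\<integral>\<^sup>+x. 1 \<partial>\<mu>)"
      using w_sum by (intro nn_integral_cong_AE) auto
    finally show "emeasure Q (space Q) = 1" by (simp add: M.emeasure_space_1)
  qed
  interpret Q: prob_space Q by (rule Q_prob)
  have Q_inv: "distr Q borel (translate h) = Q" for h
  proof (rule measure_eqI)
    fix B assume "B \<in> sets (distr Q borel (translate h))"
    then have B: "B \<in> sets borel" by simp
    have tm: "translate h \<in> measurable Q borel"
      using measurable_translate measurable_cong_sets[OF Q_sets refl] by blast
    have Bm: "(indicator B :: _ \<Rightarrow> ennreal) \<in> borel_measurable borel" using B by simp
    define k where "k z = w z * indicator B (cl z)" for z
    have km: "k \<in> borel_measurable pairs"
      unfolding k_def[abs_def] using measurable_compose[OF clm Bm] by measurable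
    have k_class: "class_fun k"
    proof -
      have "cl (a, x) = cl (b, x)" if "E x a b" for x a b
      proof -
        have "E x a = E x b" using that E_sym E_trans by blast
        then show ?thesis by (simp add: cl_def)
      qed
      then show ?thesis
        using f_class by (simp add: class_fun_def k_def w_def)
    qed
    have "emeasure (distr Q borel (translate h)) B = (\<integral>\<^sup>+\<omega>. indicator B (translate h \<omega>) \<partial>Q)"
      using B by (subst nn_integral_distr[OF tm, symmetric]) simp_all
    also have "\<dots> = (\<integral>\<^sup>+z. w z * indicator B (translate h (cl z)) \<partial>?R)"
      using Bm by (intro Q_int measurable_compose[OF measurable_translate])
    also have "\<dots> = (\<integral>\<^sup>+z. k (act h z) \<partial>?R)"
      by (simp add: k_def w_act cl_act)
    also have "\<dots> = (\<integral>\<^sup>+z. k z \<partial>?R)"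
      by (rule class_measure_act[OF inv km k_class])
    also have "\<dots> = (\<integral>\<^sup>+\<omega>. indicator B \<omega> \<partial>Q)"
      unfolding k_def by (rule Q_int[OF Bm, symmetric])
    finally show "emeasure (distr Q borel (translate h)) B = emeasure Q B"
      using B by (simp add: Q_sets)
  qed (simp add: Q_sets)
  have "measure Q {\<omega>. \<omega> 0} \<le> m"
  proof -
    have m0: "{\<omega> :: 'g \<Rightarrow> bool. \<omega> 0} \<in> sets borel"
    proof -
      have "Measurable.pred (PiM UNIV (\<lambda>_. count_space UNIV)) (\<lambda>\<omega> :: 'g \<Rightarrow> bool. \<omega> 0)" by measurable
      then show ?thesis
        unfolding borel_eq_PiM_bool[OF countable_group] by (simp add: pred_def space_PiM PiE_UNIV_domain)
    qed
    have xm: "{x. x 0 = j} \<in> sets \<mu>"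
    proof -
      have "Measurable.pred colorings (\<lambda>x :: 'g \<Rightarrow> nat. x 0 = j)" by measurable
      then show ?thesis by (simp add: pred_def sets_\<mu>)
    qed
    have im: "(indicator {\<omega> :: 'g \<Rightarrow> bool. \<omega> 0} :: _ \<Rightarrow> ennreal) \<in> borel_measurable borel" using m0 by simp
    have "emeasure Q {\<omega>. \<omega> 0} = (\<integral>\<^sup>+z. w z * indicator {\<omega>. \<omega> 0} (cl z) \<partial>?R)"
      using Q_int[OF im] m0 by (simp add: Q_sets)
    also have "\<dots> = (\<integral>\<^sup>+x. class_sum (\<lambda>z. w z * indicator {\<omega>. \<omega> 0} (cl z)) x \<partial>\<mu>)"
      by (rule int_R) (use measurable_compose[OF clm im] in measurable)
    also have "\<dots> \<le> (\<integral>\<^sup>+x. class_sum (\<lambda>z. indicator {x. x 0 = j} (snd z) * w z) x \<partial>\<mu>)"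
    proof (intro nn_integral_mono class_sum_mono)
      fix x b
      show "w (b, x) * indicator {\<omega>. \<omega> 0} (cl (b, x)) \<le> indicator {x. x 0 = j} (snd (b, x)) * w (b, x)"
        using const[of x b 0] by (auto simp: w_def f_def cl_def indicator_def)
    qed
    also have "\<dots> = (\<integral>\<^sup>+x. indicator {x. x 0 = j} x \<partial>\<mu>)"
      using w_sum by (intro nn_integral_cong_AE, eventually_elim) (simp add: class_sum_cmult)
    also have "\<dots> = emeasure \<mu> {x. x 0 = j}" using xm by simp
    finally have "measure Q {\<omega>. \<omega> 0} \<le> measure \<mu> {x. x 0 = j}"
      by (simp add: Q.emeasure_eq_measure M.emeasure_eq_measure)
    then show ?thesis using m[of j] by linarith
  qed
  moreover have "AE \<omega> in Q. P \<omega>" if "\<forall>x b. P (E x b)" "{\<omega>. P \<omega>} \<in> sets borel" for P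
    unfolding Q_def using that by (subst AE_distr_iff[OF clR]) (simp_all add: cl_def)
  ultimately show ?thesis
    using Q_prob Q_sets Q_inv by (intro bexI[of _ Q]) (auto simp: invariant_prob_measures_def)
qed

end

section \<open>Monochromatic clusters in the Cayley graph\<close>

lemma pred_rtranclp:
  fixes r :: "'x \<Rightarrow> 'v \<Rightarrow> 'v \<Rightarrow> bool"
  assumes cnt: "countable (UNIV :: 'v set)" and r [measurable]: "\<And>a b. Measurable.pred M (\<lambda>x. r x a b)"
  shows "Measurable.pred M (\<lambda>x. (r x)\<^sup>*\<^sup>* a b)"
proof -
  have [measurable]: "Measurable.pred M (\<lambda>x. (r x ^^ n) a b)" for n b
  proof (induction n arbitrary: b)
    case (Suc n)
    note [measurable] = Suc.IH
    have "Measurable.pred M (\<lambda>x. \<exists>c. (r x ^^ n) a c \<and> r x c b)"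
      by (intro pred_countable_Ex cnt) measurable
    then show ?case by (simp add: OO_def)
  qed simp
  show ?thesis
    unfolding rtranclp_power by measurable
qed

text \<open>Steps go from \<open>u\<close> to \<open>u + s\<close>, so adjacency is preserved by
  left translation. Nonemptiness is included because the remaining vertices must find a point to
  attach to.\<close>

definition connected_in :: "'g::group_add set \<Rightarrow> ('g \<Rightarrow> bool) \<Rightarrow> bool" where
  "connected_in S C \<longleftrightarrow> (\<exists>a. C a) \<and> (\<forall>a b. C a \<longrightarrow> C b \<longrightarrow> (\<lambda>u v. C u \<and> C v \<and> - u + v \<in> S)\<^sup>*\<^sup>* a b)"

definition cluster :: "'g::group_add set \<Rightarrow> ('g \<Rightarrow> 'c) \<Rightarrow> 'g \<Rightarrow> 'g \<Rightarrow> bool" where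
  "cluster S x = (\<lambda>u v. x u = x v \<and> - u + v \<in> S)\<^sup>*\<^sup>*"

lemma cluster_eq_color: "cluster S x a b \<Longrightarrow> x a = x b"
  unfolding cluster_def by (induction rule: rtranclp_induct) auto

lemma cluster_shift_imp: "cluster S x a b \<Longrightarrow> cluster S (shift g x) (g + a) (g + b)"
  unfolding cluster_def
proof (induction rule: rtranclp_induct)
  case (step b c)
  have "- (g + b) + (g + c) = - b + c" by (simp add: minus_add add.assoc[symmetric])
  with step show ?case by (auto intro: rtranclp.rtrancl_into_rtrancl)
qed simp

text \<open>A monochromatic path that starts in a cluster never leaves it; the induction carries
  membership along the path.\<close>

lemma connected_in_cluster:
  fixes x :: "'g::group_add \<Rightarrow> 'c"
  assumes "\<And>a b. cluster S x a b \<Longrightarrow> cluster S x b a"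
  shows "connected_in S (cluster S x b)"
proof -
  have refl: "cluster S x b b" by (simp add: cluster_def)
  have "(\<lambda>u v. cluster S x b u \<and> cluster S x b v \<and> - u + v \<in> S)\<^sup>*\<^sup>* a c" if "cluster S x b a" "cluster S x b c" for a c
  proof -
    have "cluster S x a c"
      using assms[OF that(1)] that(2) unfolding cluster_def by simp
    then have "cluster S x b c \<and> (\<lambda>u v. cluster S x b u \<and> cluster S x b v \<and> - u + v \<in> S)\<^sup>*\<^sup>* a c"
      unfolding cluster_def[of S x, THEN fun_cong, of a]
    proof (induction rule: rtranclp_induct)
      case base
      then show ?case using that(1) by simp
    next
      case (step u v)
      then have "cluster S x b v"
        using rtranclp.rtrancl_into_rtrancl[of "\<lambda>u v. x u = x v \<and> - u + v \<in> S" b u v]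
        by (simp add: cluster_def)
      with step show ?case by (auto intro: rtranclp.rtrancl_into_rtrancl)
    qed
    then show ?thesis by blast
  qed
  with refl show ?thesis by (auto simp: connected_in_def)
qed

lemma equivariant_equiv_cluster:
  assumes cnt: "countable (UNIV :: 'g::group_add set)" and S: "\<And>s :: 'g. s \<in> S \<Longrightarrow> - s \<in> S"
  shows "equivariant_equiv (cluster S)"
proof
  show "countable (UNIV :: 'g set)" by (rule cnt)
  fix x :: "'g \<Rightarrow> nat" and a b g
  have "symp (\<lambda>u v. x u = x v \<and> - u + v \<in> S)"
    using S by (fastforce simp: symp_def minus_add)
  then show "equivp (cluster S x)"
    unfolding cluster_def by (intro equivpI symp_rtranclp reflpI) auto
  show "Measurable.pred colorings (\<lambda>x. cluster S x a b)"
    unfolding cluster_def by (rule pred_rtranclp[OF cnt]) measurable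
  show "cluster S (shift g x) (g + a) (g + b) = cluster S x a b"
    using cluster_shift_imp[of S x a b g] cluster_shift_imp[of S "shift g x" "g + a" "g + b" "- g"]
    by (auto simp: shift_shift add.assoc[symmetric])
qed

text \<open>Recolouring singletons independently produces the i.i.d. colouring, so its ergodicity is
  a case of the general recolouring step.\<close>

lemma equivariant_equiv_eq:
  assumes cnt: "countable (UNIV :: 'g::group_add set)"
  shows "equivariant_equiv (\<lambda>_ :: 'g \<Rightarrow> nat. (=))"
  by standard (auto intro: cnt identity_equivp)

section \<open>The effect of one recolouring round\<close>

context equivariant_equiv
begin

text \<open>A vertex receives one fresh colour of law \<open>p\<close>, whatever its class. This
  keeps parity balanced and each colour rare in every round.\<close>

lemma recolor_marginal:
  assumes inv: "\<mu> \<in> invariant_prob_measures shift colorings"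
  shows "measure (recolor p \<mu>) {x. x a \<in> J} = measure (measure_pmf p) J"
proof -
  interpret M: prob_space \<mu> by (rule prob_mu[OF inv])
  have "Measurable.pred colorings (\<lambda>x :: 'g \<Rightarrow> nat. x a \<in> J)" by measurable
  then have m: "{x :: 'g \<Rightarrow> nat. x a \<in> J} \<in> sets colorings" by (simp add: pred_def)
  have "measure (law p x) {x. x a \<in> J} = measure (measure_pmf p) J" for x
    using measure_law[OF m] measure_iid_box[of "{rep x a}" p "\<lambda>_. J"] by simp
  then show ?thesis
    using measure_recolor[OF inv m, of p] M.prob_space by simp
qed

text \<open>Of all coincidences between two distinct classes only the one in colour 0 is counted,
  since any factor below 1 will do.\<close>

lemma recolor_disagree:
  assumes inv: "\<mu> \<in> invariant_prob_measures shift colorings"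
  shows "measure (recolor p \<mu>) {x. x a \<noteq> x b} \<le> (1 - (pmf p 0)\<^sup>2) * measure \<mu> {x. \<not> E x a b}"
proof -
  interpret M: prob_space \<mu> by (rule prob_mu[OF inv])
  interpret I: prob_space "iid p :: ('g \<Rightarrow> nat) measure" by (rule prob_space_iid)
  have "Measurable.pred colorings (\<lambda>x :: 'g \<Rightarrow> nat. x a \<noteq> x b)" for a b by measurable
  then have m: "{x :: 'g \<Rightarrow> nat. x a \<noteq> x b} \<in> sets colorings" for a b by (simp add: pred_def)
  have "Measurable.pred colorings (\<lambda>x. \<not> E x a b)" by measurable
  then have mE: "{x. \<not> E x a b} \<in> sets \<mu>" by (simp add: pred_def sets_mu[OF inv])
  have le: "measure (law p x) {x. x a \<noteq> x b} \<le> (1 - (pmf p 0)\<^sup>2) * indicator {x. \<not> E x a b} x" for x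
  proof (cases "E x a b")
    case True
    then show ?thesis using measure_law[OF m] by (simp add: rep_eq_iff[symmetric])
  next
    case False
    let ?v = "rep x a" and ?w = "rep x b"
    have ne: "?v \<noteq> ?w" using False by (simp add: rep_eq_iff)
    let ?D = "{u :: 'g \<Rightarrow> nat. u ?v = 0 \<and> u ?w = 0}"
    have "Measurable.pred colorings (\<lambda>u :: 'g \<Rightarrow> nat. u ?v = 0 \<and> u ?w = 0)" by measurable
    then have D: "?D \<in> I.events" by (simp add: pred_def)
    have "measure (iid p) ?D = (pmf p 0)\<^sup>2"
      using ne measure_iid_box[of "{?v, ?w}" p "\<lambda>_. {0}"] by (simp add: measure_pmf_single power2_eq_square)
    moreover have "measure (iid p) {u :: 'g \<Rightarrow> nat. u ?v \<noteq> u ?w} \<le> measure (iid p) (space (iid p) - ?D)"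
    proof (rule I.finite_measure_mono)
      show "space (iid p) - ?D \<in> I.events" using D by (rule sets.compl_sets)
    qed auto
    ultimately have "measure (iid p) {u :: 'g \<Rightarrow> nat. u ?v \<noteq> u ?w} \<le> 1 - (pmf p 0)\<^sup>2"
      using I.prob_compl[OF D] by linarith
    then show ?thesis using False by (simp add: measure_law[OF m])
  qed
  have "measure (recolor p \<mu>) {x. x a \<noteq> x b} = (\<integral>x. measure (law p x) {x. x a \<noteq> x b} \<partial>\<mu>)"
    by (rule measure_recolor[OF inv m])
  also have "\<dots> \<le> (\<integral>x. (1 - (pmf p 0)\<^sup>2) * indicator {x. \<not> E x a b} x \<partial>\<mu>)"
    using le mE by (intro integral_mono integrable_law[OF inv] m Bochner_Integration.integrable_mult_right)
      (auto simp: M.emeasure_eq_measure intro!: integrable_real_indicator)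
  also have "\<dots> = (1 - (pmf p 0)\<^sup>2) * measure \<mu> {x. \<not> E x a b}"
    using mE by simp
  finally show ?thesis .
qed

end

lemma const_coloring_ergodic:
  "return colorings (\<lambda>_. 0) \<in> ergodic_prob_measures (shift :: 'g::group_add \<Rightarrow> _) colorings"
proof -
  let ?c = "\<lambda>_ :: 'g. 0 :: nat"
  have "distr (return colorings ?c) colorings (shift g) = return colorings ?c" for g :: 'g
    by (subst distr_return) (auto simp: shift_def)
  moreover have "prob_space (return colorings ?c)" by (intro prob_space_return) simp
  ultimately show ?thesis
    by (auto simp: ergodic_prob_measures_def invariant_prob_measures_def measure_return indicator_def)
qed

lemma measurable_threshold:
  assumes cnt: "countable (UNIV :: 'v set)"
  shows "(\<lambda>x a. P (x a)) \<in> measurable colorings (borel :: ('v \<Rightarrow> bool) measure)"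
proof -
  have "(\<lambda>x a. P (x a)) \<in> measurable colorings (PiM (UNIV :: 'v set) (\<lambda>_. count_space (UNIV :: bool set)))"
    by (intro measurable_PiM_single') auto
  then show ?thesis
    using measurable_cong_sets[OF refl borel_eq_PiM_bool[OF cnt]] by blast
qed

text \<open>The map commutes with translation, so preimages of invariant sets are invariant and
  ergodicity passes to the image. It is applied to parity.\<close>

lemma threshold_ergodic:
  assumes cnt: "countable (UNIV :: 'g::group_add set)"
    and erg: "\<mu> \<in> ergodic_prob_measures (shift :: 'g \<Rightarrow> _) colorings"
  shows "distr \<mu> borel (\<lambda>x a. P (x a)) \<in> ergodic_prob_measures (translate :: 'g \<Rightarrow> _) borel"
proof -
  let ?\<pi> = "\<lambda>x (a :: 'g). P (x a :: nat)"
  have inv: "\<mu> \<in> invariant_prob_measures shift colorings" and sets: "sets \<mu> = sets colorings"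
    and shift: "\<And>g. distr \<mu> colorings (shift g) = \<mu>"
    using erg by (auto simp: ergodic_prob_measures_def invariant_prob_measures_def)
  interpret prob_space \<mu> using inv by (simp add: invariant_prob_measures_def)
  have space: "space \<mu> = UNIV" using sets_eq_imp_space_eq[OF sets] by simp
  have m: "?\<pi> \<in> measurable \<mu> borel"
    using measurable_threshold[OF cnt] measurable_cong_sets[OF sets refl] by blast
  have sm: "shift g \<in> measurable \<mu> colorings" for g
    using measurable_shift measurable_cong_sets[OF sets refl] by blast
  have comm: "translate g \<circ> ?\<pi> = ?\<pi> \<circ> shift g" for g
    by (simp add: fun_eq_iff translate_def shift_def)
  have "distr (distr \<mu> borel ?\<pi>) borel (translate g) = distr \<mu> borel ?\<pi>" for g
  proof -
    have "distr (distr \<mu> borel ?\<pi>) borel (translate g) = distr \<mu> borel (?\<pi> \<circ> shift g)"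
      by (simp add: distr_distr[OF measurable_translate m] comm)
    also have "\<dots> = distr (distr \<mu> colorings (shift g)) borel ?\<pi>"
      by (rule distr_distr[OF measurable_threshold[OF cnt] sm, symmetric])
    finally show ?thesis by (simp add: shift)
  qed
  moreover have "prob_space (distr \<mu> borel ?\<pi>)" by (rule prob_space_distr[OF m])
  moreover have "measure (distr \<mu> borel ?\<pi>) A = 0 \<or> measure (distr \<mu> borel ?\<pi>) A = 1"
    if A: "A \<in> sets borel" and A_inv: "\<And>g. translate g -` A = A" for A
  proof -
    have "measure (distr \<mu> borel ?\<pi>) A = measure \<mu> (?\<pi> -` A)"
      by (simp add: measure_distr[OF m A] space)
    moreover have "shift g -` (?\<pi> -` A) = ?\<pi> -` A" for g
      using A_inv[of g] comm[of g] unfolding vimage_comp by (metis vimage_comp)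
    moreover have "?\<pi> -` A \<in> sets colorings"
      using measurable_sets[OF m A] by (simp add: space sets)
    ultimately show ?thesis
      using erg by (simp add: ergodic_prob_measures_def)
  qed
  ultimately show ?thesis
    by (simp add: ergodic_prob_measures_def invariant_prob_measures_def)
qed

text \<open>The order of quantifiers matters: \<open>S\<close> is read off from the spectral gap
  before the number of colours is fixed.\<close>

lemma sparse_connected_sets:
  assumes cnt: "countable (UNIV :: 'g::group_add set)" and inf: "infinite (UNIV :: 'g set)"
    and T: "kazhdan TYPE('g)"
  shows "\<exists>S :: 'g set. finite S \<and> (\<forall>s\<in>S. - s \<in> S) \<and>
    (\<forall>k>0. \<exists>Q \<in> invariant_prob_measures (translate :: 'g \<Rightarrow> _) borel.
      measure Q {\<omega>. \<omega> 0} \<le> 1 / real k \<and> (AE \<omega> in Q. connected_in S \<omega>))"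
proof -
  obtain F :: "'g set" and d where F: "finite F" and d: "0 < d"
    and gap: "\<And>\<nu>. \<nu> \<in> ergodic_prob_measures (translate :: 'g \<Rightarrow> _) borel \<Longrightarrow> measure \<nu> {\<omega>. \<omega> 0} = 1 / 2 \<Longrightarrow>
      \<exists>s\<in>F. d \<le> measure \<nu> {\<omega>. \<omega> 0 \<noteq> \<omega> s}"
    using kazhdan_spectral_gap[OF cnt T] by blast
  \<comment> \<open>Symmetrised so that clusters are the classes of an equivalence relation.\<close>
  define S where "S = F \<union> uminus ` F"
  have S: "finite S" "\<And>s. s \<in> S \<Longrightarrow> - s \<in> S" using F by (auto simp: S_def)
  interpret cl: equivariant_equiv "cluster S :: ('g \<Rightarrow> nat) \<Rightarrow> _"
    by (rule equivariant_equiv_cluster[OF cnt S(2)])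
  interpret eq: equivariant_equiv "\<lambda>_ :: 'g \<Rightarrow> nat. (=)"
    by (rule equivariant_equiv_eq[OF cnt])
  have conn_meas: "{\<omega>. connected_in S \<omega>} \<in> sets borel"
  proof -
    have "Measurable.pred (PiM UNIV (\<lambda>_. count_space UNIV)) (connected_in S)"
      unfolding connected_in_def
      by (intro pred_countable_All pred_countable_Ex pred_intros_logic pred_rtranclp cnt) measurable
    then show ?thesis
      unfolding borel_eq_PiM_bool[OF cnt] by (simp add: pred_def space_PiM PiE_UNIV_domain)
  qed
  have "\<exists>Q \<in> invariant_prob_measures (translate :: 'g \<Rightarrow> _) borel.
      measure Q {\<omega>. \<omega> 0} \<le> 1 / real k \<and> (AE \<omega> in Q. connected_in S \<omega>)" if k: "0 < k" for k
  proof -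
    \<comment> \<open>An even number of colours gives parity the exact density 1/2.\<close>
    define p where "p = pmf_of_set {..<2 * k}"
    have ne: "{..<2 * k} \<noteq> {}" using k by (auto simp: lessThan_empty_iff)
    have p_le: "pmf p j \<le> 1 / real k" for j
      using k ne by (auto simp: p_def indicator_def field_simps)
    have p0: "pmf p 0 = 1 / (2 * real k)"
      using k ne by (simp add: p_def indicator_def)
    have p_even: "measure (measure_pmf p) {j. even j} = 1 / 2"
    proof -
      have "{..<2 * k} \<inter> {j. even j} = (\<lambda>i. 2 * i) ` {..<k}"
        by (auto elim!: evenE)
      then have "card ({..<2 * k} \<inter> {j. even j}) = k"
        by (simp add: card_image inj_on_def)
      then show ?thesis
        using k ne by (simp add: p_def measure_pmf_of_set)
    qed
    define \<mu> where "\<mu> n = (cl.recolor p ^^ n) (eq.recolor p (return colorings (\<lambda>_. 0)))" for n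
    have const_inv: "return colorings (\<lambda>_. 0) \<in> invariant_prob_measures (shift :: 'g \<Rightarrow> _) colorings"
      using const_coloring_ergodic[where 'g = 'g] by (simp add: ergodic_prob_measures_def)
    have \<mu>_Suc: "\<mu> (Suc n) = cl.recolor p (\<mu> n)" and \<mu>_0: "\<mu> 0 = eq.recolor p (return colorings (\<lambda>_. 0))" for n
      by (simp_all add: \<mu>_def)
    have \<mu>_inv: "\<mu> n \<in> invariant_prob_measures shift colorings" for n
      by (induction n) (simp_all add: \<mu>_Suc \<mu>_0 cl.recolor_invariant eq.recolor_invariant const_inv)
    have marginal: "measure (\<mu> n) {x. x a \<in> J} = measure (measure_pmf p) J" for n a J
      by (cases n) (simp_all add: \<mu>_Suc \<mu>_0 cl.recolor_marginal[OF \<mu>_inv] eq.recolor_marginal[OF const_inv])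
    define q where "q = 1 - (pmf p 0)\<^sup>2"
    have q: "0 \<le> q" "q < 1"
      using k by (simp_all add: q_def power_le_one pmf_le_1 p0)
    have \<mu>_prob: "prob_space (\<mu> n)" and \<mu>_sets: "sets (\<mu> n) = sets colorings" for n
      using \<mu>_inv[of n] unfolding invariant_prob_measures_def by blast+
    have diff_meas: "{x. x a \<noteq> x b} \<in> sets (\<mu> n)" for a b n
    proof -
      have "Measurable.pred colorings (\<lambda>x :: 'g \<Rightarrow> nat. x a \<noteq> x b)" by measurable
      then show ?thesis by (simp add: pred_def \<mu>_sets)
    qed
    \<comment> \<open>For \<open>s\<close> in \<open>S\<close>, if 0 and \<open>s\<close> lie in
      different clusters then their colours already differed in the previous round, so each round
      gains a factor \<open>q\<close>.\<close>
    have disagree: "measure (\<mu> n) {x. x 0 \<noteq> x s} \<le> q ^ n" if s: "s \<in> S" for n s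
    proof (induction n)
      case 0
      then show ?case using prob_space.prob_le_1[OF \<mu>_prob] by simp
    next
      case (Suc n)
      interpret prob_space "\<mu> n" by (rule \<mu>_prob)
      have "measure (\<mu> n) {x. \<not> cluster S x 0 s} \<le> measure (\<mu> n) {x. x 0 \<noteq> x s}"
        using s by (intro finite_measure_mono diff_meas) (auto simp: cluster_def)
      then have "q * measure (\<mu> n) {x. \<not> cluster S x 0 s} \<le> q * q ^ n"
        using Suc q by (intro mult_left_mono) auto
      then show ?case
        using cl.recolor_disagree[OF \<mu>_inv, of p n 0 s] by (simp add: \<mu>_Suc q_def)
    qed
    have "\<exists>n. \<mu> n \<in> ergodic_prob_measures shift colorings \<and>
      (\<exists>W e. finite W \<and> e > 0 \<and> (\<forall>g. e \<le> measure (\<mu> n) {x. \<exists>a\<in>W. \<exists>b\<in>W. cluster S x a (g + b)}))"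
    proof (rule ccontr)
      assume contra: "\<not> ?thesis"
      have erg: "\<mu> n \<in> ergodic_prob_measures shift colorings" for n
      proof (induction n)
        case 0
        \<comment> \<open>Any \<open>g\<close> outside the finite set of differences of
          \<open>W\<close> separates \<open>W\<close> from its translate, and an infinite group
          contains such a \<open>g\<close>.\<close>
        have "\<exists>g. measure (return colorings (\<lambda>_. 0)) {x :: 'g \<Rightarrow> nat. \<exists>a\<in>W. \<exists>b\<in>W. a = g + b} < e"
          if W: "finite W" and e: "0 < e" for W :: "'g set" and e
        proof -
          have "finite ((\<lambda>(a, b). a - b) ` (W \<times> W))" using W by simp
          then obtain g where g: "g \<notin> (\<lambda>(a, b). a - b) ` (W \<times> W)"
            using inf ex_new_if_finite by blast
          have "\<not> (\<exists>a\<in>W. \<exists>b\<in>W. a = g + b)"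
          proof
            assume "\<exists>a\<in>W. \<exists>b\<in>W. a = g + b"
            then obtain a b where "a \<in> W" "b \<in> W" "a = g + b" by blast
            then have "g = a - b" by (simp add: add.assoc)
            with g \<open>a \<in> W\<close> \<open>b \<in> W\<close> show False by auto
          qed
          with e show ?thesis by (intro exI[of _ g]) simp
        qed
        then show ?case
          unfolding \<mu>_0 by (intro eq.recolor_ergodic const_coloring_ergodic)
      next
        case (Suc n)
        then have "\<exists>g. measure (\<mu> n) {x. \<exists>a\<in>W. \<exists>b\<in>W. cluster S x a (g + b)} < e" if "finite W" "0 < e" for W e
          using contra that by (meson not_le)
        with Suc show ?case
          unfolding \<mu>_Suc by (intro cl.recolor_ergodic)
      qed
      \<comment> \<open>If every round stays ergodic, parity after \<open>n\<close> rounds is an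
        ergodic measure of density 1/2 that disagrees along \<open>F\<close> with probability at
        most \<open>q ^ n\<close>, which is below the gap \<open>d\<close>.\<close>
      obtain n where n: "q ^ n < d"
        using real_arch_pow_inv[OF d q(2)] by blast
      let ?\<pi> = "\<lambda>x (a :: 'g). even (x a :: nat)"
      let ?\<nu> = "distr (\<mu> n) borel ?\<pi>"
      interpret prob_space "\<mu> n" by (rule \<mu>_prob)
      have space: "space (\<mu> n) = UNIV" using sets_eq_imp_space_eq[OF \<mu>_sets] by simp
      have \<pi>m: "?\<pi> \<in> measurable (\<mu> n) borel"
        using measurable_threshold[OF cnt, of even] measurable_cong_sets[OF \<mu>_sets refl] by blast
      have "Measurable.pred (PiM UNIV (\<lambda>_. count_space UNIV)) (\<lambda>\<omega> :: 'g \<Rightarrow> bool. \<omega> 0)"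
        "Measurable.pred (PiM UNIV (\<lambda>_. count_space UNIV)) (\<lambda>\<omega> :: 'g \<Rightarrow> bool. \<omega> 0 \<noteq> \<omega> s)" for s
        by measurable
      then have sets: "{\<omega> :: 'g \<Rightarrow> bool. \<omega> 0} \<in> sets borel" "{\<omega> :: 'g \<Rightarrow> bool. \<omega> 0 \<noteq> \<omega> s} \<in> sets borel" for s
        unfolding borel_eq_PiM_bool[OF cnt] by (simp_all add: pred_def space_PiM PiE_UNIV_domain)
      have "measure ?\<nu> {\<omega>. \<omega> 0} = 1 / 2"
        using marginal[of n 0 "{j. even j}"] p_even
        by (simp add: measure_distr[OF \<pi>m sets(1)] space vimage_def)
      then obtain s where s: "s \<in> F" "d \<le> measure ?\<nu> {\<omega>. \<omega> 0 \<noteq> \<omega> s}"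
        using gap[OF threshold_ergodic[OF cnt erg]] by blast
      have "measure ?\<nu> {\<omega>. \<omega> 0 \<noteq> \<omega> s} \<le> measure (\<mu> n) {x. x 0 \<noteq> x s}"
        unfolding measure_distr[OF \<pi>m sets(2)] by (intro finite_measure_mono diff_meas) auto
      with disagree[of s n] s n show False by (auto simp: S_def)
    qed
    then obtain n W e where erg: "\<mu> n \<in> ergodic_prob_measures shift colorings"
      and W: "finite W" "e > 0" "\<And>g. e \<le> measure (\<mu> n) {x. \<exists>a\<in>W. \<exists>b\<in>W. cluster S x a (g + b)}"
      by blast
    have marg: "measure (\<mu> n) {x. x 0 = j} \<le> 1 / real k" for j
      using marginal[of n 0 "{j}"] p_le[of j] by (simp add: measure_pmf_single)
    have "\<exists>Q \<in> invariant_prob_measures (translate :: 'g \<Rightarrow> _) borel. measure Q {\<omega>. \<omega> 0} \<le> 1 / real k \<and>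
        (\<forall>P. (\<forall>(x :: 'g \<Rightarrow> nat) b. P (cluster S x b)) \<longrightarrow> {\<omega>. P \<omega>} \<in> sets borel \<longrightarrow> (AE \<omega> in Q. P \<omega>))"
      by (rule cl.cluster_measure[OF erg _ W marg]) (rule cluster_eq_color)
    then obtain Q where Q: "Q \<in> invariant_prob_measures (translate :: 'g \<Rightarrow> _) borel" "measure Q {\<omega>. \<omega> 0} \<le> 1 / real k"
      and AE_Q: "\<forall>P. (\<forall>(x :: 'g \<Rightarrow> nat) b. P (cluster S x b)) \<longrightarrow> {\<omega>. P \<omega>} \<in> sets borel \<longrightarrow> (AE \<omega> in Q. P \<omega>)"
      by (elim bexE conjE)
    have "connected_in S (cluster S x b)" for x :: "'g \<Rightarrow> nat" and b
      by (rule connected_in_cluster) (rule cl.E_sym)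
    then have "AE \<omega> in Q. connected_in S \<omega>"
      using AE_Q conn_meas by blast
    with Q show ?thesis by blast
  qed
  with S show ?thesis by blast
qed

section \<open>The upper bound on the cost\<close>

lemma translate_apply [simp]: "translate h C (h + a) = C a"
  by (simp add: translate_def add.assoc[symmetric])

text \<open>The search runs through differences from \<open>v\<close>, which makes the choice
  equivariant under left translation.\<close>

definition attach :: "('g::group_add \<Rightarrow> bool) \<Rightarrow> 'g \<Rightarrow> 'g" where
  "attach C v = v + from_nat_into UNIV (LEAST i. C (v + from_nat_into UNIV i))"

definition hook :: "('g::group_add \<Rightarrow> bool) \<Rightarrow> 'g \<Rightarrow> 'g \<Rightarrow> bool" where
  "hook C a b \<longleftrightarrow> \<not> C a \<and> b = attach C a"

text \<open>Off the event that \<open>C\<close> is connected, the complete graph is an equivariant default value.\<close>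

definition spanning_graph :: "'g::group_add set \<Rightarrow> ('g \<Rightarrow> bool) \<Rightarrow> 'g \<times> 'g \<Rightarrow> bool" where
  "spanning_graph S C = (\<lambda>(a, b). a \<noteq> b \<and>
     (connected_in S C \<longrightarrow> C a \<and> C b \<and> - a + b \<in> S \<or> hook C a b \<or> hook C b a))"

lemma attach_in:
  fixes v :: "'g::group_add"
  assumes "countable (UNIV :: 'g set)" "C c"
  shows "C (attach C v)"
proof -
  obtain i where "from_nat_into UNIV i = - v + c"
    using from_nat_into_surj[OF assms(1), of "- v + c"] by auto
  then have "C (v + from_nat_into UNIV i)" using assms(2) by (simp add: add.assoc[symmetric])
  then show ?thesis unfolding attach_def by (rule LeastI)
qed

lemma attach_translate: "attach (translate h C) (h + v) = h + attach C v"
  by (simp add: attach_def add.assoc)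

lemma hook_translate: "hook (translate h C) (h + a) (h + b) \<longleftrightarrow> hook C a b"
  by (simp add: hook_def attach_translate)

lemma minus_translate: "- (g + a) + (g + b) = - a + (b :: 'g::group_add)"
  by (simp add: minus_add add.assoc) (simp add: add.assoc[symmetric])

lemma connected_in_translate_imp:
  assumes "connected_in S C"
  shows "connected_in S (translate h C)"
proof -
  let ?T = "translate h C"
  have path: "(\<lambda>u v. ?T u \<and> ?T v \<and> - u + v \<in> S)\<^sup>*\<^sup>* (h + a) (h + b)"
    if "(\<lambda>u v. C u \<and> C v \<and> - u + v \<in> S)\<^sup>*\<^sup>* a b" for a b
    using that
  proof (induction rule: rtranclp_induct)
    case (step u v)
    then have "?T (h + u) \<and> ?T (h + v) \<and> - (h + u) + (h + v) \<in> S"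
      by (simp add: minus_translate)
    with step.IH show ?case by (rule rtranclp.rtrancl_into_rtrancl)
  qed simp
  have "(\<lambda>u v. ?T u \<and> ?T v \<and> - u + v \<in> S)\<^sup>*\<^sup>* a b" if "?T a" "?T b" for a b
    using path[of "- h + a" "- h + b"] assms that
    by (simp add: connected_in_def translate_def add.assoc[symmetric])
  moreover obtain c where "C c" using assms by (auto simp: connected_in_def)
  then have "?T (h + c)" by simp
  ultimately show ?thesis unfolding connected_in_def by blast
qed

lemma translate_translate: "translate g (translate h C) = translate (g + h) C"
  by (simp add: translate_eq_shift shift_shift)

lemma connected_in_translate: "connected_in S (translate h C) \<longleftrightarrow> connected_in S C"
  using connected_in_translate_imp[of S C h] connected_in_translate_imp[of S "translate h C" "- h"]
  by (auto simp: translate_translate) (simp add: translate_eq_shift)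

lemma spanning_graph_translate: "spanning_graph S (translate h C) = graph_act h (spanning_graph S C)"
proof (rule ext, clarify)
  fix a b
  have "spanning_graph S (translate h C) (h + (- h + a), h + (- h + b)) = spanning_graph S C (- h + a, - h + b)"
    unfolding spanning_graph_def by (simp only: case_prod_conv hook_translate connected_in_translate minus_translate translate_apply add_left_cancel)
  then show "spanning_graph S (translate h C) (a, b) = graph_act h (spanning_graph S C) (a, b)"
    by (simp add: graph_act_def add.assoc[symmetric])
qed

lemma spanning_graph_connected:
  fixes S :: "'g::group_add set"
  assumes cnt: "countable (UNIV :: 'g set)" and S: "\<And>s. s \<in> S \<Longrightarrow> - s \<in> S"
  shows "spanning_graph S C \<in> connected_graphs"
proof -
  let ?G = "spanning_graph S C"
  have S': "- a + b \<in> S \<longleftrightarrow> - b + a \<in> S" for a b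
    using S[of "- a + b"] S[of "- b + a"] by (auto simp: minus_add)
  have sym: "?G (a, b) = ?G (b, a)" for a b
    using S'[of a b] by (auto simp: spanning_graph_def)
  have "(\<lambda>u v. ?G (u, v))\<^sup>*\<^sup>* a b" for a b
  proof (cases "connected_in S C")
    case False
    then show ?thesis
      by (cases "a = b") (auto simp: spanning_graph_def intro!: r_into_rtranclp)
  next
    case True
    then obtain c where c: "C c" by (auto simp: connected_in_def)
    have inside: "(\<lambda>u v. ?G (u, v))\<^sup>*\<^sup>* u v" if "C u" "C v" for u v
    proof -
      have "(\<lambda>u v. C u \<and> C v \<and> - u + v \<in> S)\<^sup>*\<^sup>* u v"
        using True that by (auto simp: connected_in_def)
      then show ?thesis
      proof (induction rule: rtranclp_induct)
        case (step v w)
        \<comment> \<open>\<open>S\<close> may contain 0, and the resulting stationary steps are no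
          edges.\<close>
        then show ?case
          by (cases "v = w") (auto simp: spanning_graph_def intro: rtranclp.rtrancl_into_rtrancl)
      qed simp
    qed
    have out: "\<exists>u. C u \<and> (\<lambda>u v. ?G (u, v))\<^sup>*\<^sup>* v u \<and> (\<lambda>u v. ?G (u, v))\<^sup>*\<^sup>* u v" for v
    proof (cases "C v")
      case False
      let ?u = "attach C v"
      have "C ?u" by (rule attach_in[where C = C, OF cnt c])
      moreover have "?G (v, ?u)"
        using False \<open>C ?u\<close> by (auto simp: spanning_graph_def hook_def)
      moreover have "?G (?u, v)" using \<open>?G (v, ?u)\<close> sym by blast
      ultimately show ?thesis by (intro exI[of _ ?u]) (auto intro!: r_into_rtranclp)
    qed auto
    obtain u v where "C u" "C v" "(\<lambda>u v. ?G (u, v))\<^sup>*\<^sup>* a u" "(\<lambda>u v. ?G (u, v))\<^sup>*\<^sup>* v b"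
      using out by metis
    with inside[of u v] show ?thesis by (meson rtranclp_trans)
  qed
  with sym show ?thesis
    by (auto simp: connected_graphs_def) (simp add: spanning_graph_def)
qed

section \<open>Measurability and expected degree of the spanning graph\<close>

lemma pred_hook:
  fixes a b :: "'g::group_add"
  assumes cnt: "countable (UNIV :: 'g set)"
  shows "Measurable.pred borel (\<lambda>C. hook C a b)"
proof -
  note [measurable] = sets_coordinate[OF cnt]
  have [measurable]: "(\<lambda>C. attach C a) \<in> measurable borel (count_space UNIV)"
    unfolding attach_def by measurable
  show ?thesis unfolding hook_def by measurable
qed

lemma pred_connected_in:
  fixes S :: "'g::group_add set"
  assumes cnt: "countable (UNIV :: 'g set)"
  shows "Measurable.pred borel (connected_in S)"
proof -
  note [measurable] = sets_coordinate[OF cnt]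
  show ?thesis
    unfolding connected_in_def
    by (intro pred_countable_All pred_countable_Ex pred_intros_logic pred_rtranclp cnt) measurable
qed

lemma measurable_spanning_graph:
  fixes S :: "'g::group_add set"
  assumes cnt: "countable (UNIV :: 'g set)" and S: "\<And>s. s \<in> S \<Longrightarrow> - s \<in> S"
  shows "spanning_graph S \<in> measurable borel (restrict_space borel connected_graphs)"
proof (rule measurable_restrict_space2)
  show "spanning_graph S \<in> space borel \<rightarrow> connected_graphs"
    using spanning_graph_connected[OF cnt S] by auto
  note [measurable] = sets_coordinate[OF cnt] pred_hook[OF cnt] pred_connected_in[OF cnt]
  have "spanning_graph S \<in> measurable borel (PiM UNIV (\<lambda>_. count_space UNIV))"
  proof (rule measurable_PiM_single')
    fix e :: "'g \<times> 'g"
    show "(\<lambda>C. spanning_graph S C e) \<in> measurable borel (count_space UNIV)"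
      by (cases e) (simp add: spanning_graph_def)
  qed auto
  then show "spanning_graph S \<in> borel_measurable borel"
    using measurable_cong_sets[OF refl borel_eq_PiM_bool[OF countable_UNIV_prod[OF cnt]]] by blast
qed

text \<open>The vertex 0 has at most one hook of its own and edges along \<open>S\<close> only when
  it belongs to \<open>C\<close>. As each vertex sends at most one hook, mass transport shows that 0
  receives at most one on average.\<close>

lemma cost_le:
  fixes S :: "'g::group_add set"
  assumes cnt: "countable (UNIV :: 'g set)" and S: "finite S" "\<And>s. s \<in> S \<Longrightarrow> - s \<in> S"
    and Q: "Q \<in> invariant_prob_measures (translate :: 'g \<Rightarrow> _) borel" and conn: "AE C in Q. connected_in S C"
  shows "cost TYPE('g) \<le> (2 + of_nat (card S) * emeasure Q {C. C 0}) / 2"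
proof -
  have sets: "sets Q = sets borel" and Q_act: "\<And>g. distr Q borel (translate g) = Q"
    using Q unfolding invariant_prob_measures_def by blast+
  interpret prob_space Q using Q unfolding invariant_prob_measures_def by blast
  have Qm: "measurable Q N = measurable borel N" for N :: "'n measure"
    by (rule measurable_cong_sets[OF sets refl])
  have Gm: "spanning_graph S \<in> measurable Q (restrict_space borel connected_graphs)"
    using measurable_spanning_graph[OF cnt S(2)] measurable_cong_sets[OF sets refl] by blast
  have tm: "translate g \<in> measurable Q borel" for g
    using measurable_translate measurable_cong_sets[OF sets refl] by blast
  let ?\<mu> = "distr Q (restrict_space borel connected_graphs) (spanning_graph S)"
  have "distr ?\<mu> (restrict_space borel connected_graphs) (graph_act g) = ?\<mu>" for g
  proof -
    have "distr ?\<mu> (restrict_space borel connected_graphs) (graph_act g) =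
        distr Q (restrict_space borel connected_graphs) (graph_act g \<circ> spanning_graph S)"
      by (rule distr_distr[OF measurable_graph_act Gm])
    also have "graph_act g \<circ> spanning_graph S = spanning_graph S \<circ> translate g"
      by (simp add: fun_eq_iff spanning_graph_translate)
    also have "distr Q (restrict_space borel connected_graphs) (spanning_graph S \<circ> translate g) =
        distr (distr Q borel (translate g)) (restrict_space borel connected_graphs) (spanning_graph S)"
      by (rule distr_distr[OF measurable_spanning_graph[OF cnt S(2)] tm, symmetric])
    finally show ?thesis by (simp add: Q_act)
  qed
  then have \<mu>: "?\<mu> \<in> invariant_prob_measures graph_act (restrict_space borel connected_graphs)"
    using prob_space_distr[OF Gm] by (simp add: invariant_prob_measures_def)
  have hook_m: "(\<lambda>C. indicator {C. hook C a b} C :: ennreal) \<in> borel_measurable borel" for a b :: 'g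
    using pred_hook[OF cnt, of a b] by (intro borel_measurable_indicator) (simp add: pred_def)
  have C0: "{C :: 'g \<Rightarrow> bool. C 0} \<in> sets Q"
    using sets_coordinate[OF cnt, of 0] by (simp add: pred_def sets)
  define h where "h a b = (\<integral>\<^sup>+C. indicator {C. hook C a b} C \<partial>Q)" for a b :: 'g
  have h_translate: "h (g + a) (g + b) = h a b" for g a b
  proof -
    have "h (g + a) (g + b) = (\<integral>\<^sup>+C. indicator {C. hook C (g + a) (g + b)} C \<partial>distr Q borel (translate g))"
      by (simp add: h_def Q_act)
    also have "\<dots> = (\<integral>\<^sup>+C. indicator {C. hook C (g + a) (g + b)} (translate g C) \<partial>Q)"
      using hook_m by (intro nn_integral_distr tm) simp
    also have "\<dots> = h a b" by (simp add: h_def indicator_def hook_translate)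
    finally show ?thesis .
  qed
  have swap: "(\<integral>\<^sup>+C. \<integral>\<^sup>+b. indicator {C. hook C (f b) (f' b)} C \<partial>count_space UNIV \<partial>Q) = (\<integral>\<^sup>+b. h (f b) (f' b) \<partial>count_space UNIV)"
    for f f' :: "'g \<Rightarrow> 'g"
    unfolding h_def using hook_m by (intro nn_integral_count_space_nn_integral cnt) (simp add: Qm)
  have "(\<integral>\<^sup>+C. \<integral>\<^sup>+b. indicator {C. hook C b 0} C \<partial>count_space UNIV \<partial>Q) = (\<integral>\<^sup>+b. h b 0 \<partial>count_space UNIV)"
    using swap[of "\<lambda>b. b" "\<lambda>_. 0"] .
  also have "\<dots> = (\<integral>\<^sup>+b. h (- b) 0 \<partial>count_space UNIV)"
    by (intro nn_integral_bij_count_space[symmetric] bij_betw_byWitness[where f' = uminus]) auto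
  also have "\<dots> = (\<integral>\<^sup>+b. h 0 b \<partial>count_space UNIV)"
    using h_translate[of b "- b" 0 for b] by simp
  also have "\<dots> = (\<integral>\<^sup>+C. \<integral>\<^sup>+b. indicator {C. hook C 0 b} C \<partial>count_space UNIV \<partial>Q)"
    using swap[of "\<lambda>_. 0" "\<lambda>b. b", symmetric] .
  also have "\<dots> \<le> (\<integral>\<^sup>+C. 1 \<partial>Q)"
  proof (intro nn_integral_mono)
    fix C :: "'g \<Rightarrow> bool"
    have "(\<integral>\<^sup>+b. indicator {C. hook C 0 b} C \<partial>count_space UNIV) \<le> (\<integral>\<^sup>+b. indicator {attach C 0} b \<partial>count_space UNIV)"
      by (intro nn_integral_mono) (auto simp: hook_def indicator_def)
    also have "\<dots> = 1" by simp
    finally show "(\<integral>\<^sup>+b. indicator {C. hook C 0 b} C \<partial>count_space UNIV) \<le> (1 :: ennreal)" .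
  qed
  also have "\<dots> = 1" by (simp add: emeasure_space_1)
  finally have hooks: "(\<integral>\<^sup>+C. \<integral>\<^sup>+b. indicator {C. hook C b 0} C \<partial>count_space UNIV \<partial>Q) \<le> 1" .
  have hooks_m: "(\<lambda>C. \<integral>\<^sup>+b. indicator {C. hook C b 0} C \<partial>count_space UNIV :: ennreal) \<in> borel_measurable Q"
  proof -
    have "(\<lambda>q. indicator {C. hook C (fst q) 0} (snd q) :: ennreal) \<in> borel_measurable (count_space UNIV \<Otimes>\<^sub>M Q)"
      using hook_m by (intro measurable_pair_measure_countable1[OF cnt]) (simp add: Qm)
    from measurable_compose[OF measurable_pair_swap' this]
    show ?thesis
      by (intro sigma_finite_measure.borel_measurable_nn_integral sigma_finite_measure_count_space_countable cnt) (simp add: case_prod_beta')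
  qed
  have degree: "AE C in Q. graph_degree (spanning_graph S C) 0 \<le>
      1 + (of_nat (card S) * indicator {C. C 0} C + (\<integral>\<^sup>+b. indicator {C. hook C b 0} C \<partial>count_space UNIV))"
    using conn
  proof eventually_elim
    case (elim C)
    \<comment> \<open>The vertex \<open>attach C 0\<close> is counted even when 0 lies in
      \<open>C\<close>, so that the constant term is 1 throughout.\<close>
    have "{b. spanning_graph S C (0, b)} \<subseteq> {attach C 0} \<union> ((if C 0 then S else {}) \<union> {b. hook C b 0})"
      using elim by (auto simp: spanning_graph_def hook_def)
    then have "graph_degree (spanning_graph S C) 0 \<le>
        emeasure (count_space UNIV) ({attach C 0} \<union> ((if C 0 then S else {}) \<union> {b. hook C b 0}))"
      unfolding graph_degree_def by (intro emeasure_mono) auto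
    also have "\<dots> \<le> emeasure (count_space UNIV) {attach C 0} +
        (emeasure (count_space UNIV) (if C 0 then S else {}) + emeasure (count_space UNIV) {b. hook C b 0})"
      by (intro order.trans[OF emeasure_subadditive] add_mono emeasure_subadditive) auto
    also have "emeasure (count_space UNIV) (if C 0 then S else {}) = of_nat (card S) * indicator {C. C 0} C"
      using S(1) by simp
    also have "emeasure (count_space UNIV) {b. hook C b 0} = (\<integral>\<^sup>+b. indicator {C. hook C b 0} C \<partial>count_space UNIV)"
      by (simp add: indicator_def emeasure_count_space_Collect)
    finally show ?case by simp
  qed
  have "(\<integral>\<^sup>+\<omega>. graph_degree \<omega> 0 \<partial>?\<mu>) = (\<integral>\<^sup>+C. graph_degree (spanning_graph S C) 0 \<partial>Q)"
  proof (rule nn_integral_distr[OF Gm])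
    have "(\<lambda>q. of_bool (snd q (0, fst q)) :: ennreal) \<in>
        borel_measurable (count_space UNIV \<Otimes>\<^sub>M restrict_space (borel :: ('g \<times> 'g \<Rightarrow> bool) measure) connected_graphs)"
    proof (rule measurable_pair_measure_countable1[OF cnt])
      fix b :: 'g
      have "(\<lambda>\<omega>. \<omega> (0, b)) \<in> measurable (restrict_space (borel :: ('g \<times> 'g \<Rightarrow> bool) measure) connected_graphs) (count_space UNIV)"
        by (intro measurable_restrict_space1 sets_coordinate countable_UNIV_prod cnt)
      then show "(\<lambda>\<omega>. of_bool (snd (b, \<omega>) (0, fst (b, \<omega>))) :: ennreal) \<in>
          borel_measurable (restrict_space (borel :: ('g \<times> 'g \<Rightarrow> bool) measure) connected_graphs)"
        by simp
    qed
    from measurable_compose[OF measurable_pair_swap' this]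
    have "(\<lambda>\<omega>. \<integral>\<^sup>+b. of_bool (\<omega> (0, b)) \<partial>count_space UNIV :: ennreal) \<in>
        borel_measurable (restrict_space (borel :: ('g \<times> 'g \<Rightarrow> bool) measure) connected_graphs)"
      by (intro sigma_finite_measure.borel_measurable_nn_integral sigma_finite_measure_count_space_countable cnt) (simp add: case_prod_beta')
    moreover have "graph_degree \<omega> 0 = (\<integral>\<^sup>+b. of_bool (\<omega> (0, b)) \<partial>count_space UNIV)" for \<omega> :: "'g \<times> 'g \<Rightarrow> bool"
      unfolding graph_degree_def by (rule emeasure_count_space_Collect)
    ultimately show "(\<lambda>\<omega>. graph_degree \<omega> 0) \<in> borel_measurable ?\<mu>" by simp
  qed
  also have "\<dots> \<le> (\<integral>\<^sup>+C. 1 + (of_nat (card S) * indicator {C. C 0} C + (\<integral>\<^sup>+b. indicator {C. hook C b 0} C \<partial>count_space UNIV)) \<partial>Q)"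
    by (rule nn_integral_mono_AE[OF degree])
  also have "\<dots> = 1 + (of_nat (card S) * emeasure Q {C. C 0} + (\<integral>\<^sup>+C. \<integral>\<^sup>+b. indicator {C. hook C b 0} C \<partial>count_space UNIV \<partial>Q))"
    using C0 hooks_m by (simp add: nn_integral_add nn_integral_cmult emeasure_space_1)
  also have "\<dots> \<le> 1 + (of_nat (card S) * emeasure Q {C. C 0} + 1)"
    by (intro add_left_mono hooks)
  also have "\<dots> = 2 + of_nat (card S) * emeasure Q {C. C 0}"
    by (simp add: algebra_simps one_add_one[symmetric] del: one_add_one)
  finally show ?thesis
    unfolding cost_def using \<mu> by (intro divide_right_mono_ennreal INF_lower2[of ?\<mu>])
qed

theorem theorem1p2:
  assumes "countable (UNIV :: 'g::group_add set)"
    and "infinite (UNIV :: 'g set)"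
    and "kazhdan TYPE('g)"
  shows "cost TYPE('g) = 1"
proof (rule antisym)
  show "1 \<le> cost TYPE('g)" by (rule cost_ge_1[OF assms(1,2)])
  obtain S :: "'g set" where S: "finite S" "\<And>s. s \<in> S \<Longrightarrow> - s \<in> S"
    and sparse: "\<And>k. 0 < k \<Longrightarrow> \<exists>Q \<in> invariant_prob_measures (translate :: 'g \<Rightarrow> _) borel.
      measure Q {\<omega>. \<omega> 0} \<le> 1 / real k \<and> (AE \<omega> in Q. connected_in S \<omega>)"
    using sparse_connected_sets[OF assms] by blast
  \<comment> \<open>\<open>S\<close> is fixed before \<open>n\<close>, so the excess
    \<open>card S * (1 / Suc n)\<close> vanishes in the limit.\<close>
  have le: "cost TYPE('g) \<le> ennreal ((2 + card S * (1 / Suc n)) / 2)" for n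
  proof -
    obtain Q where Q: "Q \<in> invariant_prob_measures (translate :: 'g \<Rightarrow> _) borel"
      "measure Q {\<omega>. \<omega> 0} \<le> 1 / real (Suc n)" "AE \<omega> in Q. connected_in S \<omega>"
      using sparse[of "Suc n"] by auto
    interpret prob_space Q using Q(1) unfolding invariant_prob_measures_def by blast
    have "cost TYPE('g) \<le> (2 + of_nat (card S) * emeasure Q {C. C 0}) / 2"
      by (rule cost_le[OF assms(1) S Q(1,3)])
    also have "\<dots> \<le> (2 + of_nat (card S) * ennreal (1 / Suc n)) / 2"
      using Q(2) by (intro divide_right_mono_ennreal add_left_mono mult_left_mono)
        (simp_all add: emeasure_eq_measure ennreal_leI)
    also have "\<dots> = (ennreal 2 + ennreal (card S * (1 / Suc n))) / ennreal 2"
      by (simp only: ennreal_mult of_nat_0_le_iff divide_nonneg_nonneg zero_le_one ennreal_of_nat_eq_real_of_nat ennreal_numeral zero_le_divide_1_iff)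
    also have "\<dots> = ennreal ((2 + card S * (1 / Suc n)) / 2)"
      by (subst ennreal_plus[symmetric], simp, simp, subst divide_ennreal) auto
    finally show ?thesis .
  qed
  have "(\<lambda>n. (2 + real (card S) * (1 / real (Suc n))) * (1 / 2)) \<longlonglongrightarrow> (2 + real (card S) * 0) * (1 / 2)"
    by (intro tendsto_mult tendsto_add tendsto_const LIMSEQ_Suc[OF lim_1_over_n])
  then have "(\<lambda>n. ennreal ((2 + card S * (1 / Suc n)) / 2)) \<longlonglongrightarrow> ennreal ((2 + card S * 0) / 2)"
    by (intro tendsto_ennrealI) simp
  then have "cost TYPE('g) \<le> ennreal ((2 + card S * 0) / 2)"
    by (rule LIMSEQ_le_const) (use le in blast)
  then show "cost TYPE('g) \<le> 1" by simp
qed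

end
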